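(* Let $E=[n]\cup[n]^*$ and let $F$ be a tract endowed with an involution $x\mapsto\overline{x}$. Then there are natural bijections between: (1) strong orthogonal $F$-matroids on $E$; (2) strong orthogonal $F$-signatures on $E$; (3) strong $F$-circuit sets of orthogonal matroids on $E$; (4) orthogonal $F$-vector sets on $E$.
   Context: **Tracts.** A tract $F=(G,N_F)$ is an abelian group $G$ (written multiplicatively) with a subset $N_F$ of the group semiring $\mathbb{N}[G]$ such that: $0\in N_F$; $1\notin N_F$; there is a unique $\epsilon\in G$ with $1+\epsilon\in N_F$; and $g\in G$, $a\in N_F$ imply $ga\in N_F$. Write $F$ also for the set $G\cup\{0\}$ (with $0\cdot x=0$), $F^\times=G$, $-1:=\epsilon$, $-x:=\epsilon x$. Formal sums of elements of $F$ are regarded as elements of $\mathbb{N}[G]$ ($0\in F$ being the zero of $\mathbb{N}[G]$). A tract homomorphism $F_1\to F_2$ is a group homomorphism $F_1^\times\to F_2^\times$ (extended by $0\mapsto 0$) whose induced map $\mathbb{N}[F_1^\times]\to\mathbb{N}[F_2^\times]$ sends $N_{F_1}$ into $N_{F_2}$. An involution of $F$ is a tract homomorphism $F\to F$ whose square is the identity. **Orthogonal matroids.** $E=[n]\cup[n]^*=\{1,\dots,n\}\cup\{1^*,\dots,n^*\}$ with the involution $*$ exchanging $i$ and $i^*$. For $A\subseteq E$ let $A^*=\{a^*:a\in A\}$. $A$ is admissible if $A\cap A^*=\emptyset$; a transversal is an admissible set with $n$ elements; $\mathcal{T}_n$ is the set of transversals. $\triangle$ is symmetric difference. An orthogonal matroid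 on $E$ is a pair $\underline{M}=(E,\mathcal{B})$ with $\mathcal{B}$ a nonempty set of transversals (bases) such that for $B_1,B_2\in\mathcal{B}$ and every $\{x_1,x_1^*\}\subseteq B_1\triangle B_2$ there is $\{x_2,x_2^*\}\subseteq B_1\triangle B_2$ with $\{x_2,x_2^*\}\neq\{x_1,x_1^*\}$ and $B_1\triangle\{x_1,x_1^*,x_2,x_2^*\}\in\mathcal{B}$. A circuit is an inclusion-minimal admissible subset of $E$ not contained in a basis. For a basis $B$ and $e\in E\setminus B=B^*$, $C(B,e)$ is the unique circuit contained in $B\cup\{e\}$. **Strong orthogonal $F$-matroids.** A strong Wick function on $E$ with coefficients in $F$ is a map $\varphi:\mathcal{T}_n\to F$, not identically zero, such that for all $T_1,T_2\in\mathcal{T}_n$, writing $(T_1\triangle T_2)\cap[n]=\{x_1<\dots<x_m\}$, we have $\sum_{k=1}^m(-1)^k\varphi(T_1\triangle\{x_k,x_k^*\})\varphi(T_2\triangle\{x_k,x_k^*\})\in N_F$. Two such functions are equivalent if one is a multiple of the other by an element of $F^\times$; an equivalence class $[\varphi]$ is a strong orthogonal $F$-matroid. **Vectors.** For $X\in F^E$: $\underline{X}=\{i\in E:X(i)\neq0\}$ is the support; $X^*(i)=X(i^* )$; $\tilde X(i)=X(i)$ for $i\in[n]$ and $\tilde X(i)=\overline{X(i)}$ for $i\in[n]^*$. The inner product is $\langle X,Y\rangle=\sum_{i\in[n]}(X(i)\overline{Y(i)}+\overline{X(i^* )}Y(i^* ))$, so $\langle X,Y^*\rangle=\sum_{i\in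 E}\tilde X(i)\tilde Y(i^* )$. For $\alpha\in F$, $\alpha X$ is coordinatewise multiplication by $\alpha$. The linear span of $X_1,\dots,X_k\in F^E$ is the set of $X\in F^E$ for which there are $c_1,\dots,c_k\in F$ with $c_1X_1+\dots+c_kX_k-X\in(N_F)^E$ (coordinatewise). **Signatures and circuit sets.** An $F$-signature of an orthogonal matroid $\underline{M}$ on $E$ is a set $\mathcal{C}\subseteq F^E$ such that $\{\underline{X}:X\in\mathcal{C}\}$ is the set of circuits of $\underline{M}$ and $\alpha X\in\mathcal{C}$ for all $X\in\mathcal{C}$, $\alpha\in F^\times$. It is a strong orthogonal $F$-signature of $\underline{M}$ if $\langle X,Y^*\rangle\in N_F$ for all $X,Y\in\mathcal{C}$; a strong orthogonal $F$-signature on $E$ is a strong orthogonal $F$-signature of some orthogonal matroid on $E$. A strong $F$-circuit set of $\underline{M}$ is an $F$-signature $\mathcal{C}$ of $\underline{M}$ such that (O$_2$) $\langle X,Y^*\rangle\in N_F$ for all $X,Y\in\mathcal{C}$ with $|\underline{X}\cap\underline{Y}^*|=2$, and (L) for every $X\in\mathcal{C}$ and basis $B$ of $\underline{M}$, $\tilde X$ is in the linear span of $\{\tilde X_e\}_{e\in B^*}$, where $X_e\in\mathcal{C}$ has support $C(B,e)$. **Orthogonal vector sets.** Let $\mathcal{V}\subseteq F^E$. A vector $X\in\mathcal{V}$ is elementary in $\mathcal{V}$ if it is nonzero, its support is minimal among supports of elements of $\mathcal{V}\setminus\{\mathbf{0}\}$, and its support is admissible. A transversal $T$ is a support basis of $\mathcal{V}$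 if no $X\in\mathcal{V}\setminus\{\mathbf{0}\}$ has $\underline{X}\subseteq T$. A fundamental circuit form for $\mathcal{V}$ with respect to a support basis $B$ is a family $\{X_e:e\in B^*\}\subseteq\mathcal{V}$ with $\underline{X_e}\subseteq B\triangle\{e,e^*\}$ and $X_e(e)=1$. $\mathcal{V}$ is an orthogonal $F$-vector set if: (V1) for all elementary $X,Y\in\mathcal{V}$ with $|\underline{X}\cap\underline{Y}^*|\leq2$, $\langle X,Y^*\rangle\in N_F$; (V2) support bases exist, and each support basis has a fundamental circuit form; (V3) $\mathcal{V}$ is exactly the set of $X\in F^E$ such that for every support basis $B$ of $\mathcal{V}$, $\tilde X$ belongs to the linear span of $\{\tilde X_e:e\in B^*\}$, where $\{X_e\}$ is the fundamental circuit form with respect to $B$.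
   Formalization: In F-signatures, αX multiplies coordinates in [n] by α and those in [n]* by the conjugate of α, not all by α; with plain coordinatewise scaling the claim fails for nontrivial involutions (n=2, bases {1,2},{1*,2*}). For the trivial involution nothing changes. *)

theory Defs
  imports "HOL-Algebra.Group" "HOL-Library.Multiset"
begin

section \<open>Tracts\<close>

text \<open>
  Elements of the group semiring \<open>\<nat>[G]\<close> are finite formal sums of elements of \<open>G\<close>, i.e. finite
  multisets over \<open>G\<close>: addition is multiset union, \<open>0\<close> is \<open>{#}\<close>, and multiplication by \<open>g\<close> is
  \<open>image_mset ((\<otimes>) g)\<close>.
\<close>

record 'g tract = "'g monoid" +
  nulls :: "'g multiset set"

definition group_semiring :: "('g, 'b) monoid_scheme \<Rightarrow> 'g multiset set" where
  "group_semiring G = {a. set_mset a \<subseteq> carrier G}"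

locale tract = comm_group F for F :: "('g, 'b) tract_scheme" (structure) +
  assumes nulls_subset: "nulls F \<subseteq> group_semiring F"
    and zero_null: "{#} \<in> nulls F"
    and one_not_null: "{#\<one>#} \<notin> nulls F"
    and unique_eps: "\<exists>!\<epsilon>. \<epsilon> \<in> carrier F \<and> {#\<one>, \<epsilon>#} \<in> nulls F"
    and nulls_scale: "\<And>g a. g \<in> carrier F \<Longrightarrow> a \<in> nulls F \<Longrightarrow> image_mset (\<lambda>x. g \<otimes> x) a \<in> nulls F"

definition tract_hom :: "('g, 'b) tract_scheme \<Rightarrow> ('h, 'c) tract_scheme \<Rightarrow> ('g \<Rightarrow> 'h) set" where
  "tract_hom F1 F2 = {h \<in> hom F1 F2. \<forall>a \<in> nulls F1. image_mset h a \<in> nulls F2}"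

definition tract_involution :: "('g, 'b) tract_scheme \<Rightarrow> ('g \<Rightarrow> 'g) \<Rightarrow> bool" where
  "tract_involution F \<sigma> \<longleftrightarrow> \<sigma> \<in> tract_hom F F \<and> (\<forall>x \<in> carrier F. \<sigma> (\<sigma> x) = x)"

text \<open>The set \<open>F = G \<union> {0}\<close> is \<open>tract_elems F\<close>; its zero is \<^term>\<open>None\<close>.\<close>

definition tract_elems :: "('g, 'b) tract_scheme \<Rightarrow> 'g option set" where
  "tract_elems F = insert None (Some ` carrier F)"

fun tmult :: "('g, 'b) tract_scheme \<Rightarrow> 'g option \<Rightarrow> 'g option \<Rightarrow> 'g option" where
  "tmult F (Some x) (Some y) = Some (x \<otimes>\<^bsub>F\<^esub> y)"
| "tmult F _ _ = None"

definition tract_eps :: "('g, 'b) tract_scheme \<Rightarrow> 'g" where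
  "tract_eps F = (THE \<epsilon>. \<epsilon> \<in> carrier F \<and> {#\<one>\<^bsub>F\<^esub>, \<epsilon>#} \<in> nulls F)"

text \<open>\<open>(-1)\<^sup>k\<close> as an element of \<open>F\<close>.\<close>

definition tsign :: "('g, 'b) tract_scheme \<Rightarrow> nat \<Rightarrow> 'g option" where
  "tsign F k = Some (tract_eps F [^]\<^bsub>F\<^esub> k)"

definition tneg :: "('g, 'b) tract_scheme \<Rightarrow> 'g option \<Rightarrow> 'g option" where
  "tneg F x = tmult F (Some (tract_eps F)) x"

abbreviation tconj :: "('g \<Rightarrow> 'g) \<Rightarrow> 'g option \<Rightarrow> 'g option" where
  "tconj \<sigma> \<equiv> map_option \<sigma>"

text \<open>An element of \<open>F\<close> regarded as an element of \<open>\<nat>[G]\<close>; formal sums are ordinary sums of these.\<close>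

fun formal :: "'g option \<Rightarrow> 'g multiset" where
  "formal None = {#}"
| "formal (Some x) = {#x#}"


section \<open>Orthogonal matroids\<close>

datatype elt = Plain nat | Starred nat

fun star :: "elt \<Rightarrow> elt" where
  "star (Plain i) = Starred i"
| "star (Starred i) = Plain i"

fun index :: "elt \<Rightarrow> nat" where
  "index (Plain i) = i"
| "index (Starred i) = i"

definition ground :: "nat \<Rightarrow> elt set" where
  "ground n = Plain ` {1..n} \<union> Starred ` {1..n}"

definition admissible :: "nat \<Rightarrow> elt set \<Rightarrow> bool" where
  "admissible n A \<longleftrightarrow> A \<subseteq> ground n \<and> A \<inter> star ` A = {}"

definition transversals :: "nat \<Rightarrow> elt set set" where
  "transversals n = {T. admissible n T \<and> card T = n}"

definition orthogonal_matroid :: "nat \<Rightarrow> elt set set \<Rightarrow> bool" where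
  "orthogonal_matroid n \<B> \<longleftrightarrow>
     \<B> \<noteq> {} \<and> \<B> \<subseteq> transversals n \<and>
     (\<forall>B1 \<in> \<B>. \<forall>B2 \<in> \<B>. \<forall>x1. {x1, star x1} \<subseteq> sym_diff B1 B2 \<longrightarrow>
        (\<exists>x2. {x2, star x2} \<subseteq> sym_diff B1 B2 \<and> {x2, star x2} \<noteq> {x1, star x1} \<and>
              sym_diff B1 {x1, star x1, x2, star x2} \<in> \<B>))"

definition dependent :: "nat \<Rightarrow> elt set set \<Rightarrow> elt set \<Rightarrow> bool" where
  "dependent n \<B> A \<longleftrightarrow> admissible n A \<and> (\<forall>B \<in> \<B>. \<not> A \<subseteq> B)"

definition circuits :: "nat \<Rightarrow> elt set set \<Rightarrow> elt set set" where
  "circuits n \<B> = {C. dependent n \<B> C \<and> (\<forall>D. D \<subset> C \<longrightarrow> \<not> dependent n \<B> D)}"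

definition fund_circuit :: "nat \<Rightarrow> elt set set \<Rightarrow> elt set \<Rightarrow> elt \<Rightarrow> elt set" where
  "fund_circuit n \<B> B e = (THE C. C \<in> circuits n \<B> \<and> C \<subseteq> insert e B)"


section \<open>Strong orthogonal matroids over a tract\<close>

text \<open>
  Functions on the transversals are extended by \<open>0\<close> to all subsets. In the sum, \<open>x\<close> runs over
  \<open>(T1 \<triangle> T2) \<inter> [n]\<close>, and the exponent is the position of \<open>x\<close> in the increasing enumeration of
  that set.
\<close>

definition strong_wick :: "('g, 'b) tract_scheme \<Rightarrow> nat \<Rightarrow> (elt set \<Rightarrow> 'g option) set" where
  "strong_wick F n = {\<phi>.
     (\<forall>T \<in> transversals n. \<phi> T \<in> tract_elems F) \<and>
     (\<forall>T. T \<notin> transversals n \<longrightarrow> \<phi> T = None) \<and>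
     (\<exists>T \<in> transversals n. \<phi> T \<noteq> None) \<and>
     (\<forall>T1 \<in> transversals n. \<forall>T2 \<in> transversals n.
        let D = {i \<in> {1..n}. Plain i \<in> sym_diff T1 T2} in
        (\<Sum>x \<in> D. formal (tmult F (tsign F (card {y \<in> D. y \<le> x}))
            (tmult F (\<phi> (sym_diff T1 {Plain x, Starred x}))
                     (\<phi> (sym_diff T2 {Plain x, Starred x}))))) \<in> nulls F)}"

definition wick_equiv ::
    "('g, 'b) tract_scheme \<Rightarrow> nat \<Rightarrow> ((elt set \<Rightarrow> 'g option) \<times> (elt set \<Rightarrow> 'g option)) set" where
  "wick_equiv F n = {(\<phi>, \<psi>). \<phi> \<in> strong_wick F n \<and> \<psi> \<in> strong_wick F n \<and>
     (\<exists>c \<in> carrier F. \<psi> = (\<lambda>T. tmult F (Some c) (\<phi> T)))}"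

definition strong_orthogonal_matroids ::
    "('g, 'b) tract_scheme \<Rightarrow> nat \<Rightarrow> (elt set \<Rightarrow> 'g option) set set" where
  "strong_orthogonal_matroids F n = strong_wick F n // wick_equiv F n"


section \<open>Vectors\<close>

text \<open>The space \<open>F\<^sup>E\<close>; vectors are extended by \<open>0\<close> outside \<open>E\<close>.\<close>

definition vecs :: "('g, 'b) tract_scheme \<Rightarrow> nat \<Rightarrow> (elt \<Rightarrow> 'g option) set" where
  "vecs F n = {X. (\<forall>e \<in> ground n. X e \<in> tract_elems F) \<and> (\<forall>e. e \<notin> ground n \<longrightarrow> X e = None)}"

definition zero_vec :: "elt \<Rightarrow> 'g option" where
  "zero_vec = (\<lambda>_. None)"

definition supp :: "(elt \<Rightarrow> 'g option) \<Rightarrow> elt set" where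
  "supp X = {e. X e \<noteq> None}"

definition star_vec :: "(elt \<Rightarrow> 'g option) \<Rightarrow> elt \<Rightarrow> 'g option" where
  "star_vec X = (\<lambda>e. X (star e))"

definition tilde :: "('g \<Rightarrow> 'g) \<Rightarrow> (elt \<Rightarrow> 'g option) \<Rightarrow> elt \<Rightarrow> 'g option" where
  "tilde \<sigma> X = (\<lambda>e. case e of Plain i \<Rightarrow> X e | Starred i \<Rightarrow> tconj \<sigma> (X e))"

definition inner_prod ::
    "('g, 'b) tract_scheme \<Rightarrow> ('g \<Rightarrow> 'g) \<Rightarrow> nat \<Rightarrow> (elt \<Rightarrow> 'g option) \<Rightarrow> (elt \<Rightarrow> 'g option) \<Rightarrow> 'g multiset"
  where
  "inner_prod F \<sigma> n X Y =
     (\<Sum>i \<in> {1..n}. formal (tmult F (X (Plain i)) (tconj \<sigma> (Y (Plain i)))) +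
                   formal (tmult F (tconj \<sigma> (X (Starred i))) (Y (Starred i))))"

text \<open>
  Scalar multiplication, with \<open>(\<alpha> X)\<^sup>~ = \<alpha> X\<^sup>~\<close>: coordinates in \<open>[n]\<close> are multiplied by \<open>\<alpha>\<close> and
  coordinates in \<open>[n]\<^sup>*\<close> by the conjugate of \<open>\<alpha>\<close>. For the trivial involution this is the coordinatewise
  product with \<open>\<alpha>\<close> (lemma \<open>smult_trivial_involution\<close>). For a nontrivial involution the coordinatewise
  product with \<open>\<alpha>\<close> is incompatible with the pairing \<open>\<langle>X, Y\<^sup>*\<rangle>\<close>, which is bilinear in \<open>X\<^sup>~\<close> and
  \<open>Y\<^sup>~\<close>: if \<open>\<langle>X, Y\<^sup>*\<rangle>\<close> is a sum \<open>p + q\<close> of one nonzero term from each of its two halves, then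
  replacing \<open>X\<close> by that product gives \<open>\<alpha> p + \<alpha>' q\<close> with \<open>\<alpha>'\<close> the conjugate of \<open>\<alpha>\<close>, and both are null
  only if \<open>\<alpha>' = \<alpha>\<close>. So no signature closed under it could be orthogonal for the orthogonal matroid
  with bases \<open>{1, 2}\<close> and \<open>{1\<^sup>*, 2\<^sup>*}\<close>, although strong Wick functions with that support exist.
\<close>

definition smult ::
    "('g, 'b) tract_scheme \<Rightarrow> ('g \<Rightarrow> 'g) \<Rightarrow> 'g option \<Rightarrow> (elt \<Rightarrow> 'g option) \<Rightarrow> elt \<Rightarrow> 'g option" where
  "smult F \<sigma> \<alpha> X = (\<lambda>e. case e of Plain i \<Rightarrow> tmult F \<alpha> (X e) | Starred i \<Rightarrow> tmult F (tconj \<sigma> \<alpha>) (X e))"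

lemma smult_trivial_involution:
  assumes "\<forall>x \<in> carrier F. \<sigma> x = x" and "\<alpha> \<in> tract_elems F"
  shows "smult F \<sigma> \<alpha> X = (\<lambda>e. tmult F \<alpha> (X e))"
  using assms by (auto simp: smult_def tract_elems_def fun_eq_iff split: elt.split)

lemma tilde_smult:
  assumes "tract_involution F \<sigma>" and "\<alpha> \<in> tract_elems F" and "X \<in> vecs F n"
  shows "tilde \<sigma> (smult F \<sigma> \<alpha> X) = (\<lambda>e. tmult F \<alpha> (tilde \<sigma> X e))"
proof
  fix e
  have inv: "\<sigma> (\<sigma> x) = x" if "x \<in> carrier F" for x
    using assms(1) that by (simp add: tract_involution_def)
  have mul: "\<sigma> (x \<otimes>\<^bsub>F\<^esub> y) = \<sigma> x \<otimes>\<^bsub>F\<^esub> \<sigma> y" if "x \<in> carrier F" "y \<in> carrier F" for x y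
    using assms(1) that by (simp add: tract_involution_def tract_hom_def hom_def)
  have cl: "\<sigma> x \<in> carrier F" if "x \<in> carrier F" for x
    using assms(1) that by (auto simp: tract_involution_def tract_hom_def hom_def)
  have "X e \<in> tract_elems F"
    using assms(3) by (cases "e \<in> ground n") (auto simp: vecs_def tract_elems_def)
  then show "tilde \<sigma> (smult F \<sigma> \<alpha> X) e = tmult F \<alpha> (tilde \<sigma> X e)"
    using assms(2) by (auto simp: tilde_def smult_def tract_elems_def inv mul cl split: elt.split)
qed

definition lin_span ::
    "('g, 'b) tract_scheme \<Rightarrow> nat \<Rightarrow> elt set \<Rightarrow> (elt \<Rightarrow> elt \<Rightarrow> 'g option) \<Rightarrow> (elt \<Rightarrow> 'g option) set" where
  "lin_span F n I Xs = {X \<in> vecs F n. \<exists>c. (\<forall>i \<in> I. c i \<in> tract_elems F) \<and>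
     (\<forall>e \<in> ground n. (\<Sum>i \<in> I. formal (tmult F (c i) (Xs i e))) + formal (tneg F (X e)) \<in> nulls F)}"


section \<open>Signatures and circuit sets\<close>

definition signature ::
    "('g, 'b) tract_scheme \<Rightarrow> ('g \<Rightarrow> 'g) \<Rightarrow> nat \<Rightarrow> elt set set \<Rightarrow> (elt \<Rightarrow> 'g option) set \<Rightarrow> bool" where
  "signature F \<sigma> n \<B> \<C> \<longleftrightarrow>
     \<C> \<subseteq> vecs F n \<and> supp ` \<C> = circuits n \<B> \<and>
     (\<forall>X \<in> \<C>. \<forall>\<alpha> \<in> carrier F. smult F \<sigma> (Some \<alpha>) X \<in> \<C>)"

definition strong_orthogonal_signature_of ::
    "('g, 'b) tract_scheme \<Rightarrow> ('g \<Rightarrow> 'g) \<Rightarrow> nat \<Rightarrow> elt set set \<Rightarrow> (elt \<Rightarrow> 'g option) set \<Rightarrow> bool" where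
  "strong_orthogonal_signature_of F \<sigma> n \<B> \<C> \<longleftrightarrow>
     signature F \<sigma> n \<B> \<C> \<and>
     (\<forall>X \<in> \<C>. \<forall>Y \<in> \<C>. inner_prod F \<sigma> n X (star_vec Y) \<in> nulls F)"

definition strong_orthogonal_signatures ::
    "('g, 'b) tract_scheme \<Rightarrow> ('g \<Rightarrow> 'g) \<Rightarrow> nat \<Rightarrow> (elt \<Rightarrow> 'g option) set set" where
  "strong_orthogonal_signatures F \<sigma> n =
     {\<C>. \<exists>\<B>. orthogonal_matroid n \<B> \<and> strong_orthogonal_signature_of F \<sigma> n \<B> \<C>}"

text \<open>
  The vectors \<open>X\<^sub>e\<close> in the second condition are determined only up to scalars, which do not
  affect the span of the \<open>X\<^sub>e\<^sup>~\<close>; the condition is required for every choice.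
\<close>

definition strong_circuit_set_of ::
    "('g, 'b) tract_scheme \<Rightarrow> ('g \<Rightarrow> 'g) \<Rightarrow> nat \<Rightarrow> elt set set \<Rightarrow> (elt \<Rightarrow> 'g option) set \<Rightarrow> bool" where
  "strong_circuit_set_of F \<sigma> n \<B> \<C> \<longleftrightarrow>
     signature F \<sigma> n \<B> \<C> \<and>
     (\<forall>X \<in> \<C>. \<forall>Y \<in> \<C>. card (supp X \<inter> star ` supp Y) = 2 \<longrightarrow>
        inner_prod F \<sigma> n X (star_vec Y) \<in> nulls F) \<and>
     (\<forall>X \<in> \<C>. \<forall>B \<in> \<B>. \<forall>Xs.
        (\<forall>e \<in> star ` B. Xs e \<in> \<C> \<and> supp (Xs e) = fund_circuit n \<B> B e) \<longrightarrow>
        tilde \<sigma> X \<in> lin_span F n (star ` B) (\<lambda>e. tilde \<sigma> (Xs e)))"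

definition strong_circuit_sets ::
    "('g, 'b) tract_scheme \<Rightarrow> ('g \<Rightarrow> 'g) \<Rightarrow> nat \<Rightarrow> (elt \<Rightarrow> 'g option) set set" where
  "strong_circuit_sets F \<sigma> n =
     {\<C>. \<exists>\<B>. orthogonal_matroid n \<B> \<and> strong_circuit_set_of F \<sigma> n \<B> \<C>}"


section \<open>Orthogonal vector sets\<close>

definition elementary_vectors :: "nat \<Rightarrow> (elt \<Rightarrow> 'g option) set \<Rightarrow> (elt \<Rightarrow> 'g option) set" where
  "elementary_vectors n \<V> = {X \<in> \<V>. X \<noteq> zero_vec \<and>
     (\<forall>Y \<in> \<V> - {zero_vec}. \<not> supp Y \<subset> supp X) \<and> admissible n (supp X)}"

definition support_basis :: "nat \<Rightarrow> (elt \<Rightarrow> 'g option) set \<Rightarrow> elt set \<Rightarrow> bool" where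
  "support_basis n \<V> T \<longleftrightarrow> T \<in> transversals n \<and> \<not> (\<exists>X \<in> \<V> - {zero_vec}. supp X \<subseteq> T)"

definition fund_circuit_form ::
    "('g, 'b) tract_scheme \<Rightarrow> (elt \<Rightarrow> 'g option) set \<Rightarrow> elt set \<Rightarrow> (elt \<Rightarrow> elt \<Rightarrow> 'g option) \<Rightarrow> bool" where
  "fund_circuit_form F \<V> B Xs \<longleftrightarrow>
     (\<forall>e \<in> star ` B. Xs e \<in> \<V> \<and> supp (Xs e) \<subseteq> sym_diff B {e, star e} \<and> Xs e e = Some \<one>\<^bsub>F\<^esub>)"

text \<open>
  \<open>X\<close> is required to be in the span for every fundamental circuit form. If \<open>\<V>\<close> satisfies the
  conditions of \<open>orthogonal_vector_set\<close> below, there is exactly one such form for each support basis.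
\<close>

definition fundamental_span ::
    "('g, 'b) tract_scheme \<Rightarrow> ('g \<Rightarrow> 'g) \<Rightarrow> nat \<Rightarrow> (elt \<Rightarrow> 'g option) set \<Rightarrow> (elt \<Rightarrow> 'g option) set" where
  "fundamental_span F \<sigma> n \<V> = {X \<in> vecs F n.
     \<forall>B Xs. support_basis n \<V> B \<and> fund_circuit_form F \<V> B Xs \<longrightarrow>
       tilde \<sigma> X \<in> lin_span F n (star ` B) (\<lambda>e. tilde \<sigma> (Xs e))}"

definition orthogonal_vector_set ::
    "('g, 'b) tract_scheme \<Rightarrow> ('g \<Rightarrow> 'g) \<Rightarrow> nat \<Rightarrow> (elt \<Rightarrow> 'g option) set \<Rightarrow> bool" where
  "orthogonal_vector_set F \<sigma> n \<V> \<longleftrightarrow>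
     \<V> \<subseteq> vecs F n \<and>
     (\<forall>X \<in> elementary_vectors n \<V>. \<forall>Y \<in> elementary_vectors n \<V>.
        card (supp X \<inter> star ` supp Y) \<le> 2 \<longrightarrow> inner_prod F \<sigma> n X (star_vec Y) \<in> nulls F) \<and>
     (\<exists>B. support_basis n \<V> B) \<and>
     (\<forall>B. support_basis n \<V> B \<longrightarrow> (\<exists>Xs. fund_circuit_form F \<V> B Xs)) \<and>
     \<V> = fundamental_span F \<sigma> n \<V>"

definition orthogonal_vector_sets ::
    "('g, 'b) tract_scheme \<Rightarrow> ('g \<Rightarrow> 'g) \<Rightarrow> nat \<Rightarrow> (elt \<Rightarrow> 'g option) set set" where
  "orthogonal_vector_sets F \<sigma> n = {\<V>. orthogonal_vector_set F \<sigma> n \<V>}"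


section \<open>The natural maps\<close>

text \<open>
  For a strong Wick function \<open>\<phi>\<close> and a transversal \<open>T\<close>, the vector \<open>X\<close> supported in \<open>T\<close> with
  \<open>X\<^sup>~(e) = (-1)\<^sup>k \<phi>(T \<triangle> {e, e\<^sup>*})\<close> for \<open>e \<in> T\<close>, where \<open>k\<close> is the number of \<open>j \<in> T \<inter> [n]\<close> not exceeding
  the index of \<open>e\<close>. With these signs, the relation of \<open>\<phi>\<close> for the pair \<open>T1, T2\<close> says exactly
  that \<open>\<langle>X, Y\<^sup>*\<rangle>\<close> is null for the vectors \<open>X, Y\<close> of \<open>T1, T2\<close>. The outer \<^term>\<open>tilde\<close> turns
  \<open>X\<^sup>~\<close> back into \<open>X\<close>, since \<^term>\<open>tilde\<close> is an involution.
\<close>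

definition wick_vector ::
    "('g, 'b) tract_scheme \<Rightarrow> ('g \<Rightarrow> 'g) \<Rightarrow> (elt set \<Rightarrow> 'g option) \<Rightarrow> elt set \<Rightarrow> elt \<Rightarrow> 'g option" where
  "wick_vector F \<sigma> \<phi> T = tilde \<sigma> (\<lambda>e. if e \<in> T
     then tmult F (tsign F (card {j. Plain j \<in> T \<and> j \<le> index e})) (\<phi> (sym_diff T {e, star e}))
     else None)"

text \<open>
  The signature of the class \<open>M = [\<phi>]\<close> consists of the nonzero scalar multiples of the
  \<^term>\<open>wick_vector F \<sigma> \<phi> T\<close>; letting \<open>\<phi>\<close> range over \<open>M\<close> produces exactly these multiples.
\<close>

definition signature_of_matroid ::
    "('g, 'b) tract_scheme \<Rightarrow> ('g \<Rightarrow> 'g) \<Rightarrow> nat \<Rightarrow> (elt set \<Rightarrow> 'g option) set \<Rightarrow> (elt \<Rightarrow> 'g option) set" where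
  "signature_of_matroid F \<sigma> n M =
     {wick_vector F \<sigma> \<phi> T | \<phi> T. \<phi> \<in> M \<and> T \<in> transversals n} - {zero_vec}"

text \<open>
  The vectors of a strong circuit set \<open>\<C>\<close> of \<open>\<B>\<close>: the bases in \<open>\<B>\<close> are exactly the transversals not
  containing the support of an element of \<open>\<C>\<close>, i.e. the support bases of \<open>\<C>\<close>, and the members of a
  fundamental circuit form for \<open>\<C>\<close> are the \<open>X\<^sub>e \<in> \<C>\<close> with support \<open>C(B, e)\<close> and \<open>X\<^sub>e(e) = 1\<close>.
\<close>

definition vectors_of_circuits ::
    "('g, 'b) tract_scheme \<Rightarrow> ('g \<Rightarrow> 'g) \<Rightarrow> nat \<Rightarrow> (elt \<Rightarrow> 'g option) set \<Rightarrow> (elt \<Rightarrow> 'g option) set" where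
  "vectors_of_circuits F \<sigma> n \<C> = fundamental_span F \<sigma> n \<C>"

end

theory Submission
  imports Defs
begin

text \<open>
  Replacing every vector \<open>X\<close> by \<open>X\<^sup>~\<close> turns the involution into the identity, so that \<open>\<langle>X, Y\<^sup>*\<rangle>\<close> becomes
  the symmetric sum of the \<open>X(e) Y(e\<^sup>*)\<close>, \<open>e \<in> E\<close>. Two observations then give the bijections.

  Let \<open>X\<^sub>e\<close>, \<open>e \<in> B\<^sup>*\<close>, be pairwise orthogonal vectors with support in \<open>B \<triangle> {e, e\<^sup>*}\<close> and \<open>X\<^sub>e(e) \<noteq> 0\<close>. The
  coefficients expressing a vector in terms of the \<open>X\<^sub>e\<close> can be read off on \<open>B\<^sup>*\<close>, and the remaining
  condition at \<open>f \<in> B\<close> is, up to a unit, orthogonality to \<open>X\<close> with index \<open>f\<^sup>*\<close>. So the span of the \<open>X\<^sub>e\<close> is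
  the set of vectors orthogonal to all of them. This identifies strong signatures with strong circuit
  sets, and the vectors of a circuit set with its orthogonal complement, whose elementary vectors
  are again the circuit vectors.

  The Wick relation for \<open>T1, T2\<close> is the orthogonality of the vectors of \<open>T1, T2\<close>. Conversely, a strong
  signature prescribes the ratio of the values of \<open>\<phi>\<close> on adjacent bases; these ratios are consistent
  along triangles and along certain squares of the basis graph, and induction on the distance from
  a fixed basis shows that this suffices for the existence of \<open>\<phi>\<close>.
\<close>

section \<open>Transversals\<close>

text \<open>Apart from rescaling a whole pairing by a unit, only short sums can be used: a single
  nonzero term is never null, and a two-term sum is null exactly when one term is minus the other.

  For a basis B, the fundamental vectors at e and f can meet only at e and f*, so the weak axioms
  (O2) and (V1) already give the pairwise orthogonality behind the span criterion; it says that the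
  matrix of fundamental coefficients is skew-symmetric. For T and the transversal obtained by
  toggling e and f, the pairing survives only at e and f and records the ratio of two coordinates.
  One-term pairings supply existence: a term known to be nonzero needs a partner, and the partner
  exhibits a new basis.

  The exponent in the Wick relation depends on T1 and T2 together. Modulo 2 it is a contribution of
  T1 plus one of T2, which allows the sign to be absorbed into the vectors.\<close>

lemma star_star [simp]: "star (star e) = e"
  by (cases e) auto

lemma star_neq [simp]: "star e \<noteq> e" "e \<noteq> star e"
  by (cases e; simp)+

lemma star_eq_iff [simp]: "star e = star f \<longleftrightarrow> e = f"
  by (metis star_star)

lemma star_ground [simp]: "star e \<in> ground n \<longleftrightarrow> e \<in> ground n"
  by (cases e) (auto simp: ground_def)

lemma index_star [simp]: "index (star e) = index e"
  by (cases e) auto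

lemma index_eq_iff: "index e = index f \<longleftrightarrow> e = f \<or> e = star f"
  by (cases e; cases f) auto

lemma finite_ground [simp]: "finite (ground n)"
  by (simp add: ground_def)

lemma star_image_iff: "e \<in> star ` A \<longleftrightarrow> star e \<in> A"
  by (metis imageE imageI star_star)

text \<open>Toggles are commuting involutions that depend only on the skew pair; in this form
  exchanges become identities that rewriting can settle.\<close>

definition flip :: "elt set \<Rightarrow> elt \<Rightarrow> elt set" where
  "flip T e = sym_diff T {e, star e}"

lemma in_flip_iff: "x \<in> flip T e \<longleftrightarrow> (if x = e \<or> x = star e then x \<notin> T else x \<in> T)"
  by (auto simp: flip_def)

lemma flip_star [simp]: "flip T (star e) = flip T e"
  by (auto simp: flip_def)

lemma flip_flip [simp]: "flip (flip T e) e = T"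
  by (simp add: set_eq_iff in_flip_iff)

lemma flip_commute: "flip (flip T e) f = flip (flip T f) e"
  by (simp add: set_eq_iff in_flip_iff)

lemma flip_left_cancel [simp]: "flip (flip (flip T e) f) e = flip T f"
  by (metis flip_commute flip_flip)

text \<open>Distinctness matters: for \<open>f\<close> in the pair of \<open>e\<close> the two
  toggles cancel, while the four-element set collapses to one pair.\<close>

lemma sym_diff_eq_flip2:
  assumes "f \<noteq> e" "f \<noteq> star e"
  shows "sym_diff T {e, star e, f, star f} = flip (flip T e) f"
proof (rule Set.set_eqI)
  have "star f \<noteq> e" "star f \<noteq> star e" using assms by auto
  then show "x \<in> sym_diff T {e, star e, f, star f} \<longleftrightarrow> x \<in> flip (flip T e) f" for x
    using assms by (cases "x = f \<or> x = star f") (auto simp: in_flip_iff)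
qed

text \<open>Admissibility makes \<open>index\<close> injective on \<open>T\<close>, so
  \<open>n\<close> elements exhaust all \<open>n\<close> skew pairs. The pointwise form spares later
  arguments the cardinality.\<close>

lemma transversal_iff:
  "T \<in> transversals n \<longleftrightarrow> T \<subseteq> ground n \<and> (\<forall>e \<in> ground n. star e \<in> T \<longleftrightarrow> e \<notin> T)"
proof -
  have idx: "index ` T \<subseteq> {1..n}" if "T \<subseteq> ground n" for T
    using that by (auto simp: ground_def)
  have inj: "inj_on index T" if "T \<inter> star ` T = {}" for T
    using that by (auto simp: inj_on_def index_eq_iff)
  show ?thesis
  proof
    assume T: "T \<in> transversals n"
    then have sub: "T \<subseteq> ground n" and disj: "T \<inter> star ` T = {}" and "card T = n"
      by (auto simp: transversals_def admissible_def)
    then have "card (index ` T) = n"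
      by (simp add: card_image inj)
    then have img: "index ` T = {1..n}"
      using idx[OF sub] by (simp add: card_subset_eq)
    have "star e \<in> T \<longleftrightarrow> e \<notin> T" if "e \<in> ground n" for e
    proof -
      have "index e \<in> index ` T"
        using that img by (auto simp: ground_def)
      then have "e \<in> T \<or> star e \<in> T"
        by (auto simp: index_eq_iff)
      then show ?thesis
        using disj by (auto simp: star_image_iff)
    qed
    with sub show "T \<subseteq> ground n \<and> (\<forall>e \<in> ground n. star e \<in> T \<longleftrightarrow> e \<notin> T)"
      by blast
  next
    assume *: "T \<subseteq> ground n \<and> (\<forall>e \<in> ground n. star e \<in> T \<longleftrightarrow> e \<notin> T)"
    then have disj: "T \<inter> star ` T = {}"
      by (auto simp: star_image_iff)
    have "{1..n} \<subseteq> index ` T"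
    proof
      fix i assume "i \<in> {1..n}"
      then have "Plain i \<in> ground n" by (auto simp: ground_def)
      with * have "Plain i \<in> T \<or> star (Plain i) \<in> T" by blast
      then show "i \<in> index ` T" by (metis imageI index.simps star.simps(1))
    qed
    then have "index ` T = {1..n}"
      using idx * by blast
    then have "card T = n"
      using inj[OF disj] by (metis card_atLeastAtMost card_image diff_Suc_1)
    then show "T \<in> transversals n"
      using * disj by (auto simp: transversals_def admissible_def)
  qed
qed

lemma transversalD:
  assumes "T \<in> transversals n"
  shows "T \<subseteq> ground n" "e \<in> ground n \<Longrightarrow> star e \<in> T \<longleftrightarrow> e \<notin> T"
  using assms by (auto simp: transversal_iff)

lemma in_transversal_ground: "T \<in> transversals n \<Longrightarrow> e \<in> T \<Longrightarrow> e \<in> ground n"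
  by (auto simp: transversal_iff)

lemma transversal_star: "T \<in> transversals n \<Longrightarrow> e \<in> T \<Longrightarrow> star e \<notin> T"
  by (auto simp: transversal_iff)

lemma flip_transversal:
  "T \<in> transversals n \<Longrightarrow> e \<in> ground n \<Longrightarrow> flip T e \<in> transversals n"
  by (auto simp: transversal_iff in_flip_iff split: if_splits)

lemma star_transversal: "T \<in> transversals n \<Longrightarrow> e \<in> star ` T \<longleftrightarrow> e \<in> ground n \<and> e \<notin> T"
  unfolding star_image_iff by (metis star_ground star_star transversal_iff subsetD)

lemma transversal_eqI:
  "S \<in> transversals n \<Longrightarrow> T \<in> transversals n \<Longrightarrow> S \<subseteq> T \<Longrightarrow> S = T"
  unfolding transversal_iff by (metis subsetD subsetI subset_antisym)

lemma transversal_diff_star: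
  "S \<in> transversals n \<Longrightarrow> T \<in> transversals n \<Longrightarrow> e \<in> S - T \<Longrightarrow> star e \<in> T - S"
  by (auto simp: transversal_iff)

lemma admissible_subset: "admissible n A \<Longrightarrow> B \<subseteq> A \<Longrightarrow> admissible n B"
  by (auto simp: admissible_def)

lemma admissible_star: "admissible n A \<Longrightarrow> e \<in> A \<Longrightarrow> star e \<notin> A"
  by (auto simp: admissible_def star_image_iff disjoint_iff)

text \<open>Confines the pairing of a vector on \<open>T\<close> with one on the twice toggled
  transversal to the coordinates \<open>e\<close> and \<open>f\<close>.\<close>

lemma star_in_flip2:
  assumes "T \<in> transversals n" "e \<in> T" "f \<in> T" "x \<in> T" "star x \<in> flip (flip T e) f"
  shows "x = e \<or> x = f"
proof (rule ccontr)
  assume "\<not> (x = e \<or> x = f)"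
  moreover have "x \<noteq> star e" "x \<noteq> star f"
    using assms transversal_star[OF assms(1)] by blast+
  moreover from this have "star x \<noteq> e" "star x \<noteq> f" by auto
  ultimately have "star x \<in> T"
    using assms(5) by (auto simp: in_flip_iff)
  then show False using transversal_star[OF assms(1,4)] by blast
qed

text \<open>Confines the pairing of two fundamental vectors of one basis to two coordinates, which
  is why two-term axioms suffice for such pairs.\<close>

lemma star_in_flip:
  assumes "T \<in> transversals n" "e \<in> star ` T" "f \<in> star ` T" "x \<in> flip T e" "star x \<in> flip T f"
  shows "x = e \<or> x = star f"
proof (rule ccontr)
  assume "\<not> (x = e \<or> x = star f)"
  then have ne: "x \<noteq> e" "star x \<noteq> f" by (metis star_star)+
  have ef: "star e \<in> T" "star f \<in> T"
    using assms(2,3) by (simp_all add: star_image_iff)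
  have "x \<noteq> star e" "star x \<noteq> star f"
    using assms(4,5) ef by (auto simp: in_flip_iff)
  then have "x \<in> T" "star x \<in> T"
    using assms(4,5) ne by (auto simp: in_flip_iff)
  then show False using transversal_star[OF assms(1)] by blast
qed

lemma transversal_admissible: "T \<in> transversals n \<Longrightarrow> admissible n T"
  by (simp add: transversals_def)

lemma finite_transversal: "T \<in> transversals n \<Longrightarrow> finite T"
  by (meson finite_ground finite_subset transversalD(1))


section \<open>Circuits of orthogonal matroids\<close>

locale orth_matroid =
  fixes n :: nat and \<B> :: "elt set set"
  assumes orth_matroid: "orthogonal_matroid n \<B>"
begin

lemma basis_transversal: "B \<in> \<B> \<Longrightarrow> B \<in> transversals n"
  using orth_matroid by (auto simp: orthogonal_matroid_def)

lemma bases_nonempty: "\<B> \<noteq> {}"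
  using orth_matroid by (auto simp: orthogonal_matroid_def)

text \<open>The axiom speaks of skew pairs. Each pair inside the symmetric difference has exactly
  one member in \<open>B1 - B2\<close>, and it is this member that later arguments handle.\<close>

lemma exchange:
  assumes "B1 \<in> \<B>" "B2 \<in> \<B>" "e \<in> B1 - B2"
  obtains f where "f \<in> B1 - B2" "f \<noteq> e" "flip (flip B1 e) f \<in> \<B>"
proof -
  note tr = basis_transversal[OF assms(1)] basis_transversal[OF assms(2)]
  have "{e, star e} \<subseteq> sym_diff B1 B2"
    using transversal_diff_star[OF tr assms(3)] assms(3) by auto
  then obtain x where x: "{x, star x} \<subseteq> sym_diff B1 B2" "{x, star x} \<noteq> {e, star e}"
      "sym_diff B1 {e, star e, x, star x} \<in> \<B>"
    using orth_matroid assms(1,2) unfolding orthogonal_matroid_def by meson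
  obtain f where f: "f = x \<or> f = star x" "f \<in> B1 - B2"
  proof (cases "x \<in> B1")
    case True
    then show thesis using that[of x] x(1) by auto
  next
    case False
    then have "star x \<in> B1 - B2"
      using x(1) transversal_diff_star[OF tr(2,1), of x] by auto
    then show thesis using that[of "star x"] by auto
  qed
  have ne: "x \<noteq> e" "x \<noteq> star e"
    using x(2) by auto
  moreover have "flip (flip B1 e) f = flip (flip B1 e) x"
    using f(1) by auto
  ultimately have "flip (flip B1 e) f = sym_diff B1 {e, star e, x, star x}"
    using sym_diff_eq_flip2[of x e B1] by simp
  moreover have "f \<noteq> e"
    using f(1) ne by auto
  ultimately show thesis
    using that[OF f(2)] x(3) by simp
qed

text \<open>The circuit \<open>C(B, e)\<close> is \<open>circ (flip B e)\<close>. Indexing by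
  transversals instead of by a basis and an element matches the Wick vectors: all bases one toggle
  away from \<open>T\<close> give the same circuit, and the set is empty if there are none.\<close>

definition circ :: "elt set \<Rightarrow> elt set" where
  "circ T = {e \<in> T. flip T e \<in> \<B>}"

lemma circ_subset: "circ T \<subseteq> T"
  by (auto simp: circ_def)

text \<open>If a basis \<open>B\<close> contained the set, exchanging \<open>star e\<close> out of
  \<open>flip T e\<close> towards \<open>B\<close> would cancel the toggle of \<open>e\<close> and
  leave a basis \<open>flip T f\<close> with \<open>f\<close> outside \<open>B\<close>; but such an
  \<open>f\<close> belongs to the set.\<close>

lemma circ_dependent:
  assumes T: "T \<in> transversals n" and "circ T \<noteq> {}"
  shows "dependent n \<B> (circ T)"
proof -
  have "\<not> circ T \<subseteq> B" if B: "B \<in> \<B>" for B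
  proof
    assume sub: "circ T \<subseteq> B"
    obtain e where e: "e \<in> T" "flip T e \<in> \<B>"
      using assms(2) by (auto simp: circ_def)
    then have "e \<in> B" using sub by (auto simp: circ_def)
    then have "star e \<in> flip T e - B"
      using T e transversal_star[OF basis_transversal[OF B]] transversal_star[OF T]
      by (auto simp: in_flip_iff)
    then obtain f where f: "f \<in> flip T e - B" "f \<noteq> star e" "flip (flip (flip T e) (star e)) f \<in> \<B>"
      using exchange[OF e(2) B] by metis
    then have "f \<in> circ T"
      using e(1) by (auto simp: circ_def in_flip_iff split: if_splits)
    then show False using sub f(1) by auto
  qed
  then show ?thesis
    using admissible_subset[OF transversal_admissible[OF T] circ_subset] by (auto simp: dependent_def)
qed

lemma circ_circuit:
  assumes T: "T \<in> transversals n" and "circ T \<noteq> {}"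
  shows "circ T \<in> circuits n \<B>"
proof -
  have "\<not> dependent n \<B> D" if D: "D \<subset> circ T" for D
  proof -
    obtain f where "f \<in> circ T" "f \<notin> D" using D by auto
    then have "flip T f \<in> \<B>" "D \<subseteq> flip T f"
      using D circ_subset[of T] transversal_star[OF T] by (auto simp: circ_def in_flip_iff)
    then show ?thesis by (auto simp: dependent_def)
  qed
  then show ?thesis
    using circ_dependent[OF assms] by (auto simp: circuits_def)
qed

text \<open>If \<open>f\<close> in \<open>circ T\<close> were missing from \<open>D\<close>, then
  \<open>D\<close> would lie in the basis \<open>flip T f\<close>.\<close>

lemma circ_least:
  assumes D: "dependent n \<B> D" "D \<subseteq> T" and T: "admissible n T"
  shows "circ T \<subseteq> D"
proof
  fix f assume "f \<in> circ T"
  then have "f \<in> T" "flip T f \<in> \<B>" by (auto simp: circ_def)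
  then have "\<not> D \<subseteq> flip T f" using D by (auto simp: dependent_def)
  moreover have "x = f" if "x \<in> D" "x \<notin> flip T f" for x
    using that D(2) admissible_star[OF T \<open>f \<in> T\<close>] by (auto simp: in_flip_iff split: if_splits)
  ultimately show "f \<in> D" by blast
qed

lemma circ_unique:
  assumes T: "T \<in> transversals n" and "circ T \<noteq> {}" "D \<in> circuits n \<B>" "D \<subseteq> T"
  shows "D = circ T"
  using circ_least[OF _ _ transversal_admissible[OF T], of D] circ_dependent[OF assms(1,2)] assms by (auto simp: circuits_def)

lemma dependent_contains_circuit:
  assumes "dependent n \<B> A"
  obtains C where "C \<in> circuits n \<B>" "C \<subseteq> A"
proof -
  have "finite A"
    using assms by (meson admissible_def dependent_def finite_ground finite_subset)
  then have fin: "finite {D. D \<subseteq> A \<and> dependent n \<B> D}" by simp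
  obtain C where C: "C \<subseteq> A" "dependent n \<B> C"
      and min: "\<forall>D \<in> {D. D \<subseteq> A \<and> dependent n \<B> D}. D \<subseteq> C \<longrightarrow> C = D"
    using finite_has_minimal[OF fin] assms by blast
  then have "\<not> dependent n \<B> D" if "D \<subset> C" for D
    using that by blast
  then have "C \<in> circuits n \<B>"
    using C by (simp add: circuits_def)
  with C that show thesis by blast
qed

text \<open>The bases are recoverable from the circuits, so a signature determines its
  matroid.\<close>

lemma basis_iff_no_circuit:
  assumes "T \<in> transversals n"
  shows "T \<in> \<B> \<longleftrightarrow> (\<forall>C \<in> circuits n \<B>. \<not> C \<subseteq> T)"
proof
  show "T \<in> \<B> \<Longrightarrow> \<forall>C \<in> circuits n \<B>. \<not> C \<subseteq> T"
    by (auto simp: circuits_def dependent_def)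
next
  assume none: "\<forall>C \<in> circuits n \<B>. \<not> C \<subseteq> T"
  show "T \<in> \<B>"
  proof (rule ccontr)
    assume "T \<notin> \<B>"
    then have "\<not> T \<subseteq> B" if "B \<in> \<B>" for B
      using transversal_eqI[OF assms basis_transversal[OF that]] that by blast
    then have "dependent n \<B> T"
      using transversal_admissible[OF assms] by (simp add: dependent_def)
    then show False
      using none dependent_contains_circuit[of T] by metis
  qed
qed

lemma circuit_nonempty: "C \<in> circuits n \<B> \<Longrightarrow> C \<noteq> {}"
  using bases_nonempty by (auto simp: circuits_def dependent_def)

lemma circuit_admissible: "C \<in> circuits n \<B> \<Longrightarrow> admissible n C"
  by (auto simp: circuits_def dependent_def)

lemma fundamental_circ:
  assumes "B \<in> \<B>" "e \<in> star ` B"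
  shows "flip B e \<in> transversals n" "e \<in> circ (flip B e)" "circ (flip B e) \<in> circuits n \<B>"
proof -
  have e: "e \<in> ground n" "e \<notin> B"
    using star_transversal[OF basis_transversal[OF assms(1)]] assms(2) by auto
  show T: "flip B e \<in> transversals n"
    by (rule flip_transversal[OF basis_transversal[OF assms(1)] e(1)])
  show "e \<in> circ (flip B e)"
    using e assms by (auto simp: circ_def in_flip_iff)
  then show "circ (flip B e) \<in> circuits n \<B>"
    using circ_circuit[OF T] by auto
qed

text \<open>Minimality puts \<open>C - {e}\<close> into a basis, which then avoids \<open>e\<close>.
  A claim about a circuit can thus be tested in a fundamental family, with any element of the
  circuit in the role of \<open>e\<close>.\<close>

lemma circuit_fundamental:
  assumes "C \<in> circuits n \<B>" "e \<in> C"
  obtains B where "B \<in> \<B>" "e \<in> star ` B" "C = circ (flip B e)"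
proof -
  have "C - {e} \<subset> C" using assms(2) by auto
  then have "\<not> dependent n \<B> (C - {e})" and adm: "admissible n C"
    using assms by (auto simp: circuits_def dependent_def)
  then obtain B where B: "B \<in> \<B>" "C - {e} \<subseteq> B"
    using admissible_subset[OF adm] unfolding dependent_def by blast
  moreover have "\<not> C \<subseteq> B"
    using assms(1) B by (auto simp: circuits_def dependent_def)
  ultimately have e: "e \<in> star ` B"
    using adm assms(2) star_transversal[OF basis_transversal[OF B(1)]] unfolding admissible_def by blast
  have "e \<notin> B"
    using B(2) \<open>\<not> C \<subseteq> B\<close> by blast
  then have "C \<subseteq> flip B e"
    using B(2) admissible_star[OF adm assms(2)] unfolding in_flip_iff subset_iff by auto
  then have "C = circ (flip B e)"
    using fundamental_circ[OF B(1) e] circ_unique assms(1) by blast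
  with B e that show thesis by blast
qed

lemma fund_circuit_eq:
  assumes "B \<in> \<B>" "e \<in> star ` B"
  shows "fund_circuit n \<B> B e = circ (flip B e)"
  unfolding fund_circuit_def
proof (rule the_equality)
  note f = fundamental_circ[OF assms]
  have e: "e \<notin> B" "star e \<in> B"
    using assms star_transversal[OF basis_transversal[OF assms(1)]] by (auto simp: star_image_iff)
  show "circ (flip B e) \<in> circuits n \<B> \<and> circ (flip B e) \<subseteq> insert e B"
    using f e circ_subset[of "flip B e"] by (auto simp: in_flip_iff split: if_splits)
  fix C assume C: "C \<in> circuits n \<B> \<and> C \<subseteq> insert e B"
  moreover have "\<not> C \<subseteq> B"
    using C assms(1) by (auto simp: circuits_def dependent_def)
  ultimately have "e \<in> C" by auto
  then have "C \<subseteq> flip B e"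
    using C admissible_star[OF circuit_admissible, of C e] e unfolding in_flip_iff subset_iff by auto
  then show "C = circ (flip B e)"
    using circ_unique f C by blast
qed

text \<open>Both transversals are one toggle away from the same two bases \<open>flip T e\<close>
  and \<open>flip T f\<close>, so their circuits see the same edge of the basis graph.\<close>

lemma circ_flip2:
  assumes "T \<in> transversals n" "e \<in> circ T" "f \<in> circ T" "e \<noteq> f"
  shows "flip (flip T e) f \<in> transversals n" "star e \<in> circ (flip (flip T e) f)"
    "star f \<in> circ (flip (flip T e) f)"
  using assms circ_subset[of T] transversal_star[OF assms(1)] flip_transversal in_transversal_ground[OF assms(1)]
  by (auto simp: circ_def in_flip_iff flip_commute[of T e f])

end


section \<open>Arithmetic in a tract\<close>

declare not_None_eq [simp del]

lemma in_supp_iff: "e \<in> supp X \<longleftrightarrow> X e \<noteq> None"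
  by (simp add: supp_def)

lemma zero_vec_iff: "X = zero_vec \<longleftrightarrow> supp X = {}"
  by (auto simp: zero_vec_def supp_def fun_eq_iff)

lemma image_mset_sum: "image_mset f (\<Sum>i \<in> I. g i) = (\<Sum>i \<in> I. image_mset f (g i))"
  by (induction I rule: infinite_finite_induct) auto

context tract
begin

abbreviation K :: "'g option set" where "K \<equiv> tract_elems F"

abbreviation tm :: "'g option \<Rightarrow> 'g option \<Rightarrow> 'g option" (infixl "\<odot>" 70) where
  "x \<odot> y \<equiv> tmult F x y"

abbreviation tn :: "'g option \<Rightarrow> 'g option" where "tn \<equiv> tneg F"

abbreviation eps :: 'g where "eps \<equiv> tract_eps F"

lemma None_K [simp]: "None \<in> K"
  by (simp add: tract_elems_def)

lemma Some_K [simp]: "Some x \<in> K \<longleftrightarrow> x \<in> carrier F"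
  by (auto simp: tract_elems_def)

lemma K_cases: "x \<in> K \<Longrightarrow> (x = None \<Longrightarrow> P) \<Longrightarrow> (\<And>a. a \<in> carrier F \<Longrightarrow> x = Some a \<Longrightarrow> P) \<Longrightarrow> P"
  by (auto simp: tract_elems_def)

lemma tm_None [simp]: "None \<odot> x = None" "x \<odot> None = None"
  by (cases x; simp)+

lemma tm_eq_None_iff [simp]: "x \<odot> y = None \<longleftrightarrow> x = None \<or> y = None"
  by (cases x; cases y) auto

lemma tm_closed [simp]: "x \<in> K \<Longrightarrow> y \<in> K \<Longrightarrow> x \<odot> y \<in> K"
  by (auto elim!: K_cases)

lemma tm_assoc: "x \<in> K \<Longrightarrow> y \<in> K \<Longrightarrow> z \<in> K \<Longrightarrow> x \<odot> y \<odot> z = x \<odot> (y \<odot> z)"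
  by (auto elim!: K_cases simp: m_assoc)

lemma tm_comm: "x \<in> K \<Longrightarrow> y \<in> K \<Longrightarrow> x \<odot> y = y \<odot> x"
  by (auto elim!: K_cases simp: m_comm)

lemma tm_lcomm: "x \<in> K \<Longrightarrow> y \<in> K \<Longrightarrow> z \<in> K \<Longrightarrow> x \<odot> (y \<odot> z) = y \<odot> (x \<odot> z)"
  by (auto elim!: K_cases simp: m_lcomm)

lemmas tm_ac = tm_assoc tm_comm tm_lcomm

lemma tm_one [simp]: "x \<in> K \<Longrightarrow> Some \<one> \<odot> x = x" "x \<in> K \<Longrightarrow> x \<odot> Some \<one> = x"
  by (auto elim!: K_cases)

lemma tm_left_cancel:
  "x \<in> K \<Longrightarrow> y \<in> K \<Longrightarrow> z \<in> K \<Longrightarrow> x \<noteq> None \<Longrightarrow> x \<odot> y = x \<odot> z \<longleftrightarrow> y = z"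
  by (auto elim!: K_cases)

definition ti :: "'g option \<Rightarrow> 'g option" where "ti = map_option (m_inv F)"

lemma ti_closed [simp]: "x \<in> K \<Longrightarrow> ti x \<in> K"
  by (auto elim!: K_cases simp: ti_def)

lemma ti_eq_None_iff [simp]: "ti x = None \<longleftrightarrow> x = None"
  by (simp add: ti_def)

lemma tm_ti: "x \<in> K \<Longrightarrow> x \<noteq> None \<Longrightarrow> x \<odot> ti x = Some \<one>" "x \<in> K \<Longrightarrow> x \<noteq> None \<Longrightarrow> ti x \<odot> x = Some \<one>"
  by (auto elim!: K_cases simp: ti_def)

lemma tm_ti_cancel [simp]: "x \<in> K \<Longrightarrow> x \<noteq> None \<Longrightarrow> y \<in> K \<Longrightarrow> x \<odot> (ti x \<odot> y) = y"
  "x \<in> K \<Longrightarrow> x \<noteq> None \<Longrightarrow> y \<in> K \<Longrightarrow> ti x \<odot> (x \<odot> y) = y"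
  by (simp_all add: tm_assoc[symmetric] tm_ti)

section \<open>The element -1 and null sums with one or two terms\<close>

lemma eps: "eps \<in> carrier F" "{#\<one>, eps#} \<in> nulls F"
  unfolding tract_eps_def using theI'[OF unique_eps] by auto

lemma eps_unique: "x \<in> carrier F \<Longrightarrow> {#\<one>, x#} \<in> nulls F \<Longrightarrow> x = eps"
  using unique_eps eps by blast

declare eps(1) [simp]

lemma mult_inv_cancel: "x \<in> carrier F \<Longrightarrow> z \<in> carrier F \<Longrightarrow> x \<otimes> (z \<otimes> inv x) = z"
  by (metis m_lcomm inv_closed r_inv r_one)

text \<open>Scaling by \<open>inv x\<close> reduces this to the uniqueness of
  \<open>eps\<close>.\<close>

lemma null_pair:
  assumes "x \<in> carrier F" "y \<in> carrier F"
  shows "{#x, y#} \<in> nulls F \<longleftrightarrow> y = eps \<otimes> x"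
proof
  assume "{#x, y#} \<in> nulls F"
  then have "image_mset (\<lambda>z. inv x \<otimes> z) {#x, y#} \<in> nulls F"
    using assms by (intro nulls_scale) auto
  then have "inv x \<otimes> y = eps"
    using assms by (intro eps_unique) auto
  then show "y = eps \<otimes> x"
    using assms by (metis eps(1) inv_solve_left' m_comm)
next
  assume "y = eps \<otimes> x"
  then have "image_mset (\<lambda>z. x \<otimes> z) {#\<one>, eps#} = {#x, y#}"
    using assms by (simp add: m_comm)
  then show "{#x, y#} \<in> nulls F"
    using nulls_scale[OF assms(1) eps(2)] by simp
qed

text \<open>The null sum of \<open>\<one>\<close> and \<open>eps\<close> may be read from either
  end; reading it from \<open>eps\<close> makes \<open>\<one>\<close> the negative of
  \<open>eps\<close>.\<close>

lemma eps_sq [simp]: "eps \<otimes> eps = \<one>"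
proof -
  have "{#eps, \<one>#} \<in> nulls F"
    using eps(2) by (simp add: add_mset_commute)
  then show ?thesis using null_pair[of eps \<one>] by simp
qed

lemma eps_eps [simp]: "x \<in> carrier F \<Longrightarrow> eps \<otimes> (eps \<otimes> x) = x"
  by (simp add: m_assoc[symmetric])

lemma tn_closed [simp]: "x \<in> K \<Longrightarrow> tn x \<in> K"
  by (simp add: tneg_def)

lemma tn_eq_None_iff [simp]: "tn x = None \<longleftrightarrow> x = None"
  by (simp add: tneg_def)

lemma tn_None [simp]: "tn None = None"
  by (simp add: tneg_def)

lemma tn_tn [simp]: "x \<in> K \<Longrightarrow> tn (tn x) = x"
  by (simp add: tneg_def tm_assoc[symmetric])

lemma tn_tm: "x \<in> K \<Longrightarrow> y \<in> K \<Longrightarrow> tn x \<odot> y = tn (x \<odot> y)" "x \<in> K \<Longrightarrow> y \<in> K \<Longrightarrow> x \<odot> tn y = tn (x \<odot> y)"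
  by (simp_all add: tneg_def tm_ac)

lemma tn_inject [simp]: "x \<in> K \<Longrightarrow> y \<in> K \<Longrightarrow> tn x = tn y \<longleftrightarrow> x = y"
  by (metis tn_tn)

text \<open>A unit would scale to \<open>\<one>\<close>, which is not null. Every argument that a
  nonzero term needs a partner rests on this.\<close>

lemma formal_single_null: "x \<in> K \<Longrightarrow> formal x \<in> nulls F \<longleftrightarrow> x = None"
proof -
  assume x: "x \<in> K"
  have False if "a \<in> carrier F" "{#a#} \<in> nulls F" for a
  proof -
    have "image_mset (\<lambda>z. inv a \<otimes> z) {#a#} \<in> nulls F"
      using that by (intro nulls_scale) auto
    then show False using that one_not_null by simp
  qed
  then show ?thesis
    using x zero_null by (auto elim!: K_cases)
qed

lemma formal_pair_null: "x \<in> K \<Longrightarrow> y \<in> K \<Longrightarrow> formal x + formal y \<in> nulls F \<longleftrightarrow> y = tn x"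
  using formal_single_null[of x] formal_single_null[of y] null_pair zero_null
  by (auto elim!: K_cases simp: tneg_def)

lemma formal_Some_tm: "formal (Some a \<odot> x) = image_mset (\<lambda>z. a \<otimes> z) (formal x)"
  by (cases x) auto

lemma null_sum_scale:
  assumes "a \<in> K" "a \<noteq> None" "\<And>i. i \<in> I \<Longrightarrow> f i \<in> K"
  shows "(\<Sum>i \<in> I. formal (a \<odot> f i)) \<in> nulls F \<longleftrightarrow> (\<Sum>i \<in> I. formal (f i)) \<in> nulls F"
proof -
  have *: "(\<Sum>i \<in> I. formal (b \<odot> g i)) \<in> nulls F"
    if "b \<in> K" "b \<noteq> None" "(\<Sum>i \<in> I. formal (g i)) \<in> nulls F" for b g
    using that nulls_scale[of "the b" "\<Sum>i \<in> I. formal (g i)"]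
    by (auto elim!: K_cases simp: formal_Some_tm image_mset_sum)
  have "(\<Sum>i \<in> I. formal (ti a \<odot> (a \<odot> f i))) = (\<Sum>i \<in> I. formal (f i))"
    using assms by (intro sum.cong) auto
  then show ?thesis
    using *[of a f] *[of "ti a" "\<lambda>i. a \<odot> f i"] assms by auto
qed

definition epow :: "nat \<Rightarrow> 'g" where "epow k = eps [^] k"

lemma epow_closed [simp]: "epow k \<in> carrier F"
  by (simp add: epow_def)

lemma epow_add: "epow (j + k) = epow j \<otimes> epow k"
  by (simp add: epow_def nat_pow_mult)

lemma epow_Suc: "epow (Suc k) = eps \<otimes> epow k"
  by (simp add: epow_def m_comm)

lemma epow_sq [simp]: "epow k \<otimes> epow k = \<one>"
proof (induction k)
  case (Suc k)
  have "epow (Suc k) \<otimes> epow (Suc k) = eps \<otimes> eps \<otimes> (epow k \<otimes> epow k)"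
    unfolding epow_Suc by (simp add: m_ac del: eps_sq)
  then show ?case using Suc by simp
qed (simp add: epow_def)

lemma epow_mod2: "epow k = (if even k then \<one> else eps)"
  by (induction k) (auto simp: epow_Suc, simp add: epow_def)

lemma tsign_eq: "tsign F k = Some (epow k)"
  by (simp add: tsign_def epow_def)


section \<open>Vectors and their pairing\<close>

abbreviation V :: "nat \<Rightarrow> (elt \<Rightarrow> 'g option) set" where "V \<equiv> vecs F"

lemma vecs_iff: "X \<in> V n \<longleftrightarrow> (\<forall>e. X e \<in> K) \<and> supp X \<subseteq> ground n"
  by (auto simp: vecs_def supp_def)

lemma vecs_K [simp]: "X \<in> V n \<Longrightarrow> X e \<in> K"
  by (simp add: vecs_iff)

definition scale :: "'g option \<Rightarrow> (elt \<Rightarrow> 'g option) \<Rightarrow> elt \<Rightarrow> 'g option" where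
  "scale a X = (\<lambda>e. a \<odot> X e)"

lemma supp_scale [simp]: "a \<noteq> None \<Longrightarrow> supp (scale a X) = supp X"
  by (auto simp: supp_def scale_def)

lemma scale_vecs [simp]: "a \<in> K \<Longrightarrow> X \<in> V n \<Longrightarrow> scale a X \<in> V n"
  by (auto simp: vecs_iff scale_def supp_def)

lemma scale_scale_ti: "a \<in> K \<Longrightarrow> a \<noteq> None \<Longrightarrow> X \<in> V n \<Longrightarrow> scale (ti a) (scale a X) = X"
  "a \<in> K \<Longrightarrow> a \<noteq> None \<Longrightarrow> X \<in> V n \<Longrightarrow> scale a (scale (ti a) X) = X"
  by (auto simp: scale_def)

definition orth :: "nat \<Rightarrow> (elt \<Rightarrow> 'g option) \<Rightarrow> (elt \<Rightarrow> 'g option) \<Rightarrow> bool" where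
  "orth n X Y \<longleftrightarrow> (\<Sum>e \<in> ground n. formal (X e \<odot> Y (star e))) \<in> nulls F"

lemma inner_prod_id: "inner_prod F id n X (star_vec Y) \<in> nulls F \<longleftrightarrow> orth n X Y"
proof -
  have "(\<Sum>e \<in> ground n. formal (X e \<odot> Y (star e))) =
      (\<Sum>e \<in> Plain ` {1..n}. formal (X e \<odot> Y (star e))) + (\<Sum>e \<in> Starred ` {1..n}. formal (X e \<odot> Y (star e)))"
    unfolding ground_def by (rule sum.union_disjoint) auto
  also have "\<dots> = (\<Sum>i \<in> {1..n}. formal (X (Plain i) \<odot> Y (Starred i))) + (\<Sum>i \<in> {1..n}. formal (X (Starred i) \<odot> Y (Plain i)))"
    by (simp add: sum.reindex inj_on_def)
  also have "\<dots> = inner_prod F id n X (star_vec Y)"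
    by (simp add: inner_prod_def star_vec_def sum.distrib option.map_id)
  finally show ?thesis by (simp add: orth_def)
qed

lemma orth_commute:
  assumes "X \<in> V n" "Y \<in> V n"
  shows "orth n X Y \<longleftrightarrow> orth n Y X"
proof -
  have "(\<Sum>e \<in> ground n. formal (X e \<odot> Y (star e))) = (\<Sum>e \<in> ground n. formal (Y e \<odot> X (star e)))"
    using assms by (intro sum.reindex_bij_witness[of _ star star]) (auto simp: tm_comm)
  then show ?thesis by (simp add: orth_def)
qed

lemma orth_restrict:
  assumes "S \<subseteq> ground n" "\<And>e. e \<in> ground n \<Longrightarrow> X e \<noteq> None \<Longrightarrow> Y (star e) \<noteq> None \<Longrightarrow> e \<in> S"
  shows "orth n X Y \<longleftrightarrow> (\<Sum>e \<in> S. formal (X e \<odot> Y (star e))) \<in> nulls F"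
proof -
  have "(\<Sum>e \<in> ground n. formal (X e \<odot> Y (star e))) = (\<Sum>e \<in> S. formal (X e \<odot> Y (star e)))"
  proof (rule sum.mono_neutral_right)
    show "\<forall>e \<in> ground n - S. formal (X e \<odot> Y (star e)) = {#}"
    proof
      fix e assume "e \<in> ground n - S"
      then have "X e = None \<or> Y (star e) = None" using assms(2) by blast
      then show "formal (X e \<odot> Y (star e)) = {#}" by auto
    qed
  qed (use assms in auto)
  then show ?thesis by (simp add: orth_def)
qed

lemma orth_disjoint: "(\<And>e. X e = None \<or> Y (star e) = None) \<Longrightarrow> orth n X Y"
proof -
  assume "\<And>e. X e = None \<or> Y (star e) = None"
  then have "formal (X e \<odot> Y (star e)) = {#}" for e
    by (metis formal.simps(1) tm_None)
  then show ?thesis using zero_null by (simp add: orth_def)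
qed

text \<open>The short pairings: with one possible term orthogonality means that it vanishes, and
  with two, in \<open>orth_pair\<close>, it fixes a ratio.\<close>

lemma orth_single:
  assumes "X \<in> V n" "Y \<in> V n" "e \<in> ground n"
    and "\<And>x. x \<in> ground n \<Longrightarrow> X x \<noteq> None \<Longrightarrow> Y (star x) \<noteq> None \<Longrightarrow> x = e"
  shows "orth n X Y \<longleftrightarrow> X e = None \<or> Y (star e) = None"
  using orth_restrict[of "{e}" n X Y] assms by (auto simp: formal_single_null)

lemma orth_pair:
  assumes "X \<in> V n" "Y \<in> V n" "e \<in> ground n" "f \<in> ground n" "e \<noteq> f"
    and "\<And>x. x \<in> ground n \<Longrightarrow> X x \<noteq> None \<Longrightarrow> Y (star x) \<noteq> None \<Longrightarrow> x = e \<or> x = f"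
  shows "orth n X Y \<longleftrightarrow> X f \<odot> Y (star f) = tn (X e \<odot> Y (star e))"
  using orth_restrict[of "{e, f}" n X Y] assms by (auto simp: formal_pair_null)

lemma orth_scale:
  assumes "X \<in> V n" "Y \<in> V n" "a \<in> K" "a \<noteq> None"
  shows "orth n (scale a X) Y \<longleftrightarrow> orth n X Y" "orth n X (scale a Y) \<longleftrightarrow> orth n X Y"
proof -
  have *: "orth n (scale a X) Y \<longleftrightarrow> orth n X Y" if "X \<in> V n" "Y \<in> V n" for X Y
    using null_sum_scale[OF assms(3,4), of "ground n" "\<lambda>e. X e \<odot> Y (star e)"] that assms
    by (simp add: orth_def scale_def tm_assoc)
  show "orth n (scale a X) Y \<longleftrightarrow> orth n X Y" using * assms by blast
  show "orth n X (scale a Y) \<longleftrightarrow> orth n X Y"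
    using *[OF assms(2,1)] orth_commute[OF assms(1) scale_vecs[OF assms(3,2)]] orth_commute[OF assms(1,2)] by simp
qed

end


section \<open>Potentials on the basis graph\<close>

context orth_matroid
begin

text \<open>Adjacency is witnessed by a transversal one toggle away from both bases, because the
  vector on that transversal carries the ratio of the two values.\<close>

definition adj :: "elt set \<Rightarrow> elt set \<Rightarrow> bool" where
  "adj B B' \<longleftrightarrow> (\<exists>T \<in> transversals n. \<exists>e \<in> circ T. \<exists>f \<in> circ T. e \<noteq> f \<and> B = flip T e \<and> B' = flip T f)"

lemma adj_sym: "adj B B' \<Longrightarrow> adj B' B"
  unfolding adj_def by metis

lemma adj_flip2:
  assumes "B \<in> \<B>" "e \<in> B" "f \<in> B" "e \<noteq> f" "flip (flip B e) f \<in> \<B>"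
  shows "flip B e \<in> transversals n" "star e \<in> circ (flip B e)" "f \<in> circ (flip B e)" "star e \<noteq> f"
    "adj B (flip (flip B e) f)"
proof -
  note tr = basis_transversal[OF assms(1)]
  show T: "flip B e \<in> transversals n"
    using flip_transversal[OF tr] in_transversal_ground[OF tr] assms by blast
  show ne: "star e \<noteq> f"
    using transversal_star[OF tr] assms by blast
  show c: "star e \<in> circ (flip B e)" "f \<in> circ (flip B e)"
    using assms transversal_star[OF tr] ne by (auto simp: circ_def in_flip_iff)
  show "adj B (flip (flip B e) f)"
    unfolding adj_def using T c ne by (metis flip_flip flip_star)
qed

lemma adjE:
  assumes "adj B B'"
  obtains e f where "B \<in> \<B>" "e \<in> B" "f \<in> B" "e \<noteq> f" "B' = flip (flip B e) f" "B' \<in> \<B>"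
proof -
  obtain T e f where T: "T \<in> transversals n" "e \<in> circ T" "f \<in> circ T" "e \<noteq> f" "B = flip T e" "B' = flip T f"
    using assms unfolding adj_def by blast
  then have "star e \<in> B" "f \<in> B" "star e \<noteq> f" "B \<in> \<B>" "B' \<in> \<B>"
    using transversal_star[OF T(1)] circ_subset[of T] by (auto simp: in_flip_iff circ_def)
  with T that[of "star e" f] show thesis by simp
qed

end

text \<open>
  Two steps from a basis towards a base point are connected by triangles, or else none of the four
  bases exchanging one element of each step exists, and then they span a square. So triangles and
  squares of this kind generate all relations between the cycles of the basis graph.
\<close>

locale basis_cocycle = orth_matroid n \<B> + group G
  for n :: nat and \<B> :: "elt set set" and G :: "('g, 'b) monoid_scheme" (structure) +
  fixes \<gamma> :: "elt set \<Rightarrow> elt set \<Rightarrow> 'g"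
  assumes closed: "adj B B' \<Longrightarrow> \<gamma> B B' \<in> carrier G"
    and inverse: "adj B B' \<Longrightarrow> \<gamma> B' B = inv (\<gamma> B B')"
    and triangle: "\<lbrakk>T \<in> transversals n; e \<in> circ T; f \<in> circ T; g \<in> circ T; e \<noteq> f; f \<noteq> g; e \<noteq> g\<rbrakk> \<Longrightarrow>
      \<gamma> (flip T e) (flip T f) \<otimes> \<gamma> (flip T f) (flip T g) = \<gamma> (flip T e) (flip T g)"
    and square: "\<lbrakk>B \<in> \<B>; {a, b, c, d} \<subseteq> B; distinct [a, b, c, d];
        flip (flip B a) b \<in> \<B>; flip (flip B c) d \<in> \<B>;
        flip (flip B a) c \<notin> \<B>; flip (flip B a) d \<notin> \<B>; flip (flip B b) c \<notin> \<B>; flip (flip B b) d \<notin> \<B>\<rbrakk> \<Longrightarrow>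
      flip (flip (flip (flip B a) b) c) d \<in> \<B> \<and>
      \<gamma> B (flip (flip B a) b) \<otimes> \<gamma> (flip (flip B a) b) (flip (flip (flip (flip B a) b) c) d) =
      \<gamma> B (flip (flip B c) d) \<otimes> \<gamma> (flip (flip B c) d) (flip (flip (flip (flip B a) b) c) d)"
begin

text \<open>\<open>B\<close> and the two other bases are all neighbours of \<open>flip B e\<close>,
  reached by toggling \<open>star e\<close>, \<open>f\<close> and \<open>g\<close>.\<close>

lemma triangle':
  assumes "B \<in> \<B>" "e \<in> B" "f \<in> B" "g \<in> B" "e \<noteq> f" "e \<noteq> g" "f \<noteq> g"
    "flip (flip B e) f \<in> \<B>" "flip (flip B e) g \<in> \<B>"
  shows "adj (flip (flip B e) f) (flip (flip B e) g)"
    "\<gamma> (flip (flip B e) f) (flip (flip B e) g) \<otimes> \<gamma> (flip (flip B e) g) B = \<gamma> (flip (flip B e) f) B"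
proof -
  note f = adj_flip2[OF assms(1,2,3,5,8)] and g = adj_flip2[OF assms(1,2,4,6,9)]
  show "adj (flip (flip B e) f) (flip (flip B e) g)"
    unfolding adj_def using f g assms(7) by metis
  show "\<gamma> (flip (flip B e) f) (flip (flip B e) g) \<otimes> \<gamma> (flip (flip B e) g) B = \<gamma> (flip (flip B e) f) B"
    using triangle[OF f(1,3) g(3,2)] f(4) g(4) assms(7) by simp
qed

section \<open>Extending a potential by distance from a base point\<close>

context
  fixes B0 :: "elt set"
  assumes B0: "B0 \<in> \<B>"
begin

text \<open>An exchange changes this number by 0 or 2; levels without bases do no harm to an
  induction that advances by one.\<close>

definition dst :: "elt set \<Rightarrow> nat" where "dst B = card (B - B0)"

definition consistent :: "nat \<Rightarrow> (elt set \<Rightarrow> 'g) \<Rightarrow> bool" where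
  "consistent k \<phi> \<longleftrightarrow> (\<forall>B. \<phi> B \<in> carrier G) \<and>
    (\<forall>B B'. adj B B' \<and> dst B \<le> k \<and> dst B' \<le> k \<longrightarrow> \<phi> B' = \<phi> B \<otimes> \<gamma> B B')"

lemma diff_flip2:
  assumes "B \<in> transversals n" "e \<in> B" "f \<in> B" "e \<noteq> f"
  shows "flip (flip B e) f - B0 = (B - B0 - {e, f}) \<union> ({star e, star f} - B0)"
proof -
  have st: "star e \<notin> B" "star f \<notin> B"
    using transversal_star[OF assms(1)] assms by auto
  show ?thesis
  proof (rule Set.set_eqI)
    fix x
    show "x \<in> flip (flip B e) f - B0 \<longleftrightarrow> x \<in> (B - B0 - {e, f}) \<union> ({star e, star f} - B0)"
      using st assms(2-4) by (cases "x = e"; cases "x = f"; cases "x = star e"; cases "x = star f")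
        (simp_all add: in_flip_iff)
  qed
qed

lemma star_in_B0: "B \<in> transversals n \<Longrightarrow> e \<in> B \<Longrightarrow> star e \<in> B0 \<longleftrightarrow> e \<notin> B0"
  using transversalD(2)[OF basis_transversal[OF B0]] in_transversal_ground by blast

lemma dst_flip2:
  assumes "B \<in> transversals n" "e \<in> B" "f \<in> B" "e \<noteq> f"
  shows "e \<notin> B0 \<Longrightarrow> f \<notin> B0 \<Longrightarrow> dst B = dst (flip (flip B e) f) + 2"
    "e \<in> B0 \<Longrightarrow> f \<notin> B0 \<Longrightarrow> dst (flip (flip B e) f) = dst B"
    "e \<in> B0 \<Longrightarrow> f \<in> B0 \<Longrightarrow> dst (flip (flip B e) f) = dst B + 2"
proof -
  have fin: "finite (B - B0)" using finite_transversal[OF assms(1)] by simp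
  have st: "star e \<notin> B" "star f \<notin> B"
    using transversal_star[OF assms(1)] assms by auto
  note sB = star_in_B0[OF assms(1,2)] star_in_B0[OF assms(1,3)]
  show "dst B = dst (flip (flip B e) f) + 2" if *: "e \<notin> B0" "f \<notin> B0"
  proof -
    have "star e \<in> B0" "star f \<in> B0" using * sB by simp_all
    then have "{star e, star f} - B0 = {}" by simp
    then have "flip (flip B e) f - B0 = B - B0 - {e} - {f}"
      unfolding diff_flip2[OF assms] by auto
    moreover have "e \<in> B - B0" "f \<in> B - B0 - {e}" using * assms by simp_all
    ultimately show ?thesis
      unfolding dst_def using fin by (metis card_Suc_Diff1 add_2_eq_Suc' finite_Diff)
  qed
  show "dst (flip (flip B e) f) = dst B" if *: "e \<in> B0" "f \<notin> B0"
  proof -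
    have "star e \<notin> B0" "star f \<in> B0" using * sB by simp_all
    then have "{star e, star f} - B0 = {star e}" by auto
    then have "flip (flip B e) f - B0 = insert (star e) (B - B0 - {f})"
      unfolding diff_flip2[OF assms] using * by auto
    moreover have "f \<in> B - B0" "star e \<notin> B - B0 - {f}" using * assms st by simp_all
    ultimately show ?thesis
      unfolding dst_def using fin by (metis card_insert_disjoint card_Suc_Diff1 finite_Diff)
  qed
  show "dst (flip (flip B e) f) = dst B + 2" if *: "e \<in> B0" "f \<in> B0"
  proof -
    have "star e \<notin> B0" "star f \<notin> B0" using * sB by simp_all
    then have "{star e, star f} - B0 = {star e, star f}" by auto
    then have "flip (flip B e) f - B0 = insert (star e) (insert (star f) (B - B0))"
      unfolding diff_flip2[OF assms] using * by auto
    moreover have "star f \<notin> B - B0" "star e \<notin> insert (star f) (B - B0)" using assms st by simp_all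
    ultimately show ?thesis
      unfolding dst_def using fin by simp
  qed
qed

text \<open>The element \<open>e\<close> to be removed can be prescribed. This freedom provides
  common lower neighbours for two bases of the same level.\<close>

lemma descent:
  assumes "B \<in> \<B>" "e \<in> B - B0"
  obtains f where "f \<in> B - B0" "f \<noteq> e" "flip (flip B e) f \<in> \<B>"
  using exchange[OF assms(1) B0 assms(2)] by blast

context
  fixes k \<phi>
  assumes cons: "consistent k \<phi>"
begin

lemma phi_closed [simp]: "\<phi> B \<in> carrier G"
  using cons by (auto simp: consistent_def)

lemma phi_adj: "adj B B' \<Longrightarrow> dst B \<le> k \<Longrightarrow> dst B' \<le> k \<Longrightarrow> \<phi> B' = \<phi> B \<otimes> \<gamma> B B'"
  using cons by (auto simp: consistent_def)

text \<open>The value at \<open>B\<close> that is forced by the edge from a lower neighbour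
  \<open>B'\<close>.\<close>

definition val :: "elt set \<Rightarrow> elt set \<Rightarrow> 'g" where
  "val B B' = \<phi> B' \<otimes> \<gamma> B' B"

definition down :: "elt set \<Rightarrow> elt \<Rightarrow> elt \<Rightarrow> bool" where
  "down B e f \<longleftrightarrow> e \<in> B - B0 \<and> f \<in> B - B0 \<and> e \<noteq> f \<and> flip (flip B e) f \<in> \<B>"

lemma down_sym: "down B e f \<Longrightarrow> down B f e"
  by (auto simp: down_def flip_commute)

lemma down_adj: "B \<in> \<B> \<Longrightarrow> down B e f \<Longrightarrow> adj B (flip (flip B e) f)"
  using adj_flip2(5) by (auto simp: down_def)

lemma down_dst: "B \<in> \<B> \<Longrightarrow> down B e f \<Longrightarrow> dst B = dst (flip (flip B e) f) + 2"
  using dst_flip2(1)[OF basis_transversal] by (auto simp: down_def)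

text \<open>Two descents through the same \<open>e\<close> form a triangle with \<open>B\<close>,
  and the edge opposite \<open>B\<close> lies in the range where \<open>\<phi>\<close> is already
  consistent.\<close>

lemma val_share:
  assumes B: "B \<in> \<B>" "dst B = Suc k" and d: "down B e f" "down B e g"
  shows "val B (flip (flip B e) f) = val B (flip (flip B e) g)"
proof (cases "f = g")
  case False
  let ?P = "flip (flip B e) f" and ?Q = "flip (flip B e) g"
  have h: "e \<in> B" "f \<in> B" "g \<in> B" "e \<noteq> f" "e \<noteq> g" "?P \<in> \<B>" "?Q \<in> \<B>"
    using d by (auto simp: down_def)
  note t = triangle'[OF B(1) h(1-5) False h(6,7)]
  have "\<phi> ?Q = \<phi> ?P \<otimes> \<gamma> ?P ?Q"
    using phi_adj[OF t(1)] down_dst[OF B(1) d(1)] down_dst[OF B(1) d(2)] B(2) by simp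
  then show ?thesis
    using t closed[OF t(1)] closed[OF adj_sym[OF down_adj[OF B(1) d(2)]]]
    by (simp add: val_def m_assoc)
qed simp

lemma val_unique:
  assumes B: "B \<in> \<B>" "dst B = Suc k" and d: "down B a b" "down B c d"
  shows "val B (flip (flip B a) b) = val B (flip (flip B c) d)"
proof -
  note share = val_share[OF B]
  \<comment> \<open>A mixed descent through \<open>a\<close> and \<open>c\<close> connects the two
    given ones by two triangles.\<close>
  have link: "val B (flip (flip B a) b) = val B (flip (flip B c) d)" if "down B a b" "down B c d" "down B a c" for a b c d
    using share[OF that(1,3)] share[OF down_sym[OF that(3)] that(2)] by (simp add: flip_commute[of B c a])
  have s: "flip (flip B b) a = flip (flip B a) b" "flip (flip B d) c = flip (flip B c) d"
    by (rule flip_commute)+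
  consider "a = c \<or> a = d \<or> b = c \<or> b = d" | "down B a c" | "down B a d" | "down B b c" | "down B b d"
    | "distinct [a, b, c, d]" "\<not> down B a c" "\<not> down B a d" "\<not> down B b c" "\<not> down B b d"
    using d by (auto simp: down_def)
  then show ?thesis
  proof cases
    case 1
    then show ?thesis
      using share[OF d(1), of d] share[OF d(1), of c] share[OF down_sym[OF d(1)], of d]
        share[OF down_sym[OF d(1)], of c] d(2) down_sym[OF d(2)] s by auto
  next
    case 2
    then show ?thesis using link[OF d] by blast
  next
    case 3
    then show ?thesis using link[OF d(1) down_sym[OF d(2)]] s by simp
  next
    case 4
    then show ?thesis using link[OF down_sym[OF d(1)] d(2)] s by simp
  next
    case 5
    then show ?thesis using link[OF down_sym[OF d(1)] down_sym[OF d(2)]] s by simp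
  next
    \<comment> \<open>Neither a shared element nor a mixed descent: \<open>square\<close> supplies a
      common lower neighbour \<open>?R\<close> of \<open>?P\<close> and \<open>?Q\<close>, and both
      values are computed from \<open>\<phi> ?R\<close>.\<close>
    case 6
    let ?P = "flip (flip B a) b" and ?Q = "flip (flip B c) d"
    let ?R = "flip (flip ?P c) d"
    have sub: "{a, b, c, d} \<subseteq> B" and P: "?P \<in> \<B>" and Q: "?Q \<in> \<B>"
      using d by (auto simp: down_def)
    have sq: "?R \<in> \<B>" "\<gamma> B ?P \<otimes> \<gamma> ?P ?R = \<gamma> B ?Q \<otimes> \<gamma> ?Q ?R"
      using square[OF B(1) sub 6(1) P Q] 6 d by (auto simp: down_def)
    have R: "?R = flip (flip ?Q a) b"
      by (simp only: flip_commute)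
    have st: "star a \<notin> B" "star b \<notin> B" "star c \<notin> B" "star d \<notin> B"
      using sub transversal_star[OF basis_transversal[OF B(1)]] by auto
    then have "c \<in> ?P" "d \<in> ?P" "a \<in> ?Q" "b \<in> ?Q"
      using sub 6(1) by (auto simp: in_flip_iff)
    then have dP: "down ?P c d" and dQ: "down ?Q a b"
      using d 6(1) sq(1) R by (auto simp: down_def)
    have aP: "adj B ?P" "adj ?P ?R" and aQ: "adj B ?Q" "adj ?Q ?R"
      using down_adj[OF B(1) d(1)] down_adj[OF P dP] down_adj[OF B(1) d(2)] down_adj[OF Q dQ] R by auto
    have dst: "dst ?P \<le> k" "dst ?Q \<le> k" "dst ?R \<le> k"
      using down_dst[OF B(1) d(1)] down_dst[OF P dP] down_dst[OF B(1) d(2)] B(2) by auto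
    have *: "val B S = \<phi> ?R \<otimes> inv (\<gamma> B S \<otimes> \<gamma> S ?R)" if "adj B S" "adj S ?R" "dst S \<le> k" for S
    proof -
      have "\<phi> S = \<phi> ?R \<otimes> inv (\<gamma> S ?R)"
        using phi_adj[OF adj_sym[OF that(2)] dst(3) that(3)] inverse[OF that(2)] by simp
      then show ?thesis
        using inverse[OF that(1)] closed[OF that(1)] closed[OF that(2)]
        by (simp add: val_def inv_mult_group m_assoc)
    qed
    show ?thesis
      using *[OF aP dst(1)] *[OF aQ dst(2)] sq(2) by simp
  qed
qed

lemma consistent_extend: "\<exists>\<psi>. consistent (Suc k) \<psi>"
proof -
  \<comment> \<open>An arbitrary lower neighbour; by \<open>val_unique\<close> the choice does not
    affect the value.\<close>
  define nb where "nb B = (SOME P. \<exists>e f. down B e f \<and> P = flip (flip B e) f)" for B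
  define \<psi> where "\<psi> B = (if B \<in> \<B> \<and> dst B = Suc k then val B (nb B) else \<phi> B)" for B
  have psi_new: "\<psi> B = val B (flip (flip B e) f)" if B: "B \<in> \<B>" "dst B = Suc k" and d: "down B e f" for B e f
  proof -
    have "\<exists>P e f. down B e f \<and> P = flip (flip B e) f"
      using d by blast
    then have "\<exists>e f. down B e f \<and> nb B = flip (flip B e) f"
      unfolding nb_def by (rule someI_ex)
    then obtain e' f' where "down B e' f'" "nb B = flip (flip B e') f'" by blast
    then have "val B (nb B) = val B (flip (flip B e) f)"
      using val_unique[OF B _ d] by simp
    then show ?thesis using B by (simp add: \<psi>_def)
  qed
  have psi_old: "\<psi> B = \<phi> B" if "dst B \<le> k" for B
    using that by (simp add: \<psi>_def)
  have ex_down: "\<exists>f. down B e f" if "B \<in> \<B>" "e \<in> B - B0" for B e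
    using descent[OF that] that unfolding down_def by metis
  have psi_closed: "\<psi> B \<in> carrier G" for B
  proof (cases "B \<in> \<B> \<and> dst B = Suc k")
    case True
    then have "card (B - B0) \<noteq> 0" by (simp add: dst_def)
    then have "B - B0 \<noteq> {}" by (metis card.empty)
    then obtain e where "e \<in> B - B0" by blast
    then obtain f where "down B e f" using ex_down True by blast
    then show ?thesis
      using psi_new closed[OF adj_sym[OF down_adj]] True by (simp add: val_def)
  qed (auto simp: \<psi>_def)
  have main: "\<psi> B' = \<psi> B \<otimes> \<gamma> B B'" if a: "adj B B'" and d: "dst B = Suc k" "dst B' \<le> Suc k" for B B'
  proof -
    \<comment> \<open>Ordered so that \<open>e\<close> lies outside \<open>B0\<close> as soon as the
      upward step, with both elements in \<open>B0\<close>, is excluded by the distance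
      bound.\<close>
    obtain e f where ef: "B \<in> \<B>" "e \<in> B" "f \<in> B" "e \<noteq> f" "B' = flip (flip B e) f" "B' \<in> \<B>"
        and e0: "e \<in> B0 \<Longrightarrow> f \<in> B0"
    proof -
      obtain e f where ef: "B \<in> \<B>" "e \<in> B" "f \<in> B" "e \<noteq> f" "B' = flip (flip B e) f" "B' \<in> \<B>"
        using a by (elim adjE) blast
      show thesis
      proof (cases "e \<in> B0 \<longrightarrow> f \<in> B0")
        case True
        then show thesis using that[of e f] ef by blast
      next
        case False
        then show thesis using that[of f e] ef by (auto simp: flip_commute)
      qed
    qed
    note tr = basis_transversal[OF ef(1)]
    have eB: "e \<notin> B0"
      using dst_flip2(3)[OF tr ef(2,3,4)] e0 d ef(5) by auto
    show ?thesis
    proof (cases "f \<in> B0")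
      case False
      then have "down B e f" using ef eB by (auto simp: down_def)
      then have "\<psi> B = \<phi> B' \<otimes> \<gamma> B' B" "\<psi> B' = \<phi> B'"
        using psi_new[OF ef(1) d(1)] down_dst[OF ef(1)] d ef(5) psi_old by (auto simp: val_def)
      then show ?thesis
        using inverse[OF a] closed[OF a] by (simp add: m_assoc)
    next
      \<comment> \<open>A step within the level. A descent from \<open>B\<close> through
        \<open>e\<close> and some \<open>h\<close> reaches \<open>?Q\<close>, which also lies below
        \<open>B'\<close>, through \<open>star f\<close> and \<open>h\<close>; the triangle on
        \<open>B\<close>, \<open>B'\<close>, \<open>?Q\<close> gives the relation.\<close>
      case True
      have d': "dst B' = Suc k"
        using dst_flip2(2)[OF tr ef(3,2)] ef True eB d by (simp add: flip_commute)
      obtain h where h: "down B e h" using ex_down ef(1,2) eB by blast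
      then have h': "h \<in> B" "h \<notin> B0" "h \<noteq> e" "h \<noteq> f" and Q: "flip (flip B e) h \<in> \<B>"
        using True by (auto simp: down_def)
      have st: "star e \<notin> B" "star f \<notin> B" "star h \<notin> B"
        using transversal_star[OF tr] ef h' by auto
      have eqQ: "flip (flip B' (star f)) h = flip (flip B e) h"
        unfolding ef(5) by simp
      have "star f \<in> B'" "h \<in> B'" "star f \<notin> B0" "star f \<noteq> h"
        using ef h' st True star_in_B0[OF tr ef(3)] by (auto simp: in_flip_iff)
      then have h2: "down B' (star f) h"
        using h' Q eqQ by (auto simp: down_def)
      let ?Q = "flip (flip B e) h"
      have psi: "\<psi> B = \<phi> ?Q \<otimes> \<gamma> ?Q B" "\<psi> B' = \<phi> ?Q \<otimes> \<gamma> ?Q B'"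
        using psi_new[OF ef(1) d(1) h] psi_new[OF ef(6) d' h2] eqQ by (simp_all add: val_def)
      have "\<gamma> ?Q B' \<otimes> \<gamma> B' B = \<gamma> ?Q B"
        using triangle'(2)[OF ef(1,2) h'(1) ef(3) h'(3)[symmetric] ef(4) h'(4) Q] ef by simp
      moreover have cl: "\<gamma> ?Q B' \<in> carrier G" "\<gamma> B B' \<in> carrier G"
        using closed a adj_sym[OF down_adj[OF ef(6) h2]] eqQ by auto
      ultimately have "\<gamma> ?Q B' = \<gamma> ?Q B \<otimes> \<gamma> B B'"
        using inverse[OF a] by (metis inv_closed inv_solve_right m_closed)
      then show ?thesis
        using psi cl closed[OF adj_sym[OF down_adj[OF ef(1) h]]] by (simp add: m_assoc)
    qed
  qed
  have "\<psi> B' = \<psi> B \<otimes> \<gamma> B B'" if a: "adj B B'" and d: "dst B \<le> Suc k" "dst B' \<le> Suc k" for B B'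
  proof -
    consider "dst B = Suc k" | "dst B' = Suc k" | "dst B \<le> k" "dst B' \<le> k"
      using d by linarith
    then show ?thesis
    proof cases
      case 1
      then show ?thesis using main a d by blast
    next
      case 2
      then have "\<psi> B = \<psi> B' \<otimes> inv (\<gamma> B B')"
        using main[OF adj_sym[OF a]] d inverse[OF a] by simp
      then show ?thesis
        using closed[OF a] psi_closed by (simp add: m_assoc)
    next
      case 3
      then show ?thesis using phi_adj[OF a] psi_old by simp
    qed
  qed
  then show ?thesis
    using psi_closed unfolding consistent_def by blast
qed

end

lemma consistent_exists: "\<exists>\<phi>. consistent k \<phi>"
proof (induction k)
  case 0
  \<comment> \<open>Level 0 has no edges: its only basis is \<open>B0\<close>, and adjacent bases
    differ.\<close>
  have False if a: "adj B B'" and d0: "dst B = 0" "dst B' = 0" for B B'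
  proof -
    obtain e f where ef: "B \<in> \<B>" "e \<in> B" "f \<in> B" "e \<noteq> f" "B' = flip (flip B e) f" "B' \<in> \<B>"
      using a by (elim adjE) blast
    have "B - B0 = {}" "B' - B0 = {}"
      using d0 finite_transversal[OF basis_transversal] ef by (auto simp: dst_def)
    then have "B = B'"
      using transversal_eqI[OF basis_transversal basis_transversal[OF B0]] ef by blast
    then show False
      using ef transversal_star[OF basis_transversal[OF ef(1)]] by (metis in_flip_iff)
  qed
  then have "consistent 0 (\<lambda>_. \<one>)" by (auto simp: consistent_def)
  then show ?case by blast
qed (use consistent_extend in blast)

end

theorem potential_exists:
  obtains \<phi> where "\<And>B. \<phi> B \<in> carrier G" "\<And>B B'. adj B B' \<Longrightarrow> \<phi> B' = \<phi> B \<otimes> \<gamma> B B'"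
proof -
  obtain B0 where B0: "B0 \<in> \<B>" using bases_nonempty by blast
  obtain \<phi> where \<phi>: "consistent B0 (card (ground n)) \<phi>"
    using consistent_exists[OF B0] by blast
  have "dst B0 B \<le> card (ground n)" if "B \<in> \<B>" for B
    unfolding dst_def[OF B0] using transversalD(1)[OF basis_transversal[OF that]] by (intro card_mono) auto
  moreover have "B \<in> \<B>" "B' \<in> \<B>" if "adj B B'" for B B'
    using that by (auto elim: adjE)
  ultimately show thesis
    using that \<phi> unfolding consistent_def[OF B0] by blast
qed

end


section \<open>Spans of fundamental circuit vectors\<close>

lemma tilde_id [simp]: "tilde id X = X"
  by (auto simp: tilde_def fun_eq_iff option.map_id split: elt.split)

context tract
begin

lemma smult_id: "smult F id a X = scale a X"
  by (auto simp: smult_def scale_def option.map_id fun_eq_iff split: elt.split)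

text \<open>Among the sets \<open>flip B i\<close> only that of \<open>g\<close> contains
  \<open>g\<close>, so the sum collapses to one term against \<open>X g\<close>. Coefficients are
  therefore forced by the coordinates outside \<open>B\<close>.\<close>

lemma span_coeff:
  assumes B: "B \<in> transversals n" and X: "X \<in> V n"
    and Xs: "\<And>e. e \<in> star ` B \<Longrightarrow> Xs e \<in> V n" "\<And>e. e \<in> star ` B \<Longrightarrow> supp (Xs e) \<subseteq> flip B e"
    and c: "\<And>i. i \<in> star ` B \<Longrightarrow> c i \<in> K" and g: "g \<in> star ` B"
  shows "(\<Sum>i \<in> star ` B. formal (c i \<odot> Xs i g)) + formal (tn (X g)) \<in> nulls F \<longleftrightarrow> c g \<odot> Xs g g = X g"
proof -
  have "Xs i g = None" if i: "i \<in> star ` B" "i \<noteq> g" for i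
  proof -
    have "g \<noteq> star i" "g \<notin> B"
      using g i star_transversal[OF B] by (auto simp: star_image_iff)
    then have "g \<notin> supp (Xs i)"
      using Xs(2)[OF i(1)] i(2) by (auto simp: in_flip_iff dest!: subsetD)
    then show ?thesis by (simp add: in_supp_iff)
  qed
  then have "(\<Sum>i \<in> star ` B. formal (c i \<odot> Xs i g)) = (\<Sum>i \<in> {g}. formal (c i \<odot> Xs i g))"
    using g finite_transversal[OF B] by (intro sum.mono_neutral_right) auto
  then show ?thesis
    using formal_pair_null[of "c g \<odot> Xs g g" "tn (X g)"] Xs(1)[OF g] c[OF g] X by auto
qed

text \<open>By \<open>span_coeff\<close> every coefficient but that of \<open>e\<close> vanishes,
  and each coordinate becomes a two-term null sum. This later yields uniqueness and minimality of
  fundamental vectors.\<close>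

lemma span_single:
  assumes B: "B \<in> transversals n" and X: "X \<in> lin_span F n (star ` B) Xs"
    and Xs: "\<And>e. e \<in> star ` B \<Longrightarrow> Xs e \<in> V n" "\<And>e. e \<in> star ` B \<Longrightarrow> supp (Xs e) \<subseteq> flip B e"
      "\<And>e. e \<in> star ` B \<Longrightarrow> Xs e e = Some \<one>"
    and e: "e \<in> star ` B" "supp X \<subseteq> flip B e"
  shows "X = scale (X e) (Xs e)"
proof
  fix f
  obtain c where c: "\<And>i. i \<in> star ` B \<Longrightarrow> c i \<in> K"
      "\<And>g. g \<in> ground n \<Longrightarrow> (\<Sum>i \<in> star ` B. formal (c i \<odot> Xs i g)) + formal (tn (X g)) \<in> nulls F"
    and XV: "X \<in> V n"
    using X by (auto simp: lin_span_def)
  have cX: "c g = X g" if g: "g \<in> star ` B" for g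
  proof -
    have "g \<in> ground n" using g star_transversal[OF B] by blast
    then have "c g \<odot> Xs g g = X g"
      using span_coeff[of B n X Xs c g] B XV Xs(1,2) c g by blast
    then show ?thesis using c(1)[OF g] Xs(3)[OF g] by simp
  qed
  have cN: "c g = None" if g: "g \<in> star ` B" "g \<noteq> e" for g
  proof -
    have "star e \<in> B" "g \<notin> B" using g e star_transversal[OF B] by (simp_all add: star_image_iff)
    then have "g \<notin> B" "g \<noteq> star e" by auto
    then have "g \<notin> flip B e" using g(2) by (simp add: in_flip_iff)
    then have "g \<notin> supp X" using e(2) by blast
    then show ?thesis using cX[OF g(1)] by (simp add: in_supp_iff)
  qed
  show "X f = scale (X e) (Xs e) f"
  proof (cases "f \<in> ground n")
    case True
    have "(\<Sum>i \<in> star ` B. formal (c i \<odot> Xs i f)) = (\<Sum>i \<in> {e}. formal (c i \<odot> Xs i f))"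
      using e(1) cN finite_transversal[OF B] by (intro sum.mono_neutral_right) simp_all
    then have "formal (c e \<odot> Xs e f) + formal (tn (X f)) \<in> nulls F"
      using c(2)[OF True] by simp
    moreover have K: "c e \<odot> Xs e f \<in> K" "X f \<in> K"
      using c(1)[OF e(1)] vecs_K[OF Xs(1)[OF e(1)]] vecs_K[OF XV] by simp_all
    ultimately have "tn (X f) = tn (c e \<odot> Xs e f)"
      using formal_pair_null[OF K(1) tn_closed[OF K(2)]] by blast
    then have "X f = c e \<odot> Xs e f" using tn_inject[OF K(2,1)] by blast
    then show ?thesis unfolding scale_def cX[OF e(1)] .
  next
    case False
    then have "X f = None" "Xs e f = None"
      using XV Xs(1)[OF e(1)] unfolding vecs_def by blast+
    then show ?thesis by (simp add: scale_def)
  qed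
qed

text \<open>By \<open>pw\<close> the matrix of coefficients is skew-symmetric up to the diagonal
  units, which turns the row at \<open>f\<close> of the span condition into the pairing with the
  vector at \<open>star f\<close>.\<close>

lemma span_iff_orth:
  assumes B: "B \<in> transversals n" and X: "X \<in> V n"
    and Xs: "\<And>e. e \<in> star ` B \<Longrightarrow> Xs e \<in> V n" "\<And>e. e \<in> star ` B \<Longrightarrow> supp (Xs e) \<subseteq> flip B e"
      "\<And>e. e \<in> star ` B \<Longrightarrow> Xs e e \<noteq> None"
    and pw: "\<And>e f. e \<in> star ` B \<Longrightarrow> f \<in> star ` B \<Longrightarrow> e \<noteq> f \<Longrightarrow> orth n (Xs e) (Xs f)"
  shows "X \<in> lin_span F n (star ` B) Xs \<longleftrightarrow> (\<forall>e \<in> star ` B. orth n X (Xs e))"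
proof -
  define c where "c i = X i \<odot> ti (Xs i i)" for i
  have cK: "c i \<in> K" if "i \<in> star ` B" for i
    using Xs(1)[OF that] X by (simp add: c_def)
  note fin = finite_transversal[OF B]
  have B_star: "x \<in> star ` B \<longleftrightarrow> x \<notin> B" if "x \<in> ground n" for x
    using star_transversal[OF B] that by blast
  have key: "(\<Sum>i \<in> star ` B. formal (c i \<odot> Xs i f)) + formal (tn (X f)) \<in> nulls F \<longleftrightarrow> orth n X (Xs (star f))"
    if f: "f \<in> B" for f
  proof -
    define h where "h = star f"
    have h: "h \<in> star ` B" using f by (simp add: h_def)
    have fg: "f \<in> ground n" "f \<notin> star ` B"
      using f in_transversal_ground[OF B] B_star by auto
    define S where "S = star ` B - {h}"
    have fS: "f \<notin> S" and finS: "finite S" using fg fin by (auto simp: S_def)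
    \<comment> \<open>The unit that carries the \<open>f\<close> term of the pairing to
      \<open>tn (X f)\<close>.\<close>
    define u where "u = tn (ti (Xs h h))"
    have u: "u \<in> K" "u \<noteq> None" using Xs(1,3)[OF h] by (auto simp: u_def)
    have hh: "Xs h h \<in> K" "Xs h h \<noteq> None" using Xs(1,3)[OF h] by auto
    have uf: "u \<odot> (X f \<odot> Xs h (star f)) = tn (X f)"
      using X hh by (simp add: u_def h_def[symmetric] tn_tm tm_comm[of "X f"])
    have ux: "u \<odot> (X x \<odot> Xs h (star x)) = c x \<odot> Xs x f" if x: "x \<in> S" for x
    proof -
      have x': "x \<in> star ` B" "x \<noteq> h" "x \<in> ground n" "x \<noteq> f"
        using x fS star_transversal[OF B] by (auto simp: S_def)
      have "orth n (Xs x) (Xs h)" using pw x' h by blast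
      moreover have "y = x \<or> y = f" if "Xs x y \<noteq> None" "Xs h (star y) \<noteq> None" for y
      proof -
        have "y \<in> flip B x" "star y \<in> flip B h"
          using Xs(2)[OF x'(1)] Xs(2)[OF h] that by (auto simp: supp_def)
        then show ?thesis
          using star_in_flip[OF B x'(1) h] by (simp add: h_def)
      qed
      ultimately have "Xs x f \<odot> Xs h (star f) = tn (Xs x x \<odot> Xs h (star x))"
        using orth_pair[OF Xs(1)[OF x'(1)] Xs(1)[OF h] x'(3) fg(1) x'(4)] by blast
      \<comment> \<open>Skew-symmetry: after division by the diagonal entries, the coordinate of
        \<open>Xs h\<close> at \<open>star x\<close> is minus that of \<open>Xs x\<close> at
        \<open>f\<close>.\<close>
      then have eq: "Xs x x \<odot> Xs h (star x) = tn (Xs x f \<odot> Xs h h)"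
        using Xs(1)[OF x'(1)] Xs(1)[OF h] by (simp add: h_def)
      have xx: "Xs x x \<in> K" "Xs x x \<noteq> None" "Xs x f \<in> K" using Xs(1,3)[OF x'(1)] by auto
      have "Xs h (star x) = ti (Xs x x) \<odot> (Xs x x \<odot> Xs h (star x))"
        using xx Xs(1)[OF h] by simp
      also have "\<dots> = tn (ti (Xs x x) \<odot> Xs x f \<odot> Xs h h)"
        unfolding eq using xx hh by (simp add: tn_tm tm_assoc)
      finally have "u \<odot> (X x \<odot> Xs h (star x)) = ti (Xs h h) \<odot> (X x \<odot> (ti (Xs x x) \<odot> Xs x f \<odot> Xs h h))"
        using xx hh X by (simp add: u_def tn_tm)
      also have "\<dots> = X x \<odot> (ti (Xs x x) \<odot> (Xs x f \<odot> (ti (Xs h h) \<odot> Xs h h)))"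
        using xx hh X by (simp add: tm_ac del: tm_ti_cancel)
      finally show ?thesis
        using xx hh X by (simp add: c_def tm_ti tm_assoc)
    qed
    have "orth n X (Xs h) \<longleftrightarrow> (\<Sum>x \<in> insert f S. formal (X x \<odot> Xs h (star x))) \<in> nulls F"
    proof (rule orth_restrict)
      show "insert f S \<subseteq> ground n"
        using fg star_transversal[OF B] by (auto simp: S_def)
      fix x assume x: "x \<in> ground n" "X x \<noteq> None" "Xs h (star x) \<noteq> None"
      then have "star x \<in> flip B h" using Xs(2)[OF h] by (auto simp: supp_def)
      then show "x \<in> insert f S"
        using B_star[OF x(1)] transversalD(2)[OF B x(1)] f
        by (cases "x = f"; cases "x = star f") (auto simp: in_flip_iff S_def h_def split: if_splits)
    qed
    also have "\<dots> \<longleftrightarrow> (\<Sum>x \<in> insert f S. formal (u \<odot> (X x \<odot> Xs h (star x)))) \<in> nulls F"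
      using null_sum_scale[OF u, of "insert f S" "\<lambda>x. X x \<odot> Xs h (star x)"] X Xs(1)[OF h] by simp
    also have "(\<Sum>x \<in> insert f S. formal (u \<odot> (X x \<odot> Xs h (star x)))) = (\<Sum>i \<in> S. formal (c i \<odot> Xs i f)) + formal (tn (X f))"
      using fS finS ux by (simp add: uf)
    also have "(\<Sum>i \<in> S. formal (c i \<odot> Xs i f)) = (\<Sum>i \<in> star ` B. formal (c i \<odot> Xs i f))"
    proof (rule sum.mono_neutral_left)
      have "Xs h f = None"
        using Xs(2)[OF h] f by (auto simp: supp_def in_flip_iff h_def)
      then show "\<forall>i \<in> star ` B - S. formal (c i \<odot> Xs i f) = {#}"
        by (auto simp: S_def)
    qed (use fin in \<open>auto simp: S_def\<close>)
    finally show ?thesis by (simp add: h_def)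
  qed
  show ?thesis
  proof
    assume "X \<in> lin_span F n (star ` B) Xs"
    then obtain c' where c': "\<And>i. i \<in> star ` B \<Longrightarrow> c' i \<in> K"
        "\<And>g. g \<in> ground n \<Longrightarrow> (\<Sum>i \<in> star ` B. formal (c' i \<odot> Xs i g)) + formal (tn (X g)) \<in> nulls F"
      by (auto simp: lin_span_def)
    have "c' g = c g" if g: "g \<in> star ` B" for g
    proof -
      have "g \<in> ground n" using g star_transversal[OF B] by blast
      then have "c' g \<odot> Xs g g = X g"
        using span_coeff[of B n X Xs c' g] B X Xs(1,2) c' g by blast
      then have "c g = c' g \<odot> Xs g g \<odot> ti (Xs g g)" by (simp add: c_def)
      then show ?thesis
        using c'(1)[OF g] Xs(1,3)[OF g] by (simp add: tm_assoc tm_ti)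
    qed
    then have "(\<Sum>i \<in> star ` B. formal (c i \<odot> Xs i g)) = (\<Sum>i \<in> star ` B. formal (c' i \<odot> Xs i g))" for g
      by (intro sum.cong) simp_all
    then have "orth n X (Xs (star f))" if "f \<in> B" for f
      using c'(2)[of f] key[OF that] in_transversal_ground[OF B that] by simp
    then show "\<forall>e \<in> star ` B. orth n X (Xs e)"
      by blast
  next
    assume *: "\<forall>e \<in> star ` B. orth n X (Xs e)"
    have "(\<Sum>i \<in> star ` B. formal (c i \<odot> Xs i g)) + formal (tn (X g)) \<in> nulls F" if "g \<in> ground n" for g
    proof (cases "g \<in> B")
      case True
      then show ?thesis using key * by simp
    next
      case False
      then have g: "g \<in> star ` B" using B_star that by blast
      have "c g \<odot> Xs g g = X g"
        using Xs(1,3)[OF g] X by (simp add: c_def tm_assoc tm_ti)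
      then show ?thesis
        using span_coeff[of B n X Xs c g] B X Xs(1,2) cK g by blast
    qed
    then show "X \<in> lin_span F n (star ` B) Xs"
      using cK X unfolding lin_span_def by blast
  qed
qed

end


section \<open>Signatures orthogonal on pairs meeting in two elements\<close>

text \<open>The common ground of strong signatures and strong circuit sets: enough orthogonality to
  fix ratios inside a circuit, before full orthogonality or (L) is assumed.\<close>

locale circuit_signature = tract F + orth_matroid n \<B>
  for F :: "('g, 'b) tract_scheme" (structure) and n :: nat and \<B> :: "elt set set" +
  fixes \<C> :: "(elt \<Rightarrow> 'g option) set"
  assumes sign: "signature F id n \<B> \<C>"
    and orth2: "\<lbrakk>X \<in> \<C>; Y \<in> \<C>; card (supp X \<inter> star ` supp Y) = 2\<rbrakk> \<Longrightarrow> orth n X Y"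
begin

lemma C_vecs: "X \<in> \<C> \<Longrightarrow> X \<in> V n"
  using sign by (auto simp: signature_def)

lemma C_circuit: "X \<in> \<C> \<Longrightarrow> supp X \<in> circuits n \<B>"
  using sign by (auto simp: signature_def)

lemma circuit_C: "C \<in> circuits n \<B> \<Longrightarrow> \<exists>X \<in> \<C>. supp X = C"
  using sign unfolding signature_def by (metis imageE)

lemma C_scale: "X \<in> \<C> \<Longrightarrow> a \<in> K \<Longrightarrow> a \<noteq> None \<Longrightarrow> scale a X \<in> \<C>"
  using sign by (auto simp: signature_def smult_id elim!: K_cases)

lemma C_nonzero: "X \<in> \<C> \<Longrightarrow> X \<noteq> zero_vec"
  using C_circuit[of X] circuit_nonempty by (auto simp: zero_vec_def supp_def)

lemma common_circ_flip2:
  assumes "T \<in> transversals n" "e \<in> circ T" "f \<in> circ T" "e \<noteq> f"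
    and "supp X = circ T" "supp Z = circ (flip (flip T e) f)"
  shows "supp X \<inter> star ` supp Z = {e, f}"
proof -
  have "x = e \<or> x = f" if "x \<in> circ T" "star x \<in> circ (flip (flip T e) f)" for x
    using star_in_flip2[OF assms(1), of e f x] that assms(2,3) circ_subset by blast
  then show ?thesis
    using circ_flip2[OF assms(1-4)] assms by (intro Set.set_eqI) (auto simp: star_image_iff)
qed

lemma ratio_eq:
  assumes T: "T \<in> transversals n" "e \<in> circ T" "f \<in> circ T" "e \<noteq> f"
    and X: "X \<in> V n" "supp X = circ T" and Z: "Z \<in> \<C>" "supp Z = circ (flip (flip T e) f)"
    and "orth n X Z"
  shows "X f \<odot> Z (star f) = tn (X e \<odot> Z (star e))"
proof -
  note c = common_circ_flip2[OF T X(2) Z(2)]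
  have "x = e \<or> x = f" if "X x \<noteq> None" "Z (star x) \<noteq> None" for x
  proof -
    have "x \<in> supp X \<inter> star ` supp Z" using that by (auto simp: supp_def star_image_iff)
    then show ?thesis using c by auto
  qed
  moreover have "e \<in> ground n" "f \<in> ground n"
    using T circ_subset[of T] in_transversal_ground by auto
  ultimately show ?thesis
    using orth_pair[OF X(1) C_vecs[OF Z(1)] _ _ T(4)] assms(9) by blast
qed

text \<open>Each ratio of coordinates is fixed by a probe from \<open>\<C>\<close> that meets the
  support in just two elements, hence is the same for \<open>X\<close> and \<open>Y\<close>. Since
  \<open>X\<close> may lie outside \<open>\<C>\<close>, this applies to vectors of the orthogonal
  complement.\<close>

lemma proportional:
  assumes X: "X \<in> V n" "\<And>Z. Z \<in> \<C> \<Longrightarrow> card (supp X \<inter> star ` supp Z) = 2 \<Longrightarrow> orth n X Z"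
    and Y: "Y \<in> \<C>" "supp Y = supp X"
  obtains a where "a \<in> carrier F" "X = scale (Some a) Y"
proof -
  have cX: "supp X \<in> circuits n \<B>" using C_circuit[OF Y(1)] Y(2) by simp
  then obtain e where e: "e \<in> supp X" using circuit_nonempty by blast
  obtain B where B: "B \<in> \<B>" "e \<in> star ` B" "supp X = circ (flip B e)"
    using circuit_fundamental[OF cX e] .
  define T where "T = flip B e"
  have T: "T \<in> transversals n" "supp X = circ T" "supp Y = circ T"
    using fundamental_circ(1)[OF B(1,2)] B Y(2) by (auto simp: T_def)
  have Ye: "Y e \<in> K" "Y e \<noteq> None" and XeK: "X e \<in> K" and Xe: "X e \<noteq> None"
    using e Y C_vecs[OF Y(1)] X(1) by (auto simp: supp_def)
  define a where "a = X e \<odot> ti (Y e)"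
  have aK: "a \<in> K" "a \<noteq> None" using Ye XeK Xe by (auto simp: a_def)
  have "X f = a \<odot> Y f" for f
  proof -
    consider "f \<notin> supp X" | "f = e" | "f \<in> supp X" "f \<noteq> e" by blast
    then show ?thesis
    proof cases
      case 1
      then have "f \<notin> supp Y" using Y(2) by simp
      with 1 show ?thesis by (simp add: in_supp_iff)
    next
      case 2
      then show ?thesis using Ye XeK by (simp add: a_def tm_assoc tm_ti)
    next
      case 3
      have ef: "e \<in> circ T" "f \<in> circ T" "e \<noteq> f" using 3 e T by auto
      note T' = circ_flip2[OF T(1) ef]
      \<comment> \<open>The probe: it pairs with vectors on \<open>circ T\<close> only at
        \<open>e\<close> and \<open>f\<close>.\<close>
      obtain Z where Z: "Z \<in> \<C>" "supp Z = circ (flip (flip T e) f)"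
        using circuit_C[OF circ_circuit[OF T'(1)]] T'(2) by blast
      have ZK: "Z x \<in> K" "Y x \<in> K" "X x \<in> K" for x
        using C_vecs[OF Z(1)] C_vecs[OF Y(1)] X(1) by auto
      have Zf: "Z (star f) \<noteq> None" using T'(3) Z(2) by (auto simp: supp_def)
      have 2: "card (supp U \<inter> star ` supp Z) = 2" if "supp U = circ T" for U :: "elt \<Rightarrow> 'g option"
        using common_circ_flip2[OF T(1) ef that Z(2)] ef(3) by simp
      have "X f \<odot> Z (star f) = tn (X e \<odot> Z (star e))"
        using ratio_eq[OF T(1) ef X(1) T(2) Z] X(2)[OF Z(1) 2[OF T(2)]] by blast
      also have "X e = a \<odot> Y e" using Ye XeK by (simp add: a_def tm_assoc tm_ti)
      also have "tn (a \<odot> Y e \<odot> Z (star e)) = a \<odot> tn (Y e \<odot> Z (star e))"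
        using aK ZK by (simp add: tn_tm tm_assoc)
      also have "tn (Y e \<odot> Z (star e)) = Y f \<odot> Z (star f)"
        using ratio_eq[OF T(1) ef C_vecs[OF Y(1)] T(3) Z] orth2[OF Y(1) Z(1) 2[OF T(3)]] by simp
      finally have "Z (star f) \<odot> X f = Z (star f) \<odot> (a \<odot> Y f)"
        using ZK aK by (simp add: tm_ac)
      then show ?thesis
        using tm_left_cancel[of "Z (star f)" "X f" "a \<odot> Y f"] ZK aK Zf by simp
    qed
  qed
  then have "X = scale a Y" by (auto simp: scale_def)
  then show thesis using that aK by (auto elim!: K_cases)
qed

text \<open>The pairing can survive only at \<open>e\<close> and \<open>star f\<close>, and does so
  at both or at neither, since either incidence says that \<open>flip (flip B e) f\<close> is a
  basis.\<close>

lemma fundamental_orth: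
  assumes B: "B \<in> \<B>" and e: "e \<in> star ` B" "f \<in> star ` B" "e \<noteq> f"
    and X: "X \<in> \<C>" "supp X = circ (flip B e)" and Y: "Y \<in> \<C>" "supp Y = circ (flip B f)"
  shows "orth n X Y"
proof -
  note tr = basis_transversal[OF B]
  have ef: "star e \<in> B" "star f \<in> B" "e \<notin> B" "f \<notin> B"
    using e star_transversal[OF tr] by (auto simp: star_image_iff)
  have sub: "x = e \<or> x = star f" if "x \<in> circ (flip B e)" "star x \<in> circ (flip B f)" for x
    using star_in_flip[OF tr e(1,2), of x] that circ_subset by blast
  have iff: "star e \<in> circ (flip B f) \<longleftrightarrow> star f \<in> circ (flip B e)"
    using ef e(3) by (auto simp: circ_def in_flip_iff flip_commute[of B e])
  note mem = fundamental_circ(2)[OF B e(1)] fundamental_circ(2)[OF B e(2)]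
  show ?thesis
  proof (cases "star e \<in> circ (flip B f)")
    case True
    then have "supp X \<inter> star ` supp Y = {e, star f}"
      using sub iff mem X(2) Y(2) True by (intro Set.set_eqI) (auto simp: star_image_iff)
    moreover have "e \<noteq> star f" using ef by auto
    ultimately show ?thesis using orth2[OF X(1) Y(1)] by simp
  next
    case False
    have "X x = None \<or> Y (star x) = None" for x
    proof (rule ccontr)
      assume "\<not> (X x = None \<or> Y (star x) = None)"
      then have "x \<in> circ (flip B e)" "star x \<in> circ (flip B f)"
        using X(2) Y(2) by (auto simp: supp_def)
      then show False using sub False iff by blast
    qed
    then show ?thesis by (rule orth_disjoint)
  qed
qed

lemma fundamental_span_iff:
  assumes B: "B \<in> \<B>" and Xs: "\<And>e. e \<in> star ` B \<Longrightarrow> Xs e \<in> \<C> \<and> supp (Xs e) = circ (flip B e)"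
    and X: "X \<in> V n"
  shows "X \<in> lin_span F n (star ` B) Xs \<longleftrightarrow> (\<forall>e \<in> star ` B. orth n X (Xs e))"
proof (rule span_iff_orth[OF basis_transversal[OF B] X])
  fix e assume e: "e \<in> star ` B"
  show "Xs e \<in> V n" using Xs[OF e] C_vecs by blast
  show "supp (Xs e) \<subseteq> flip B e" using Xs[OF e] circ_subset by blast
  show "Xs e e \<noteq> None"
    using fundamental_circ(2)[OF B e] Xs[OF e] by (auto simp: supp_def)
  fix f assume "f \<in> star ` B" "e \<noteq> f"
  then show "orth n (Xs e) (Xs f)"
    using fundamental_orth[OF B e] Xs e by blast
qed

lemma fundamental_family:
  assumes B: "B \<in> \<B>"
  obtains Xs where "\<And>e. e \<in> star ` B \<Longrightarrow> Xs e \<in> \<C> \<and> supp (Xs e) = circ (flip B e)"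
proof -
  have "\<forall>e \<in> star ` B. \<exists>X. X \<in> \<C> \<and> supp X = circ (flip B e)"
    using circuit_C fundamental_circ(3)[OF B] by blast
  then show thesis using that by metis
qed

text \<open>The family in (L) is arbitrary, so any \<open>Y\<close> can be made one of its members;
  the span criterion then gives orthogonality to that member.\<close>

lemma strong_iff_span:
  "(\<forall>X \<in> \<C>. \<forall>Y \<in> \<C>. orth n X Y) \<longleftrightarrow>
   (\<forall>X \<in> \<C>. \<forall>B \<in> \<B>. \<forall>Xs. (\<forall>e \<in> star ` B. Xs e \<in> \<C> \<and> supp (Xs e) = fund_circuit n \<B> B e) \<longrightarrow>
      X \<in> lin_span F n (star ` B) Xs)"
proof (intro iffI ballI allI impI)
  fix X B Xs
  assume strong: "\<forall>X \<in> \<C>. \<forall>Y \<in> \<C>. orth n X Y" and X: "X \<in> \<C>" and B: "B \<in> \<B>"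
    and Xs: "\<forall>e \<in> star ` B. Xs e \<in> \<C> \<and> supp (Xs e) = fund_circuit n \<B> B e"
  then have Xs: "Xs e \<in> \<C> \<and> supp (Xs e) = circ (flip B e)" if "e \<in> star ` B" for e
    using that fund_circuit_eq[OF B] by metis
  show "X \<in> lin_span F n (star ` B) Xs"
    using fundamental_span_iff[OF B Xs C_vecs[OF X]] strong X Xs by blast
next
  fix X Y
  assume L: "\<forall>X \<in> \<C>. \<forall>B \<in> \<B>. \<forall>Xs. (\<forall>e \<in> star ` B. Xs e \<in> \<C> \<and> supp (Xs e) = fund_circuit n \<B> B e) \<longrightarrow>
      X \<in> lin_span F n (star ` B) Xs" and X: "X \<in> \<C>" and Y: "Y \<in> \<C>"
  obtain e where e: "e \<in> supp Y" using circuit_nonempty[OF C_circuit[OF Y]] by blast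
  obtain B where B: "B \<in> \<B>" "e \<in> star ` B" "supp Y = circ (flip B e)"
    using circuit_fundamental[OF C_circuit[OF Y] e] .
  obtain Xs0 where Xs0: "\<And>e. e \<in> star ` B \<Longrightarrow> Xs0 e \<in> \<C> \<and> supp (Xs0 e) = circ (flip B e)"
    using fundamental_family[OF B(1)] by blast
  define Xs where "Xs = Xs0(e := Y)"
  have Xs: "Xs e \<in> \<C> \<and> supp (Xs e) = circ (flip B e)" if "e \<in> star ` B" for e
    using Xs0[OF that] Y B(3) by (auto simp: Xs_def)
  then have "X \<in> lin_span F n (star ` B) Xs"
    using L X B(1) fund_circuit_eq[OF B(1)] by simp
  then have "orth n X (Xs e)"
    using fundamental_span_iff[OF B(1) Xs C_vecs[OF X]] B(2) by blast
  then show "orth n X Y" by (simp add: Xs_def)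
qed

lemma support_basis_C: "support_basis n \<C> B \<longleftrightarrow> B \<in> \<B>"
proof (cases "B \<in> transversals n")
  case True
  have "(\<exists>X \<in> \<C> - {zero_vec}. supp X \<subseteq> B) \<longleftrightarrow> (\<exists>C \<in> circuits n \<B>. C \<subseteq> B)"
    using C_circuit circuit_C C_nonzero by blast
  then show ?thesis
    using basis_iff_no_circuit[OF True] True by (auto simp: support_basis_def)
qed (use basis_transversal in \<open>auto simp: support_basis_def\<close>)

text \<open>The transversal \<open>flip B e\<close> contains a single circuit, so containment of
  supports improves to equality.\<close>

lemma fund_circuit_form_C:
  assumes B: "B \<in> \<B>"
  shows "fund_circuit_form F \<C> B Xs \<longleftrightarrow>
    (\<forall>e \<in> star ` B. Xs e \<in> \<C> \<and> supp (Xs e) = circ (flip B e) \<and> Xs e e = Some \<one>)"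
proof -
  have "X \<in> \<C> \<and> supp X \<subseteq> sym_diff B {e, star e} \<and> X e = Some \<one> \<longleftrightarrow> X \<in> \<C> \<and> supp X = circ (flip B e) \<and> X e = Some \<one>"
    if e: "e \<in> star ` B" for X e
    unfolding flip_def[symmetric]
    using circ_unique[OF fundamental_circ(1)[OF B e]] fundamental_circ(2)[OF B e] C_circuit circ_subset by blast
  then show ?thesis by (auto simp: fund_circuit_form_def)
qed

lemma normalize:
  assumes Y: "Y \<in> \<C>" and e: "e \<in> supp Y"
  shows "scale (ti (Y e)) Y \<in> \<C>" "supp (scale (ti (Y e)) Y) = supp Y" "scale (ti (Y e)) Y e = Some \<one>"
proof -
  have Ye: "Y e \<noteq> None" "Y e \<in> K" using e C_vecs[OF Y] by (auto simp: in_supp_iff)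
  then show "scale (ti (Y e)) Y \<in> \<C>" "supp (scale (ti (Y e)) Y) = supp Y"
    using C_scale[OF Y] by simp_all
  show "scale (ti (Y e)) Y e = Some \<one>" using Ye by (simp add: scale_def tm_ti)
qed

lemma ex_form_C:
  assumes B: "B \<in> \<B>"
  obtains Xs where "fund_circuit_form F \<C> B Xs"
proof -
  obtain Zs where Zs: "\<And>e. e \<in> star ` B \<Longrightarrow> Zs e \<in> \<C> \<and> supp (Zs e) = circ (flip B e)"
    using fundamental_family[OF B] by blast
  have "fund_circuit_form F \<C> B (\<lambda>e. scale (ti (Zs e e)) (Zs e))"
    unfolding fund_circuit_form_C[OF B]
  proof
    fix e assume e: "e \<in> star ` B"
    then have "Zs e \<in> \<C>" "supp (Zs e) = circ (flip B e)" "e \<in> supp (Zs e)"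
      using Zs fundamental_circ(2)[OF B e] by simp_all
    then show "scale (ti (Zs e e)) (Zs e) \<in> \<C> \<and> supp (scale (ti (Zs e e)) (Zs e)) = circ (flip B e) \<and>
        scale (ti (Zs e e)) (Zs e) e = Some \<one>"
      using normalize[of "Zs e" e] by simp
  qed
  then show thesis by (rule that)
qed

definition perp :: "(elt \<Rightarrow> 'g option) set" where
  "perp = {X \<in> V n. \<forall>Y \<in> \<C>. orth n X Y}"

lemma fundamental_span_perp: "fundamental_span F id n \<C> = perp"
proof (intro subset_antisym subsetI)
  fix X assume X: "X \<in> perp"
  then have XV: "X \<in> V n" by (simp add: perp_def)
  have "X \<in> lin_span F n (star ` B) Xs" if B: "B \<in> \<B>" and form: "fund_circuit_form F \<C> B Xs" for B Xs
  proof -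
    have Xs: "Xs e \<in> \<C> \<and> supp (Xs e) = circ (flip B e)" if "e \<in> star ` B" for e
      using form that unfolding fund_circuit_form_C[OF B] by blast
    then show ?thesis
      using fundamental_span_iff[OF B Xs XV] X by (simp add: perp_def)
  qed
  then show "X \<in> fundamental_span F id n \<C>"
    using X by (auto simp: fundamental_span_def support_basis_C perp_def)
next
  fix X assume X: "X \<in> fundamental_span F id n \<C>"
  then have XV: "X \<in> V n" by (simp add: fundamental_span_def)
  have "orth n X Y" if Y: "Y \<in> \<C>" for Y
  proof -
    obtain e where e: "e \<in> supp Y" using circuit_nonempty[OF C_circuit[OF Y]] by blast
    obtain B where B: "B \<in> \<B>" "e \<in> star ` B" "supp Y = circ (flip B e)"
      using circuit_fundamental[OF C_circuit[OF Y] e] .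
    obtain Xs0 where Xs0: "fund_circuit_form F \<C> B Xs0" using ex_form_C[OF B(1)] .
    \<comment> \<open>The span condition holds for every form, so one may be chosen that contains a
      multiple of \<open>Y\<close>.\<close>
    define Xs where "Xs = Xs0(e := scale (ti (Y e)) Y)"
    have form: "fund_circuit_form F \<C> B Xs"
      using Xs0 normalize[OF Y e] B(3) unfolding fund_circuit_form_C[OF B(1)] Xs_def by (metis fun_upd_apply)
    then have Xs: "Xs g \<in> \<C> \<and> supp (Xs g) = circ (flip B g)" if "g \<in> star ` B" for g
      using that unfolding fund_circuit_form_C[OF B(1)] by blast
    have "X \<in> lin_span F n (star ` B) Xs"
      using X B(1) form by (simp add: fundamental_span_def support_basis_C)
    then have "orth n X (Xs e)"
      using fundamental_span_iff[OF B(1) Xs XV] B(2) by blast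
    moreover have "Xs e = scale (ti (Y e)) Y" by (simp add: Xs_def)
    ultimately show ?thesis
      using orth_scale(2)[OF XV C_vecs[OF Y], of "ti (Y e)"] e C_vecs[OF Y] by (simp add: supp_def)
  qed
  then show "X \<in> perp" using XV by (simp add: perp_def)
qed

end


section \<open>From circuit sets to vector sets\<close>

locale strong_signature = circuit_signature +
  assumes strong: "X \<in> \<C> \<Longrightarrow> Y \<in> \<C> \<Longrightarrow> orth n X Y"
begin

lemma perp_vecs: "X \<in> perp \<Longrightarrow> X \<in> V n"
  by (simp add: perp_def)

lemma C_perp: "X \<in> \<C> \<Longrightarrow> X \<in> perp"
  using C_vecs strong by (auto simp: perp_def)

text \<open>For \<open>f\<close> in \<open>B\<close>, the circuit vector at \<open>star f\<close> is
  nonzero there and can meet \<open>X\<close> in the pairing only at \<open>f\<close>; so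
  \<open>X f\<close> vanishes.\<close>

lemma perp_in_basis:
  assumes X: "X \<in> perp" and B: "B \<in> \<B>" "supp X \<subseteq> B"
  shows "X = zero_vec"
proof -
  note tr = basis_transversal[OF B(1)]
  have "X f = None" if f: "f \<in> B" for f
  proof -
    have e: "star f \<in> star ` B" using f by simp
    obtain Y where Y: "Y \<in> \<C>" "supp Y = circ (flip B (star f))"
      using circuit_C[OF fundamental_circ(3)[OF B(1) e]] by blast
    have "x = f" if "X x \<noteq> None" "Y (star x) \<noteq> None" for x
    proof -
      have x: "x \<in> B" "star x \<in> flip B f"
        using that B(2) Y(2) circ_subset[of "flip B f"] by (auto simp: in_supp_iff[symmetric])
      have "star x \<notin> B" "star x \<noteq> f"
        using transversal_star[OF tr x(1)] f by auto
      then show ?thesis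
        using x(2) by (auto simp: in_flip_iff split: if_splits)
    qed
    then have "X f = None \<or> Y (star f) = None"
      using orth_single[OF perp_vecs[OF X] C_vecs[OF Y(1)]] X Y(1) in_transversal_ground[OF tr f]
      by (auto simp: perp_def)
    moreover have "Y (star f) \<noteq> None"
      using fundamental_circ(2)[OF B(1) e] Y(2) by (simp add: in_supp_iff[symmetric])
    ultimately show ?thesis by blast
  qed
  then show ?thesis
    using B(2) by (auto simp: zero_vec_def supp_def)
qed

lemma perp_dependent:
  assumes "X \<in> perp" "X \<noteq> zero_vec" "admissible n (supp X)"
  shows "dependent n \<B> (supp X)"
  using perp_in_basis assms by (auto simp: dependent_def)

text \<open>Nonzero vectors of \<open>perp\<close> with admissible support are dependent, so none
  lies strictly inside a circuit. Conversely, an elementary vector contains a circuit, has it as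
  support by minimality, and is a multiple of the circuit vector by
  \<open>proportional\<close>.\<close>

lemma elementary_perp: "elementary_vectors n perp = \<C>"
proof (intro subset_antisym subsetI)
  fix X assume X: "X \<in> \<C>"
  have "\<not> supp Y \<subset> supp X" if Y: "Y \<in> perp - {zero_vec}" for Y
  proof
    assume sub: "supp Y \<subset> supp X"
    then have "admissible n (supp Y)"
      using admissible_subset circuit_admissible[OF C_circuit[OF X]] by blast
    then show False
      using perp_dependent Y sub C_circuit[OF X] by (auto simp: circuits_def)
  qed
  then show "X \<in> elementary_vectors n perp"
    using C_perp[OF X] C_nonzero[OF X] circuit_admissible[OF C_circuit[OF X]]
    by (auto simp: elementary_vectors_def)
next
  fix X assume X: "X \<in> elementary_vectors n perp"
  then have XP: "X \<in> perp" and "X \<noteq> zero_vec" "admissible n (supp X)"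
      and min: "\<And>Y. Y \<in> perp - {zero_vec} \<Longrightarrow> \<not> supp Y \<subset> supp X"
    by (auto simp: elementary_vectors_def)
  then obtain C where C: "C \<in> circuits n \<B>" "C \<subseteq> supp X"
    using perp_dependent dependent_contains_circuit by metis
  then obtain Y where Y: "Y \<in> \<C>" "supp Y = C" using circuit_C by blast
  then have "supp Y = supp X"
    using min[of Y] C_perp C_nonzero C(2) by blast
  then obtain a where "a \<in> carrier F" "X = scale (Some a) Y"
    using proportional[OF perp_vecs[OF XP] _ Y(1)] XP by (auto simp: perp_def)
  then show "X \<in> \<C>" using C_scale[OF Y(1)] by auto
qed

lemma support_basis_perp: "support_basis n perp B \<longleftrightarrow> B \<in> \<B>"
proof
  assume "support_basis n perp B"
  then have "support_basis n \<C> B" using C_perp by (auto simp: support_basis_def)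
  then show "B \<in> \<B>" by (simp add: support_basis_C)
next
  assume "B \<in> \<B>"
  then show "support_basis n perp B"
    using perp_in_basis basis_transversal by (auto simp: support_basis_def)
qed

text \<open>A member of \<open>perp\<close> supported in \<open>flip B e\<close> is a multiple of
  the circuit vector by \<open>span_single\<close>, and the normalisation at \<open>e\<close> makes
  the factor \<open>\<one>\<close>. So passing from \<open>\<C>\<close> to \<open>perp\<close>
  creates no new forms, which is what (V3) asks for.\<close>

lemma fund_circuit_form_perp:
  assumes B: "B \<in> \<B>"
  shows "fund_circuit_form F perp B Xs \<longleftrightarrow> fund_circuit_form F \<C> B Xs"
proof
  assume "fund_circuit_form F \<C> B Xs"
  then show "fund_circuit_form F perp B Xs"
    using C_perp by (auto simp: fund_circuit_form_def)
next
  assume form: "fund_circuit_form F perp B Xs"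
  obtain Ys where Ys: "fund_circuit_form F \<C> B Ys" using ex_form_C[OF B] .
  have Ys': "Ys e \<in> \<C>" "supp (Ys e) \<subseteq> flip B e" "Ys e e = Some \<one>" if "e \<in> star ` B" for e
    using Ys that unfolding fund_circuit_form_def flip_def by blast+
  have "Xs e = Ys e" if e: "e \<in> star ` B" for e
  proof -
    have X: "Xs e \<in> perp" "supp (Xs e) \<subseteq> flip B e" "Xs e e = Some \<one>"
      using form e unfolding fund_circuit_form_def flip_def by blast+
    then have "Xs e \<in> fundamental_span F id n \<C>"
      by (simp add: fundamental_span_perp)
    then have "Xs e \<in> lin_span F n (star ` B) Ys"
      using Ys B by (simp add: fundamental_span_def support_basis_C)
    then have "Xs e = scale (Xs e e) (Ys e)"
      using span_single[OF basis_transversal[OF B], of "Xs e" Ys e] Ys' C_vecs e X(2) by blast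
    then show ?thesis
      using X(3) C_vecs[OF Ys'(1)[OF e]] by (simp add: scale_def)
  qed
  then show "fund_circuit_form F \<C> B Xs"
    using Ys by (auto simp: fund_circuit_form_def)
qed

lemma orthogonal_vector_set_perp: "orthogonal_vector_set F id n perp"
proof -
  have "fundamental_span F id n perp = fundamental_span F id n \<C>"
    unfolding fundamental_span_def using support_basis_perp support_basis_C fund_circuit_form_perp by blast
  then have V3: "perp = fundamental_span F id n perp"
    by (simp add: fundamental_span_perp)
  have "\<exists>Xs. fund_circuit_form F perp B Xs" if B: "B \<in> \<B>" for B
    using ex_form_C[OF B] fund_circuit_form_perp[OF B] by blast
  then show ?thesis
    unfolding orthogonal_vector_set_def inner_prod_id elementary_perp support_basis_perp
    using V3 perp_vecs strong bases_nonempty by blast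
qed

end


section \<open>From vector sets to circuit sets\<close>

text \<open>No matroid is given here; it has to be built from the support bases before the results
  on signatures become available.\<close>

locale vector_set = tract F
  for F :: "('g, 'b) tract_scheme" (structure) +
  fixes n :: nat and \<V> :: "(elt \<Rightarrow> 'g option) set"
  assumes ov: "orthogonal_vector_set F id n \<V>"
begin

definition bases :: "elt set set" where "bases = {B. support_basis n \<V> B}"

definition elem :: "(elt \<Rightarrow> 'g option) set" where "elem = elementary_vectors n \<V>"

lemma V_vecs: "X \<in> \<V> \<Longrightarrow> X \<in> V n"
  using ov by (auto simp: orthogonal_vector_set_def)

lemma bases_transversal: "B \<in> bases \<Longrightarrow> B \<in> transversals n"
  by (simp add: bases_def support_basis_def)

lemma V_in_basis: "B \<in> bases \<Longrightarrow> X \<in> \<V> \<Longrightarrow> supp X \<subseteq> B \<Longrightarrow> X = zero_vec"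
  by (auto simp: bases_def support_basis_def)

lemma ex_form: "B \<in> bases \<Longrightarrow> \<exists>Xs. fund_circuit_form F \<V> B Xs"
  using ov by (auto simp: orthogonal_vector_set_def bases_def)

lemma formD:
  assumes "fund_circuit_form F \<V> B Xs" "e \<in> star ` B"
  shows "Xs e \<in> \<V>" "Xs e \<in> V n" "supp (Xs e) \<subseteq> flip B e" "Xs e e = Some \<one>"
  using assms V_vecs unfolding fund_circuit_form_def flip_def by blast+

lemma V_span:
  assumes "X \<in> \<V>" "B \<in> bases" "fund_circuit_form F \<V> B Xs"
  shows "X \<in> lin_span F n (star ` B) Xs"
proof -
  have "X \<in> fundamental_span F id n \<V>"
    using ov assms(1) by (simp add: orthogonal_vector_set_def)
  then show ?thesis using assms by (simp add: fundamental_span_def bases_def)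
qed

lemma form_single:
  assumes B: "B \<in> bases" and form: "fund_circuit_form F \<V> B Xs" and e: "e \<in> star ` B"
    and X: "X \<in> \<V>" "supp X \<subseteq> flip B e"
  shows "X = scale (X e) (Xs e)"
  using span_single[OF bases_transversal[OF B] V_span[OF X(1) B form]] formD[OF form] e X(2) by blast

lemma lin_span_scale:
  assumes X: "X \<in> lin_span F n I Xs" and a: "a \<in> carrier F" and Xs: "\<And>i. i \<in> I \<Longrightarrow> Xs i \<in> V n"
  shows "scale (Some a) X \<in> lin_span F n I Xs"
proof -
  obtain c where c: "\<And>i. i \<in> I \<Longrightarrow> c i \<in> K"
      "\<And>g. g \<in> ground n \<Longrightarrow> (\<Sum>i \<in> I. formal (c i \<odot> Xs i g)) + formal (tn (X g)) \<in> nulls F"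
    and XV: "X \<in> V n"
    using X by (auto simp: lin_span_def)
  have "(\<Sum>i \<in> I. formal (Some a \<odot> c i \<odot> Xs i g)) + formal (tn (scale (Some a) X g)) \<in> nulls F"
    if g: "g \<in> ground n" for g
  proof -
    have "image_mset (\<lambda>z. a \<otimes> z) ((\<Sum>i \<in> I. formal (c i \<odot> Xs i g)) + formal (tn (X g))) \<in> nulls F"
      using nulls_scale[OF a c(2)[OF g]] .
    moreover have "image_mset (\<lambda>z. a \<otimes> z) (\<Sum>i \<in> I. formal (c i \<odot> Xs i g)) = (\<Sum>i \<in> I. formal (Some a \<odot> c i \<odot> Xs i g))"
      unfolding image_mset_sum using a c(1) vecs_K[OF Xs] by (intro sum.cong refl) (simp add: formal_Some_tm[symmetric] tm_assoc)
    moreover have "image_mset (\<lambda>z. a \<otimes> z) (formal (tn (X g))) = formal (tn (scale (Some a) X g))"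
      using a XV by (simp add: formal_Some_tm[symmetric] scale_def tn_tm)
    ultimately show ?thesis by simp
  qed
  then show ?thesis
    using XV a c(1) unfolding lin_span_def by (auto intro!: exI[of _ "\<lambda>i. Some a \<odot> c i"])
qed

text \<open>Closure under scaling is not an axiom of vector sets; (V3) transfers it from
  spans.\<close>

lemma V_scale:
  assumes "X \<in> \<V>" "a \<in> carrier F"
  shows "scale (Some a) X \<in> \<V>"
proof -
  have "scale (Some a) X \<in> lin_span F n (star ` B) Xs" if "support_basis n \<V> B" "fund_circuit_form F \<V> B Xs" for B Xs
    using lin_span_scale[OF V_span[OF assms(1)] assms(2)] that formD(2)[OF that(2)] by (simp add: bases_def)
  then have "scale (Some a) X \<in> fundamental_span F id n \<V>"
    using V_vecs[OF assms(1)] assms(2) by (simp add: fundamental_span_def)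
  then show ?thesis using ov by (simp add: orthogonal_vector_set_def)
qed

lemma elem_V: "X \<in> elem \<Longrightarrow> X \<in> \<V>"
  by (simp add: elem_def elementary_vectors_def)

text \<open>A vector with strictly smaller support would be a multiple of \<open>Xs e\<close> by
  \<open>form_single\<close>, and a nonzero multiple has the same support.\<close>

lemma form_elem:
  assumes B: "B \<in> bases" and form: "fund_circuit_form F \<V> B Xs" and e: "e \<in> star ` B"
  shows "Xs e \<in> elem"
proof -
  note f = formD[OF form e]
  have adm: "admissible n (supp (Xs e))"
    using admissible_subset[OF transversal_admissible f(3)] flip_transversal[OF bases_transversal[OF B]]
      star_transversal[OF bases_transversal[OF B]] e by blast
  have "Xs e \<noteq> zero_vec" using f(4) by (auto simp: zero_vec_def)
  moreover have "\<not> supp X \<subset> supp (Xs e)" if X: "X \<in> \<V> - {zero_vec}" for X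
  proof
    assume sub: "supp X \<subset> supp (Xs e)"
    then have eq: "X = scale (X e) (Xs e)"
      using form_single[OF B form e, of X] X f(3) by blast
    have "X e \<noteq> None"
    proof
      assume "X e = None"
      then have "X = zero_vec" using eq by (simp add: scale_def zero_vec_def)
      then show False using X by simp
    qed
    then have "supp X = supp (Xs e)" using eq by (metis supp_scale)
    then show False using sub by blast
  qed
  ultimately show ?thesis
    using f(1) adm by (simp add: elem_def elementary_vectors_def)
qed

lemma elem_orth: "X \<in> elem \<Longrightarrow> Y \<in> elem \<Longrightarrow> card (supp X \<inter> star ` supp Y) \<le> 2 \<Longrightarrow> orth n X Y"
  using ov by (simp add: orthogonal_vector_set_def elem_def inner_prod_id)

lemma form_pairwise:
  assumes B: "B \<in> bases" and form: "fund_circuit_form F \<V> B Xs" and e: "e \<in> star ` B" "f \<in> star ` B"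
  shows "orth n (Xs e) (Xs f)"
proof (rule elem_orth[OF form_elem[OF B form e(1)] form_elem[OF B form e(2)]])
  have "supp (Xs e) \<inter> star ` supp (Xs f) \<subseteq> {e, star f}"
  proof
    fix x assume "x \<in> supp (Xs e) \<inter> star ` supp (Xs f)"
    then have "x \<in> flip B e" "star x \<in> flip B f"
      using formD(3)[OF form e(1)] formD(3)[OF form e(2)] unfolding Int_iff star_image_iff by blast+
    then show "x \<in> {e, star f}"
      using star_in_flip[OF bases_transversal[OF B] e] by blast
  qed
  then have "card (supp (Xs e) \<inter> star ` supp (Xs f)) \<le> card {e, star f}"
    by (rule card_mono[rotated]) simp
  also have "\<dots> \<le> 2" by (simp add: card_insert_if)
  finally show "card (supp (Xs e) \<inter> star ` supp (Xs f)) \<le> 2" .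
qed

lemma form_orth:
  assumes B: "B \<in> bases" and form: "fund_circuit_form F \<V> B Xs" and e: "e \<in> star ` B" and X: "X \<in> \<V>"
  shows "orth n X (Xs e)"
proof -
  have "X \<in> lin_span F n (star ` B) Xs \<longleftrightarrow> (\<forall>e \<in> star ` B. orth n X (Xs e))"
    using formD[OF form] form_pairwise[OF B form]
    by (intro span_iff_orth[OF bases_transversal[OF B] V_vecs[OF X]]) simp_all
  then show ?thesis using V_span[OF X B form] e by blast
qed

text \<open>A vector on the new transversal is tested against two fundamental vectors. The one at
  \<open>e\<close> kills its coordinate at \<open>star f\<close>. Skew-symmetry makes the one at
  \<open>star f\<close> nonzero at \<open>star e\<close>, so it kills the coordinate at
  \<open>e\<close>. What remains is supported in \<open>B\<close>.\<close>

lemma basis_exchange: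
  assumes B: "B \<in> bases" and form: "fund_circuit_form F \<V> B Xs" and e: "e \<in> star ` B"
    and f: "f \<in> B" "Xs e f \<noteq> None"
  shows "flip (flip B e) f \<in> bases"
proof -
  note tr = bases_transversal[OF B]
  have ne: "e \<notin> B" "star e \<in> B" "e \<in> ground n" "f \<in> ground n"
    using e f star_transversal[OF tr] in_transversal_ground[OF tr] by (auto simp: star_image_iff)
  have fe: "f \<noteq> star e" "f \<noteq> e"
    using formD(3)[OF form e] f ne by (auto simp: in_supp_iff[symmetric] in_flip_iff dest!: subsetD)
  have sf: "star f \<in> star ` B" "star f \<noteq> e" using f fe by auto
  have T: "flip (flip B e) f \<in> transversals n"
    using flip_transversal tr ne by blast
  have V0: "X = zero_vec" if X: "X \<in> \<V>" "supp X \<subseteq> flip (flip B e) f" for X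
  proof -
    have xe: "Xs (star f) \<in> V n" "Xs (star f) (star f) = Some \<one>" "supp (Xs (star f)) \<subseteq> flip B f"
      using formD[OF form sf(1)] by auto
    have "x = star f" if "X x \<noteq> None" "Xs e (star x) \<noteq> None" for x
    proof -
      have x: "x \<in> flip (flip B e) f" "star x \<in> flip B e"
        using that X(2) formD(3)[OF form e] by (auto simp: in_supp_iff[symmetric])
      show ?thesis
        using x transversal_star[OF flip_transversal[OF tr ne(3)] x(2)] fe f(1)
        by (cases "x = star f"; cases "x = f") (auto simp: in_flip_iff split: if_splits)
    qed
    then have "X (star f) = None \<or> Xs e f = None"
      using orth_single[OF V_vecs[OF X(1)] formD(2)[OF form e], of "star f"] form_orth[OF B form e X(1)] ne by auto
    then have Xf: "X (star f) = None" using f(2) by simp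
    have "x = e \<or> x = f" if "Xs e x \<noteq> None" "Xs (star f) (star x) \<noteq> None" for x
    proof -
      have "x \<in> flip B e" "star x \<in> flip B (star f)"
        using that formD(3)[OF form e] xe(3) by (auto simp: in_supp_iff[symmetric])
      then show ?thesis
        using star_in_flip[OF tr e sf(1)] by simp
    qed
    then have "Xs e f \<odot> Xs (star f) (star f) = tn (Xs e e \<odot> Xs (star f) (star e))"
      using orth_pair[OF formD(2)[OF form e] xe(1) ne(3,4)] form_pairwise[OF B form e sf(1)] fe by blast
    then have "tn (Xs e e \<odot> Xs (star f) (star e)) \<noteq> None"
      using f(2) xe(2) by (metis option.distinct(1) tm_eq_None_iff)
    then have nz: "Xs (star f) (star e) \<noteq> None" by auto
    have "x = e" if "X x \<noteq> None" "Xs (star f) (star x) \<noteq> None" for x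
    proof -
      have x: "x \<in> flip (flip B e) f" "star x \<in> flip B f"
        using that X(2) xe(3) by (auto simp: in_supp_iff[symmetric])
      have "x \<noteq> star f" using that(1) Xf by auto
      moreover have "x \<noteq> f"
        using x(1) f(1) fe by (auto simp: in_flip_iff split: if_splits)
      ultimately have "x \<in> flip B e" "star x \<in> flip B (star f)"
        using x by (simp_all add: in_flip_iff[of x "flip B e"])
      then show ?thesis
        using star_in_flip[OF tr e sf(1)] \<open>x \<noteq> f\<close> by auto
    qed
    then have "X e = None"
      using orth_single[OF V_vecs[OF X(1)] xe(1) ne(3)] form_orth[OF B form sf(1) X(1)] nz by blast
    have "supp X \<subseteq> B"
    proof
      fix x assume "x \<in> supp X"
      then have "x \<in> flip (flip B e) f" "x \<noteq> e" "x \<noteq> star f"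
        using X(2) Xf \<open>X e = None\<close> by (auto simp: in_supp_iff)
      then show "x \<in> B" using f(1) ne(2) by (auto simp: in_flip_iff split: if_splits)
    qed
    then show ?thesis by (rule V_in_basis[OF B X(1)])
  qed
  then show ?thesis
    using T by (auto simp: bases_def support_basis_def)
qed

text \<open>For \<open>e\<close> in \<open>B2 - B1\<close>, the fundamental vector at
  \<open>e\<close> cannot be supported in the support basis \<open>B2\<close>; an element of its
  support outside \<open>B2\<close> is the exchange partner.\<close>

lemma orthogonal_matroid_bases: "orthogonal_matroid n bases"
  unfolding orthogonal_matroid_def
proof (intro conjI ballI allI impI)
  show "bases \<noteq> {}" using ov by (auto simp: orthogonal_vector_set_def bases_def)
  show "bases \<subseteq> transversals n" using bases_transversal by blast
  fix B1 B2 x assume B: "B1 \<in> bases" "B2 \<in> bases" and x: "{x, star x} \<subseteq> sym_diff B1 B2"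
  note tr = bases_transversal[OF B(1)] bases_transversal[OF B(2)]
  obtain e where e: "e = x \<or> e = star x" "e \<in> B2 - B1"
  proof (cases "x \<in> B1")
    case True
    then have "star x \<in> B2 - B1" using x transversal_diff_star[OF tr, of x] by auto
    then show thesis using that[of "star x"] by auto
  next
    case False
    then show thesis using that[of x] x by auto
  qed
  have eB: "e \<in> star ` B1"
    using e(2) star_transversal[OF tr(1)] in_transversal_ground[OF tr(2)] by blast
  obtain Xs where form: "fund_circuit_form F \<V> B1 Xs" using ex_form[OF B(1)] by blast
  have "Xs e \<noteq> zero_vec" using formD(4)[OF form eB] by (auto simp: zero_vec_def)
  then obtain f where f: "f \<in> supp (Xs e)" "f \<notin> B2"
    using V_in_basis[OF B(2) formD(1)[OF form eB]] by blast
  have "f \<in> flip B1 e" using formD(3)[OF form eB] f(1) by blast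
  moreover have "star e \<in> B1" using eB by (simp add: star_image_iff)
  ultimately have f1: "f \<in> B1" "f \<noteq> e" "f \<noteq> star e"
    using f(2) e(2) by (auto simp: in_flip_iff split: if_splits)
  have "{f, star f} \<subseteq> sym_diff B1 B2"
    using transversal_diff_star[OF tr, of f] f f1 by auto
  moreover have ne: "{f, star f} \<noteq> {x, star x}"
    using f1 e(1) by (auto simp: doubleton_eq_iff)
  moreover have "sym_diff B1 {x, star x, f, star f} = flip (flip B1 e) f"
  proof -
    have "f \<noteq> x" "f \<noteq> star x" "flip B1 e = flip B1 x" using f1 e(1) by auto
    then show ?thesis using sym_diff_eq_flip2[of f x B1] by simp
  qed
  moreover have "flip (flip B1 e) f \<in> bases"
    using basis_exchange[OF B(1) form eB f1(1)] f(1) by (simp add: in_supp_iff)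
  ultimately show "\<exists>x2. {x2, star x2} \<subseteq> sym_diff B1 B2 \<and> {x2, star x2} \<noteq> {x, star x} \<and>
      sym_diff B1 {x, star x, x2, star x2} \<in> bases"
    by (intro exI[of _ f]) simp
qed

sublocale orth_matroid n bases
  by unfold_locales (rule orthogonal_matroid_bases)

lemma V_dependent: "X \<in> \<V> \<Longrightarrow> X \<noteq> zero_vec \<Longrightarrow> admissible n (supp X) \<Longrightarrow> dependent n bases (supp X)"
  using V_in_basis by (auto simp: dependent_def)

lemma elem_dependent: "X \<in> elem \<Longrightarrow> dependent n bases (supp X)"
  using V_dependent by (auto simp: elem_def elementary_vectors_def)

text \<open>Dependence of the support bounds it from below, \<open>basis_exchange\<close> from
  above.\<close>

lemma form_supp:
  assumes B: "B \<in> bases" and form: "fund_circuit_form F \<V> B Xs" and e: "e \<in> star ` B"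
  shows "supp (Xs e) = circ (flip B e)"
proof
  note tr = bases_transversal[OF B]
  show "circ (flip B e) \<subseteq> supp (Xs e)"
    using circ_least[OF elem_dependent[OF form_elem[OF B form e]] formD(3)[OF form e]]
      transversal_admissible[OF fundamental_circ(1)[OF B e]] by blast
  show "supp (Xs e) \<subseteq> circ (flip B e)"
  proof
    fix f assume f: "f \<in> supp (Xs e)"
    then have "f \<in> flip B e" using formD(3)[OF form e] by blast
    moreover have "flip (flip B e) f \<in> bases"
    proof (cases "f = e")
      case False
      then have "f \<in> B" using \<open>f \<in> flip B e\<close> e by (auto simp: in_flip_iff star_image_iff split: if_splits)
      then show ?thesis using basis_exchange[OF B form e] f by (simp add: in_supp_iff)
    qed (use B in simp)
    ultimately show "f \<in> circ (flip B e)" by (simp add: circ_def)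
  qed
qed

text \<open>An elementary support is dependent, hence contains a circuit; a fundamental vector in
  \<open>\<V>\<close> has that circuit as support, and minimality forces equality.\<close>

lemma supp_elem: "supp ` elem = circuits n bases"
proof (intro subset_antisym subsetI)
  fix C assume C: "C \<in> circuits n bases"
  then obtain e where e: "e \<in> C" using circuit_nonempty by blast
  obtain B where B: "B \<in> bases" "e \<in> star ` B" "C = circ (flip B e)"
    using circuit_fundamental[OF C e] .
  obtain Xs where form: "fund_circuit_form F \<V> B Xs" using ex_form[OF B(1)] by blast
  show "C \<in> supp ` elem"
    using form_supp[OF B(1) form B(2)] form_elem[OF B(1) form B(2)] B(3) by (metis imageI)
next
  fix C assume "C \<in> supp ` elem"
  then obtain X where X: "X \<in> elem" "C = supp X" by blast
  obtain D where D: "D \<in> circuits n bases" "D \<subseteq> supp X"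
    using dependent_contains_circuit[OF elem_dependent[OF X(1)]] .
  then obtain e where e: "e \<in> D" using circuit_nonempty by blast
  obtain B where B: "B \<in> bases" "e \<in> star ` B" "D = circ (flip B e)"
    using circuit_fundamental[OF D(1) e] .
  obtain Xs where form: "fund_circuit_form F \<V> B Xs" using ex_form[OF B(1)] by blast
  have "supp (Xs e) = D" using form_supp[OF B(1) form B(2)] B(3) by simp
  moreover have "Xs e \<in> \<V> - {zero_vec}"
    using form_elem[OF B(1) form B(2)] by (auto simp: elem_def elementary_vectors_def)
  ultimately have "D = supp X"
    using X(1) D(2) unfolding elem_def elementary_vectors_def by blast
  then show "C \<in> circuits n bases" using D X by simp
qed

lemma elem_scale: "X \<in> elem \<Longrightarrow> a \<in> carrier F \<Longrightarrow> scale (Some a) X \<in> elem"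
proof -
  assume X: "X \<in> elem" and a: "a \<in> carrier F"
  then have "scale (Some a) X \<noteq> zero_vec"
    by (auto simp: elem_def elementary_vectors_def scale_def zero_vec_def fun_eq_iff)
  then show ?thesis
    using X V_scale[OF elem_V[OF X] a] unfolding elem_def elementary_vectors_def by simp
qed

sublocale strong_signature F n bases elem
proof
  show "signature F id n bases elem"
    using supp_elem elem_scale elem_V V_vecs by (auto simp: signature_def smult_id)
  show "orth n X Y" if "X \<in> elem" "Y \<in> elem" "card (supp X \<inter> star ` supp Y) = 2" for X Y
    using elem_orth that by simp
  \<comment> \<open>(V1) covers at most two common elements. In general \<open>Y\<close> is a
    multiple of a fundamental vector, to which (V3) makes all of \<open>\<V>\<close>
    orthogonal.\<close>
  show "orth n X Y" if X: "X \<in> elem" and Y: "Y \<in> elem" for X Y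
  proof -
    have C: "supp Y \<in> circuits n bases" using supp_elem Y by blast
    then obtain e where e: "e \<in> supp Y" using circuit_nonempty by blast
    obtain B where B: "B \<in> bases" "e \<in> star ` B" "supp Y = circ (flip B e)"
      using circuit_fundamental[OF C e] .
    obtain Xs where form: "fund_circuit_form F \<V> B Xs" using ex_form[OF B(1)] by blast
    have "Y = scale (Y e) (Xs e)"
      using form_single[OF B(1) form B(2) elem_V[OF Y]] B(3) circ_subset by blast
    moreover have "orth n X (Xs e)" by (rule form_orth[OF B(1) form B(2) elem_V[OF X]])
    moreover have "Y e \<in> K" "Y e \<noteq> None" using e V_vecs[OF elem_V[OF Y]] by (auto simp: in_supp_iff)
    ultimately show ?thesis
      using orth_scale(2)[OF V_vecs[OF elem_V[OF X]] formD(2)[OF form B(2)]] by metis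
  qed
qed

text \<open>Fundamental vectors of \<open>\<V>\<close> are elementary, so both sets have the same
  forms and (V3) applies.\<close>

lemma fundamental_span_elem: "fundamental_span F id n elem = \<V>"
proof -
  have "fund_circuit_form F elem B Xs \<longleftrightarrow> fund_circuit_form F \<V> B Xs" if "B \<in> bases" for B Xs
    using that form_elem elem_V unfolding fund_circuit_form_def by blast
  moreover have "support_basis n elem B \<longleftrightarrow> support_basis n \<V> B" for B
    by (simp add: support_basis_C) (simp add: bases_def)
  ultimately have "fundamental_span F id n elem = fundamental_span F id n \<V>"
    unfolding fundamental_span_def by (auto simp: bases_def)
  then show ?thesis using ov by (simp add: orthogonal_vector_set_def)
qed

end


section \<open>Wick functions\<close>

lemma flip_index: "sym_diff T {Plain (index e), Starred (index e)} = flip T e"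
  by (cases e) (auto simp: flip_def)

text \<open>Replaces summation over indices by summation over the members of the skew pairs that lie
  in \<open>T1\<close>, the form in which pairings appear.\<close>

lemma index_bij:
  assumes T: "T1 \<in> transversals n" "T2 \<in> transversals n"
  shows "bij_betw index (T1 - T2) {i \<in> {1..n}. Plain i \<in> sym_diff T1 T2}"
  unfolding bij_betw_def
proof
  show "inj_on index (T1 - T2)"
    using transversal_star[OF T(1)] by (auto simp: inj_on_def index_eq_iff)
  have idx: "index e \<in> {1..n}" if "e \<in> ground n" for e
    using that by (auto simp: ground_def)
  show "index ` (T1 - T2) = {i \<in> {1..n}. Plain i \<in> sym_diff T1 T2}"
  proof (intro subset_antisym subsetI)
    fix i assume "i \<in> index ` (T1 - T2)"
    then obtain e where e: "e \<in> T1 - T2" "i = index e" by blast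
    have "star e \<in> T2 - T1" using transversal_diff_star[OF T e(1)] .
    then have "Plain i \<in> sym_diff T1 T2"
      using e by (cases e) auto
    then show "i \<in> {i \<in> {1..n}. Plain i \<in> sym_diff T1 T2}"
      using idx[OF in_transversal_ground[OF T(1)], of e] e by blast
  next
    fix i assume i: "i \<in> {i \<in> {1..n}. Plain i \<in> sym_diff T1 T2}"
    show "i \<in> index ` (T1 - T2)"
    proof (cases "Plain i \<in> T1")
      case True
      then show ?thesis using i by (intro image_eqI[of _ _ "Plain i"]) auto
    next
      case False
      then have "star (Plain i) \<in> T1 - T2"
        using i transversal_diff_star[OF T(2,1), of "Plain i"] by blast
      then show ?thesis by (intro image_eqI[of _ _ "Starred i"]) auto
    qed
  qed
qed

definition pos :: "elt set \<Rightarrow> elt \<Rightarrow> nat" where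
  "pos T e = card {j. Plain j \<in> T \<and> j \<le> index e}"

lemma pos_star [simp]: "pos T (star e) = pos T e"
  by (simp add: pos_def)

text \<open>Modulo 2, the cardinalities of two sets add up to that of their symmetric difference. So
  the sign of a Wick term splits into one factor for each transversal.\<close>

lemma pos_add_parity:
  assumes T: "T1 \<in> transversals n" "T2 \<in> transversals n"
  shows "even (pos T1 e + pos T2 e) \<longleftrightarrow> even (card {j \<in> index ` (T1 - T2). j \<le> index e})"
proof -
  define P where "P T = {j. Plain j \<in> T \<and> j \<le> index e}" for T
  have fin: "finite (P T)" for T
    by (rule finite_subset[of _ "{..index e}"]) (auto simp: P_def)
  have card: "card (P T) = card (P T - P S) + card (P T \<inter> P S)" for S T
    using card_Diff_subset_Int[of "P T" "P S"] fin card_mono[of "P T" "P T \<inter> P S"] by (simp add: Int_commute)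
  have "{j \<in> index ` (T1 - T2). j \<le> index e} = (P T1 - P T2) \<union> (P T2 - P T1)"
  proof -
    have "{j \<in> index ` (T1 - T2). j \<le> index e} = {j \<in> {1..n}. Plain j \<in> sym_diff T1 T2 \<and> j \<le> index e}"
      using index_bij[OF T] by (auto simp: bij_betw_def)
    moreover have "j \<in> {1..n}" if "Plain j \<in> T1 \<or> Plain j \<in> T2" for j
      using that T[THEN transversalD(1)] by (auto simp: ground_def)
    ultimately show ?thesis by (auto simp: P_def)
  qed
  moreover have "card ((P T1 - P T2) \<union> (P T2 - P T1)) = card (P T1 - P T2) + card (P T2 - P T1)"
    using fin by (intro card_Un_disjoint) auto
  ultimately have "card {j \<in> index ` (T1 - T2). j \<le> index e} = card (P T1 - P T2) + card (P T2 - P T1)"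
    by simp
  moreover have "pos T1 e + pos T2 e = card (P T1 - P T2) + card (P T2 - P T1) + 2 * card (P T1 \<inter> P T2)"
    using card[of T1 T2] card[of T2 T1] by (simp add: pos_def P_def Int_commute)
  ultimately show ?thesis by simp
qed

context tract
begin

definition wv :: "(elt set \<Rightarrow> 'g option) \<Rightarrow> elt set \<Rightarrow> elt \<Rightarrow> 'g option" where
  "wv \<phi> T = (\<lambda>e. if e \<in> T then Some (epow (pos T e)) \<odot> \<phi> (flip T e) else None)"

lemma wick_vector_id: "wick_vector F id \<phi> T = wv \<phi> T"
  by (simp add: wick_vector_def wv_def tsign_eq pos_def flip_def fun_eq_iff)

lemma epow_parity: "even j \<longleftrightarrow> even k \<Longrightarrow> epow j = epow k"
  by (simp add: epow_mod2)

lemma wv_vecs: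
  assumes "\<And>T. \<phi> T \<in> K" "T \<in> transversals n"
  shows "wv \<phi> T \<in> V n"
  using assms transversalD(1)[OF assms(2)] by (auto simp: vecs_iff wv_def supp_def)

lemma orth_wv:
  assumes \<phi>: "\<And>T. \<phi> T \<in> K" and T: "T1 \<in> transversals n" "T2 \<in> transversals n"
  shows "(let D = {i \<in> {1..n}. Plain i \<in> sym_diff T1 T2} in
        (\<Sum>x \<in> D. formal (tsign F (card {y \<in> D. y \<le> x}) \<odot>
            (\<phi> (sym_diff T1 {Plain x, Starred x}) \<odot> \<phi> (sym_diff T2 {Plain x, Starred x})))) \<in> nulls F) \<longleftrightarrow>
    orth n (wv \<phi> T1) (wv \<phi> T2)"
proof -
  define D where "D = {i \<in> {1..n}. Plain i \<in> sym_diff T1 T2}"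
  note bij = index_bij[OF T, folded D_def]
  have "orth n (wv \<phi> T1) (wv \<phi> T2) \<longleftrightarrow> (\<Sum>e \<in> T1 - T2. formal (wv \<phi> T1 e \<odot> wv \<phi> T2 (star e))) \<in> nulls F"
  proof (rule orth_restrict)
    show "T1 - T2 \<subseteq> ground n" using transversalD(1)[OF T(1)] by blast
    fix e assume "wv \<phi> T1 e \<noteq> None" "wv \<phi> T2 (star e) \<noteq> None"
    then have "e \<in> T1" "star e \<in> T2" by (auto simp: wv_def split: if_splits)
    then show "e \<in> T1 - T2" using transversal_star[OF T(2)] by auto
  qed
  also have "(\<Sum>e \<in> T1 - T2. formal (wv \<phi> T1 e \<odot> wv \<phi> T2 (star e))) =
      (\<Sum>e \<in> T1 - T2. formal (tsign F (card {y \<in> D. y \<le> index e}) \<odot>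
            (\<phi> (sym_diff T1 {Plain (index e), Starred (index e)}) \<odot> \<phi> (sym_diff T2 {Plain (index e), Starred (index e)}))))"
  proof (rule sum.cong[OF refl])
    fix e assume e: "e \<in> T1 - T2"
    then have "star e \<in> T2" using transversal_diff_star[OF T e] by blast
    then have "wv \<phi> T1 e \<odot> wv \<phi> T2 (star e) = Some (epow (pos T1 e + pos T2 e)) \<odot> (\<phi> (flip T1 e) \<odot> \<phi> (flip T2 e))"
      using e \<phi>[of "flip T1 e"] \<phi>[of "flip T2 e"] by (auto elim!: K_cases simp: wv_def epow_add m_ac)
    moreover have "epow (pos T1 e + pos T2 e) = epow (card {y \<in> D. y \<le> index e})"
      using pos_add_parity[OF T, of e] bij by (intro epow_parity) (simp add: bij_betw_def)
    ultimately show "formal (wv \<phi> T1 e \<odot> wv \<phi> T2 (star e)) = formal (tsign F (card {y \<in> D. y \<le> index e}) \<odot>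
            (\<phi> (sym_diff T1 {Plain (index e), Starred (index e)}) \<odot> \<phi> (sym_diff T2 {Plain (index e), Starred (index e)})))"
      by (simp add: tsign_eq flip_index)
  qed
  also have "\<dots> = (\<Sum>x \<in> D. formal (tsign F (card {y \<in> D. y \<le> x}) \<odot>
            (\<phi> (sym_diff T1 {Plain x, Starred x}) \<odot> \<phi> (sym_diff T2 {Plain x, Starred x}))))"
    by (rule sum.reindex_bij_betw[OF bij])
  finally show ?thesis by (simp add: D_def Let_def)
qed

lemma strong_wick_iff:
  "\<phi> \<in> strong_wick F n \<longleftrightarrow> (\<forall>T. \<phi> T \<in> K) \<and> (\<forall>T. T \<notin> transversals n \<longrightarrow> \<phi> T = None) \<and> (\<exists>T. \<phi> T \<noteq> None) \<and>
    (\<forall>T1 \<in> transversals n. \<forall>T2 \<in> transversals n. orth n (wv \<phi> T1) (wv \<phi> T2))"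
    (is "?L \<longleftrightarrow> ?R")
proof
  assume ?L
  note L = this[unfolded strong_wick_def mem_Collect_eq]
  note L1 = L[THEN conjunct1] L[THEN conjunct2, THEN conjunct1] L[THEN conjunct2, THEN conjunct2, THEN conjunct1]
  have K: "\<phi> T \<in> K" for T
    using L1(1,2) by (cases "T \<in> transversals n") simp_all
  have "orth n (wv \<phi> T1) (wv \<phi> T2)" if T: "T1 \<in> transversals n" "T2 \<in> transversals n" for T1 T2
    using L[THEN conjunct2, THEN conjunct2, THEN conjunct2, rule_format, OF T]
    by (rule orth_wv[of \<phi>, OF K T, THEN iffD1])
  moreover have "\<exists>T. \<phi> T \<noteq> None" using L1(3) by blast
  ultimately show ?R
    using L1(2) K by simp
next
  assume R: ?R
  note K = R[THEN conjunct1, rule_format]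
  note R' = R[THEN conjunct2, THEN conjunct1] R[THEN conjunct2, THEN conjunct2, THEN conjunct1]
    R[THEN conjunct2, THEN conjunct2, THEN conjunct2, rule_format]
  show ?L
    unfolding strong_wick_def
  proof (intro CollectI conjI ballI)
    show "\<forall>T. T \<notin> transversals n \<longrightarrow> \<phi> T = None" "\<exists>T \<in> transversals n. \<phi> T \<noteq> None"
      using R'(1,2) by metis+
    fix T1 T2 assume T: "T1 \<in> transversals n" "T2 \<in> transversals n"
    show "let D = {i \<in> {1..n}. Plain i \<in> sym_diff T1 T2} in
        (\<Sum>x \<in> D. formal (tsign F (card {y \<in> D. y \<le> x}) \<odot>
            (\<phi> (sym_diff T1 {Plain x, Starred x}) \<odot> \<phi> (sym_diff T2 {Plain x, Starred x})))) \<in> nulls F"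
      by (rule orth_wv[of \<phi>, OF K T, THEN iffD2, OF R'(3)[OF T]])
  qed (rule K)
qed

lemma wv_scale:
  assumes "\<And>T. \<phi> T \<in> K" "c \<in> carrier F"
  shows "wv (\<lambda>T. Some c \<odot> \<phi> T) T = scale (Some c) (wv \<phi> T)"
proof
  fix e
  show "wv (\<lambda>T. Some c \<odot> \<phi> T) T e = scale (Some c) (wv \<phi> T) e"
    using assms(1)[of "flip T e"] assms(2) by (auto simp: wv_def scale_def tm_ac)
qed

lemma strong_wick_scale:
  assumes \<phi>: "\<phi> \<in> strong_wick F n" and c: "c \<in> carrier F"
  shows "(\<lambda>T. Some c \<odot> \<phi> T) \<in> strong_wick F n"
proof -
  have K: "\<And>T. \<phi> T \<in> K" using \<phi> by (simp add: strong_wick_iff)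
  show ?thesis
    using \<phi> c wv_vecs[of \<phi>, OF K] by (simp add: strong_wick_iff wv_scale[of \<phi>, OF K c] orth_scale)
qed

definition wick_class :: "(elt set \<Rightarrow> 'g option) \<Rightarrow> (elt set \<Rightarrow> 'g option) set" where
  "wick_class \<phi> = {\<lambda>T. Some c \<odot> \<phi> T | c. c \<in> carrier F}"

lemma strong_orthogonal_matroids_eq:
  "strong_orthogonal_matroids F n = wick_class ` strong_wick F n"
proof -
  have "wick_equiv F n `` {\<phi>} = wick_class \<phi>" if "\<phi> \<in> strong_wick F n" for \<phi>
    using that strong_wick_scale[OF that] by (auto simp: wick_equiv_def wick_class_def)
  then show ?thesis
    by (auto simp: strong_orthogonal_matroids_def quotient_def)
qed

lemma wick_class_scale:
  assumes K: "\<And>T. \<phi> T \<in> K" and c: "c \<in> carrier F"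
  shows "wick_class (\<lambda>T. Some c \<odot> \<phi> T) = wick_class \<phi>"
proof (intro subset_antisym subsetI)
  fix \<psi> assume "\<psi> \<in> wick_class (\<lambda>T. Some c \<odot> \<phi> T)"
  then obtain d where d: "d \<in> carrier F" "\<psi> = (\<lambda>T. Some d \<odot> (Some c \<odot> \<phi> T))"
    by (auto simp: wick_class_def)
  then have "\<psi> = (\<lambda>T. Some (d \<otimes> c) \<odot> \<phi> T)"
    using c K tm_assoc[of "Some d" "Some c"] by (simp add: fun_eq_iff)
  then show "\<psi> \<in> wick_class \<phi>" using d c by (auto simp: wick_class_def)
next
  fix \<psi> assume "\<psi> \<in> wick_class \<phi>"
  then obtain d where d: "d \<in> carrier F" "\<psi> = (\<lambda>T. Some d \<odot> \<phi> T)"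
    by (auto simp: wick_class_def)
  then have "\<psi> = (\<lambda>T. Some (d \<otimes> inv c) \<odot> (Some c \<odot> \<phi> T))"
    using c K tm_assoc[of "Some (d \<otimes> inv c)" "Some c"] by (simp add: fun_eq_iff m_assoc)
  then show "\<psi> \<in> wick_class (\<lambda>T. Some c \<odot> \<phi> T)" using d c by (auto simp: wick_class_def)
qed

end

section \<open>The matroid and the signature of a Wick function\<close>

locale wick = tract F for F :: "('g, 'b) tract_scheme" (structure) +
  fixes n :: nat and \<phi> :: "elt set \<Rightarrow> 'g option"
  assumes wick: "\<phi> \<in> strong_wick F n"
begin

definition bases :: "elt set set" where "bases = {T. \<phi> T \<noteq> None}"

definition vectors :: "(elt \<Rightarrow> 'g option) set" where
  "vectors = {scale (Some c) (wv \<phi> T) | c T. c \<in> carrier F \<and> T \<in> transversals n} - {zero_vec}"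

lemma phi_K [simp]: "\<phi> T \<in> K"
  using wick by (simp add: strong_wick_iff)

lemma bases_transversal: "B \<in> bases \<Longrightarrow> B \<in> transversals n"
  using wick by (auto simp: strong_wick_iff bases_def)

lemma wv_V [simp]: "T \<in> transversals n \<Longrightarrow> wv \<phi> T \<in> V n"
  by (rule wv_vecs[of \<phi>, OF phi_K])

lemma wv_orth: "T1 \<in> transversals n \<Longrightarrow> T2 \<in> transversals n \<Longrightarrow> orth n (wv \<phi> T1) (wv \<phi> T2)"
  using wick by (simp add: strong_wick_iff)

lemma wv_nonzero: "wv \<phi> T e \<noteq> None \<longleftrightarrow> e \<in> T \<and> flip T e \<in> bases"
  by (simp add: wv_def bases_def)

text \<open>Toggling \<open>e\<close> in both bases gives transversals whose pairing has, at
  \<open>star e\<close>, the nonzero term built from \<open>\<phi> B1\<close> and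
  \<open>\<phi> B2\<close>. It cannot stand alone, and any other nonzero term exhibits an exchanged
  basis.\<close>

lemma orthogonal_matroid_bases: "orthogonal_matroid n bases"
  unfolding orthogonal_matroid_def
proof (intro conjI ballI allI impI)
  show "bases \<noteq> {}" using wick by (auto simp: strong_wick_iff bases_def)
  show "bases \<subseteq> transversals n" using bases_transversal by blast
  fix B1 B2 x assume B: "B1 \<in> bases" "B2 \<in> bases" and x: "{x, star x} \<subseteq> sym_diff B1 B2"
  note tr = bases_transversal[OF B(1)] bases_transversal[OF B(2)]
  obtain e where e: "e = x \<or> e = star x" "e \<in> B1 - B2"
  proof (cases "x \<in> B1")
    case True
    then show thesis using that[of x] x by auto
  next
    case False
    then have "star x \<in> B1 - B2" using x transversal_diff_star[OF tr(2,1), of x] by auto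
    then show thesis using that[of "star x"] by auto
  qed
  have eg: "e \<in> ground n" "star e \<notin> B1" "star e \<in> B2"
    using e(2) in_transversal_ground[OF tr(1)] transversal_star[OF tr(1)] transversal_diff_star[OF tr e(2)] by auto
  let ?T1 = "flip B1 e" and ?T2 = "flip B2 e"
  have T: "?T1 \<in> transversals n" "?T2 \<in> transversals n"
    using flip_transversal tr eg by blast+
  have nz: "wv \<phi> ?T1 (star e) \<noteq> None" "wv \<phi> ?T2 (star (star e)) \<noteq> None"
    using e(2) eg B by (simp_all add: wv_nonzero in_flip_iff)
  have "\<exists>f \<in> ground n. wv \<phi> ?T1 f \<noteq> None \<and> wv \<phi> ?T2 (star f) \<noteq> None \<and> f \<noteq> star e"
  proof (rule ccontr)
    assume no: "\<not> (\<exists>f \<in> ground n. wv \<phi> ?T1 f \<noteq> None \<and> wv \<phi> ?T2 (star f) \<noteq> None \<and> f \<noteq> star e)"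
    have only: "x = star e" if "x \<in> ground n" "wv \<phi> ?T1 x \<noteq> None" "wv \<phi> ?T2 (star x) \<noteq> None" for x
      using no that by blast
    have "star e \<in> ground n" using eg(1) by simp
    from orth_single[OF wv_V[OF T(1)] wv_V[OF T(2)] this] only wv_orth[OF T]
    have "wv \<phi> ?T1 (star e) = None \<or> wv \<phi> ?T2 (star (star e)) = None"
      by metis
    then show False using nz by blast
  qed
  then obtain f where f: "f \<in> ?T1" "flip ?T1 f \<in> bases" "star f \<in> ?T2" "f \<noteq> star e"
    unfolding wv_nonzero by blast
  have "e \<notin> ?T1" using e(2) by (simp add: in_flip_iff)
  then have fe: "f \<noteq> e" using f(1) by blast
  have "star f \<noteq> e" "star f \<noteq> star e" using f(4) fe by auto
  then have fB: "f \<in> B1" "star f \<in> B2"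
    using f fe by (simp_all add: in_flip_iff)
  then have "{f, star f} \<subseteq> sym_diff B1 B2"
    using transversal_star[OF tr(1), of f] transversal_star[OF tr(2), of "star f"] by auto
  moreover have "{f, star f} \<noteq> {x, star x}"
    using f(4) fe e(1) by (auto simp: doubleton_eq_iff)
  moreover have "sym_diff B1 {x, star x, f, star f} = flip (flip B1 e) f"
  proof -
    have "f \<noteq> x" "f \<noteq> star x" "flip B1 e = flip B1 x" using f(4) fe e(1) by auto
    then show ?thesis using sym_diff_eq_flip2[of f x B1] by simp
  qed
  ultimately show "\<exists>x2. {x2, star x2} \<subseteq> sym_diff B1 B2 \<and> {x2, star x2} \<noteq> {x, star x} \<and>
      sym_diff B1 {x, star x, x2, star x2} \<in> bases"
    using f(2) by (intro exI[of _ f]) simp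
qed

sublocale orth_matroid n bases
  by unfold_locales (rule orthogonal_matroid_bases)

lemma supp_wv: "supp (wv \<phi> T) = circ T"
  unfolding supp_def circ_def by (simp add: wv_nonzero)

lemma vectors_iff: "X \<in> vectors \<longleftrightarrow> (\<exists>c T. c \<in> carrier F \<and> T \<in> transversals n \<and> circ T \<noteq> {} \<and> X = scale (Some c) (wv \<phi> T))"
proof -
  have "scale (Some c) (wv \<phi> T) = zero_vec \<longleftrightarrow> circ T = {}" for c T
    by (simp add: zero_vec_iff supp_wv)
  then show ?thesis unfolding vectors_def Diff_iff mem_Collect_eq singleton_iff by metis
qed

lemma signature_of_matroid_class: "signature_of_matroid F id n (wick_class \<phi>) = vectors"
proof -
  have "{wv \<psi> T | \<psi> T. \<psi> \<in> wick_class \<phi> \<and> T \<in> transversals n} =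
      (\<lambda>(c, T). wv (\<lambda>S. Some c \<odot> \<phi> S) T) ` (carrier F \<times> transversals n)"
    unfolding wick_class_def by auto
  also have "\<dots> = (\<lambda>(c, T). scale (Some c) (wv \<phi> T)) ` (carrier F \<times> transversals n)"
    using wv_scale[of \<phi>, OF phi_K] by (intro image_cong) auto
  also have "\<dots> = {scale (Some c) (wv \<phi> T) | c T. c \<in> carrier F \<and> T \<in> transversals n}"
    by auto
  finally show ?thesis
    by (simp add: signature_of_matroid_def vectors_def wick_vector_id)
qed

sublocale strong_signature F n bases vectors
proof
  show "signature F id n bases vectors"
    unfolding signature_def
  proof (intro conjI ballI)
    show "vectors \<subseteq> V n" by (auto simp: vectors_iff)
    show "supp ` vectors = circuits n bases"
    proof (intro subset_antisym subsetI)
      fix C assume "C \<in> supp ` vectors"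
      then obtain X where X: "X \<in> vectors" "C = supp X" by blast
      then obtain c T where "c \<in> carrier F" "T \<in> transversals n" "circ T \<noteq> {}" "X = scale (Some c) (wv \<phi> T)"
        unfolding vectors_iff by blast
      then show "C \<in> circuits n bases"
        using circ_circuit[of T] X(2) by (simp add: supp_wv)
    next
      fix C assume C: "C \<in> circuits n bases"
      then obtain e where e: "e \<in> C" using circuit_nonempty by blast
      obtain B where B: "B \<in> bases" "e \<in> star ` B" "C = circ (flip B e)"
        using circuit_fundamental[OF C e] .
      have "scale (Some \<one>) (wv \<phi> (flip B e)) \<in> vectors"
        using fundamental_circ[OF B(1,2)] unfolding vectors_iff by blast
      moreover have "supp (scale (Some \<one>) (wv \<phi> (flip B e))) = C"
        using B(3) by (simp add: supp_wv)
      ultimately show "C \<in> supp ` vectors" by blast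
    qed
    fix X \<alpha> assume "X \<in> vectors" and \<alpha>: "\<alpha> \<in> carrier F"
    then obtain c T where X: "c \<in> carrier F" "T \<in> transversals n" "circ T \<noteq> {}" "X = scale (Some c) (wv \<phi> T)"
      unfolding vectors_iff by blast
    have "smult F id (Some \<alpha>) X = scale (Some (\<alpha> \<otimes> c)) (wv \<phi> T)"
      using X(1,4) \<alpha> vecs_K[OF wv_V[OF X(2)]] tm_assoc[of "Some \<alpha>" "Some c"]
      by (simp add: smult_id scale_def fun_eq_iff)
    then show "smult F id (Some \<alpha>) X \<in> vectors"
      using X \<alpha> unfolding vectors_iff by blast
  qed
  have *: "orth n X Y" if "X \<in> vectors" "Y \<in> vectors" for X Y
    using that wv_orth unfolding vectors_iff by (auto simp: orth_scale)
  then show "orth n X Y" if "X \<in> vectors" "Y \<in> vectors" "card (supp X \<inter> star ` supp Y) = 2" for X Y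
    using that by blast
  show "orth n X Y" if "X \<in> vectors" "Y \<in> vectors" for X Y
    using * that by blast
qed

end


section \<open>Reconstructing a Wick function from its signature\<close>

context orth_matroid
begin

text \<open>The basis graph is connected: exchange towards \<open>B0\<close> strictly decreases
  \<open>card (B - B0)\<close>.\<close>

lemma adj_invariant:
  assumes "B \<in> \<B>" and B0: "B0 \<in> \<B>" and q: "\<And>B B'. adj B B' \<Longrightarrow> q B = q B'"
  shows "q B = q B0"
  using assms(1)
proof (induction "card (B - B0)" arbitrary: B rule: less_induct)
  case less
  note tr = basis_transversal[OF less.prems]
  show ?case
  proof (cases "B \<subseteq> B0")
    case True
    then show ?thesis using transversal_eqI[OF tr basis_transversal[OF B0]] by simp
  next
    case False
    then obtain e where e: "e \<in> B - B0" by blast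
    then obtain f where f: "f \<in> B - B0" "f \<noteq> e" "flip (flip B e) f \<in> \<B>"
      using exchange[OF less.prems B0] by blast
    let ?B = "flip (flip B e) f"
    have "star e \<in> B0" "star f \<in> B0"
      using transversal_diff_star[OF tr basis_transversal[OF B0]] e f by blast+
    then have "?B - B0 \<subseteq> B - B0 - {e}"
      using e f by (auto simp: in_flip_iff split: if_splits)
    then have "card (?B - B0) < card (B - B0)"
      using e finite_transversal[OF tr] by (intro psubset_card_mono) auto
    then have "q ?B = q B0" using less.hyps f(3) by blast
    moreover have "q B = q ?B"
      using q adj_flip2(5)[OF less.prems] e f by blast
    ultimately show ?thesis by simp
  qed
qed

end

lemma diff_flip:
  assumes "T1 \<in> transversals n" "c \<in> T1" "c \<in> T2"
  shows "T1 - flip T2 c = insert c (T1 - T2)"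
  using assms transversal_star[OF assms(1,2)] by (auto simp: in_flip_iff split: if_splits)

text \<open>The four ranks are 1, 2, 3, 4 in some order, with even sum. This makes the signs on the
  two ways around a square agree.\<close>

lemma rank_sum_parity:
  fixes p q r s :: nat
  assumes "distinct [p, q, r, s]"
  defines "rk \<equiv> \<lambda>x. card {j \<in> {p, q, r, s}. j \<le> x}"
  shows "even (rk p + rk q) \<longleftrightarrow> even (rk r + rk s)"
proof -
  have rk: "rk x = of_bool (p \<le> x) + of_bool (q \<le> x) + of_bool (r \<le> x) + of_bool (s \<le> x)" for x
  proof -
    have "rk x = (\<Sum>j \<in> {p, q, r, s}. of_bool (j \<le> x))"
      unfolding rk_def by (simp add: sum_of_bool_eq Int_def del: sum.insert)
    then show ?thesis using assms(1) by simp
  qed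
  have pair: "(of_bool (x \<le> y) :: nat) + of_bool (y \<le> x) = 1" if "x \<noteq> y" for x y :: nat
    using that by auto
  have ne: "p \<noteq> q" "p \<noteq> r" "p \<noteq> s" "q \<noteq> r" "q \<noteq> s" "r \<noteq> s"
    using assms(1) by auto
  \<comment> \<open>Four comparisons of an element with itself, and one for each of the six
    pairs.\<close>
  have "rk p + rk q + rk r + rk s = 10"
    using pair[of p q] pair[of p r] pair[of p s] pair[of q r] pair[of q s] pair[of r s] ne
    unfolding rk by simp
  then show ?thesis by presburger
qed

context tract
begin

text \<open>The Wick vectors of \<open>\<phi>\<close> and \<open>\<psi>\<close> on the same
  transversal are proportional, so the quotient of the two functions agrees on adjacent bases and is
  constant by connectedness.\<close>

lemma signature_injective:
  assumes \<phi>: "\<phi> \<in> strong_wick F n" and \<psi>: "\<psi> \<in> strong_wick F n"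
    and eq: "signature_of_matroid F id n (wick_class \<phi>) = signature_of_matroid F id n (wick_class \<psi>)"
  shows "wick_class \<phi> = wick_class \<psi>"
proof -
  interpret P: wick F n \<phi> by unfold_locales (rule \<phi>)
  interpret Q: wick F n \<psi> by unfold_locales (rule \<psi>)
  have vec: "P.vectors = Q.vectors"
    using eq by (simp add: P.signature_of_matroid_class Q.signature_of_matroid_class)
  have bas: "P.bases = Q.bases"
    using P.support_basis_C Q.support_basis_C vec by auto
  define q where "q B = \<psi> B \<odot> ti (\<phi> B)" for B
  have proportion: "\<exists>a \<in> carrier F. \<forall>e \<in> P.circ T. q (flip T e) = Some a" if T: "T \<in> transversals n" "P.circ T \<noteq> {}" for T
  proof -
    have circ: "Q.circ T = P.circ T" by (simp add: P.circ_def Q.circ_def bas)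
    have "scale (Some \<one>) (wv \<phi> T) \<in> P.vectors"
      unfolding P.vectors_iff using T by blast
    moreover have "scale (Some \<one>) (wv \<phi> T) = wv \<phi> T"
      using vecs_K[OF P.wv_V[OF T(1)]] by (simp add: scale_def)
    ultimately have P: "wv \<phi> T \<in> P.vectors" by simp
    have "wv \<psi> T \<in> P.perp"
    proof -
      have "scale (Some \<one>) (wv \<psi> T) \<in> Q.vectors"
        unfolding Q.vectors_iff using T circ by blast
      moreover have "scale (Some \<one>) (wv \<psi> T) = wv \<psi> T"
        using vecs_K[OF Q.wv_V[OF T(1)]] by (simp add: scale_def)
      ultimately show ?thesis using vec P.C_perp by simp
    qed
    then have Q: "wv \<psi> T \<in> V n" "\<And>Z. Z \<in> P.vectors \<Longrightarrow> orth n (wv \<psi> T) Z"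
      by (simp_all add: P.perp_def)
    obtain a where a: "a \<in> carrier F" "wv \<psi> T = scale (Some a) (wv \<phi> T)"
      using P.proportional[OF Q(1) Q(2) P] circ by (metis P.supp_wv Q.supp_wv)
    have "q (flip T e) = Some a" if e: "e \<in> P.circ T" for e
    proof -
      have "e \<in> T" "flip T e \<in> P.bases" using e by (simp_all add: P.circ_def)
      then have eT: "e \<in> T" "\<phi> (flip T e) \<noteq> None" by (simp_all add: P.bases_def)
      have "Some (epow (pos T e)) \<odot> \<psi> (flip T e) = Some a \<odot> (Some (epow (pos T e)) \<odot> \<phi> (flip T e))"
        using fun_cong[OF a(2), of e] eT by (simp add: wv_def scale_def)
      also have "\<dots> = Some (epow (pos T e)) \<odot> (Some a \<odot> \<phi> (flip T e))"
        using a(1) by (simp add: tm_ac)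
      finally have "\<psi> (flip T e) = Some a \<odot> \<phi> (flip T e)"
        using a(1) tm_left_cancel[of "Some (epow (pos T e))" "\<psi> (flip T e)" "Some a \<odot> \<phi> (flip T e)"] by simp
      then show ?thesis using eT a(1) by (simp add: q_def tm_assoc tm_ti)
    qed
    then show ?thesis using a(1) by blast
  qed
  have q_adj: "q B = q B'" if a: "P.adj B B'" for B B'
  proof -
    obtain T e f where T: "T \<in> transversals n" "e \<in> P.circ T" "f \<in> P.circ T" "B = flip T e" "B' = flip T f"
      using a unfolding P.adj_def by blast
    then show ?thesis using proportion[of T] by fastforce
  qed
  obtain B0 where B0: "B0 \<in> P.bases" using P.bases_nonempty by blast
  then have "\<psi> B0 \<noteq> None" using bas by (auto simp: Q.bases_def)
  then have q0: "q B0 \<in> K" "q B0 \<noteq> None" using B0 by (auto simp: q_def P.bases_def)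
  then obtain c where c: "c \<in> carrier F" "q B0 = Some c" by (auto elim!: K_cases)
  have "\<psi> B = Some c \<odot> \<phi> B" for B
  proof (cases "B \<in> P.bases")
    case True
    then have "\<psi> B \<odot> ti (\<phi> B) = Some c"
      using P.adj_invariant[OF True B0, of q] q_adj c(2) by (simp add: q_def)
    then have "Some c \<odot> \<phi> B = \<psi> B \<odot> ti (\<phi> B) \<odot> \<phi> B" by simp
    then show ?thesis using True by (simp add: tm_assoc tm_ti P.bases_def)
  next
    case False
    moreover from this have "B \<notin> Q.bases" using bas by simp
    ultimately show ?thesis by (simp add: P.bases_def Q.bases_def)
  qed
  then have "\<psi> = (\<lambda>T. Some c \<odot> \<phi> T)" by blast
  then show ?thesis using wick_class_scale[of \<phi>, OF P.phi_K c(1)] by simp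
qed

end

section \<open>Ratios along the edges of the basis graph\<close>

context strong_signature
begin

text \<open>The representative is arbitrary; only quantities unchanged by rescaling it enter the
  cocycle.\<close>

definition circuit_vector :: "elt set \<Rightarrow> elt \<Rightarrow> 'a option" where
  "circuit_vector T = (SOME X. X \<in> \<C> \<and> supp X = circ T)"

lemma circuit_vector:
  assumes "T \<in> transversals n" "circ T \<noteq> {}"
  shows "circuit_vector T \<in> \<C>" "supp (circuit_vector T) = circ T"
proof -
  have "\<exists>X. X \<in> \<C> \<and> supp X = circ T"
    using circuit_C[OF circ_circuit[OF assms]] by blast
  then have "circuit_vector T \<in> \<C> \<and> supp (circuit_vector T) = circ T"
    unfolding circuit_vector_def by (rule someI_ex)
  then show "circuit_vector T \<in> \<C>" "supp (circuit_vector T) = circ T" by blast+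
qed

text \<open>Up to a factor depending on \<open>T\<close> alone, the value sought for
  \<open>\<phi>\<close> at \<open>flip T e\<close>: the sign in a Wick vector is its own inverse and
  is removed here.\<close>

definition entry :: "elt set \<Rightarrow> elt \<Rightarrow> 'a" where
  "entry T e = epow (pos T e) \<otimes> the (circuit_vector T e)"

lemma entry_closed:
  assumes "T \<in> transversals n" "e \<in> circ T"
  shows "entry T e \<in> carrier F" "circuit_vector T e = Some (epow (pos T e) \<otimes> entry T e)"
proof -
  have X: "circuit_vector T \<in> \<C>" "supp (circuit_vector T) = circ T" using circuit_vector[of T] assms by auto
  then have "circuit_vector T e \<in> K" "circuit_vector T e \<noteq> None"
    using vecs_K[OF C_vecs[OF X(1)]] assms(2) by (simp_all add: in_supp_iff[symmetric])
  then obtain x where x: "x \<in> carrier F" "circuit_vector T e = Some x" by (auto elim!: K_cases)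
  then show "entry T e \<in> carrier F" "circuit_vector T e = Some (epow (pos T e) \<otimes> entry T e)"
    by (simp_all add: entry_def m_assoc[symmetric])
qed

definition rk :: "elt set \<Rightarrow> elt \<Rightarrow> nat" where
  "rk D x = card {j \<in> index ` D. j \<le> index x}"

text \<open>The term at \<open>e\<close> is nonzero and cannot be null alone, so the term at
  \<open>f\<close> is present and equals minus the first. Collecting the signs of both transversals
  leaves the two ranks and one further factor \<open>eps\<close>.\<close>

lemma entry_pair:
  assumes T: "T1 \<in> transversals n" "T2 \<in> transversals n"
    and e: "e \<in> circ T1" "star e \<in> circ T2" and f: "f \<in> ground n" "e \<noteq> f"
    and only: "\<And>x. x \<in> circ T1 \<Longrightarrow> star x \<in> circ T2 \<Longrightarrow> x = e \<or> x = f"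
  shows "f \<in> circ T1" "star f \<in> circ T2"
    "entry T1 f \<otimes> entry T2 (star f) = epow (Suc (rk (T1 - T2) e + rk (T1 - T2) f)) \<otimes> (entry T1 e \<otimes> entry T2 (star e))"
proof -
  have ne: "circ T1 \<noteq> {}" "circ T2 \<noteq> {}" using e by blast+
  note X = circuit_vector[OF T(1) ne(1)] and Z = circuit_vector[OF T(2) ne(2)]
  have nz: "circuit_vector T1 x \<noteq> None \<longleftrightarrow> x \<in> circ T1" "circuit_vector T2 x \<noteq> None \<longleftrightarrow> x \<in> circ T2" for x
    using X Z by (simp_all add: in_supp_iff[symmetric])
  have eg: "e \<in> ground n" using e circ_subset[of T1] in_transversal_ground[OF T(1)] by blast
  have o: "orth n (circuit_vector T1) (circuit_vector T2)" using strong X(1) Z(1) .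
  show f12: "f \<in> circ T1" "star f \<in> circ T2"
  proof -
    have "f \<in> circ T1 \<and> star f \<in> circ T2"
    proof (rule ccontr)
      assume no: "\<not> (f \<in> circ T1 \<and> star f \<in> circ T2)"
      have "x = e" if "x \<in> ground n" "circuit_vector T1 x \<noteq> None" "circuit_vector T2 (star x) \<noteq> None" for x
        using only[of x] that no nz by blast
      from orth_single[OF C_vecs[OF X(1)] C_vecs[OF Z(1)] eg this] o
      have "circuit_vector T1 e = None \<or> circuit_vector T2 (star e) = None" by metis
      then show False using e nz by blast
    qed
    then show "f \<in> circ T1" "star f \<in> circ T2" by blast+
  qed
  have only': "x = e \<or> x = f" if "x \<in> ground n" "circuit_vector T1 x \<noteq> None" "circuit_vector T2 (star x) \<noteq> None" for x
    using only[of x] that nz by blast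
  from orth_pair[OF C_vecs[OF X(1)] C_vecs[OF Z(1)] eg f] only' o
  have rel: "circuit_vector T1 f \<odot> circuit_vector T2 (star f) = tn (circuit_vector T1 e \<odot> circuit_vector T2 (star e))" by metis
  have prd: "circuit_vector T1 x \<odot> circuit_vector T2 (star x) = Some (epow (rk (T1 - T2) x) \<otimes> (entry T1 x \<otimes> entry T2 (star x)))"
    if x: "x \<in> circ T1" "star x \<in> circ T2" for x
  proof -
    note entry = entry_closed[OF T(1) x(1)] entry_closed[OF T(2) x(2)]
    have "circuit_vector T1 x \<odot> circuit_vector T2 (star x) = Some (epow (pos T1 x + pos T2 x) \<otimes> (entry T1 x \<otimes> entry T2 (star x)))"
      using entry by (simp add: epow_add m_ac)
    also have "epow (pos T1 x + pos T2 x) = epow (rk (T1 - T2) x)"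
      using pos_add_parity[OF T, of x] by (intro epow_parity) (simp add: rk_def)
    finally show ?thesis .
  qed
  note yf = entry_closed[OF T(1) f12(1)] entry_closed[OF T(2) f12(2)]
  note ye = entry_closed[OF T(1) e(1)] entry_closed[OF T(2) e(2)]
  have eq: "epow (rk (T1 - T2) f) \<otimes> (entry T1 f \<otimes> entry T2 (star f)) = eps \<otimes> (epow (rk (T1 - T2) e) \<otimes> (entry T1 e \<otimes> entry T2 (star e)))"
    using rel unfolding prd[OF e] prd[OF f12] by (simp add: tneg_def)
  have "entry T1 f \<otimes> entry T2 (star f) = epow (rk (T1 - T2) f) \<otimes> (epow (rk (T1 - T2) f) \<otimes> (entry T1 f \<otimes> entry T2 (star f)))"
    using yf by (simp add: m_assoc[symmetric])
  also have "\<dots> = epow (Suc (rk (T1 - T2) e + rk (T1 - T2) f)) \<otimes> (entry T1 e \<otimes> entry T2 (star e))"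
    unfolding eq using ye by (simp add: epow_Suc epow_add m_ac)
  finally show "entry T1 f \<otimes> entry T2 (star f) = epow (Suc (rk (T1 - T2) e + rk (T1 - T2) f)) \<otimes> (entry T1 e \<otimes> entry T2 (star e))" .
qed

text \<open>The two transversals differ in the pairs of \<open>e\<close> and \<open>f\<close>, with
  ranks 1 and 2 in some order, so the exponent 1 + 1 + 2 is even. Both transversals next to an edge
  therefore give the same ratio along it.\<close>

lemma entry_edge:
  assumes T: "T \<in> transversals n" and ef: "e \<in> circ T" "f \<in> circ T" "e \<noteq> f"
  shows "entry T f \<otimes> entry (flip (flip T e) f) (star f) = entry T e \<otimes> entry (flip (flip T e) f) (star e)"
proof -
  let ?S = "flip (flip T e) f"
  note S = circ_flip2[OF T ef]
  have eT: "e \<in> T" "f \<in> T" "f \<in> ground n" "star e \<notin> T"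
    using ef circ_subset[of T] in_transversal_ground[OF T] transversal_star[OF T] by auto
  have fe: "f \<in> flip T e" using eT ef(3) by (auto simp: in_flip_iff)
  have "T - ?S = {f, e}"
    using diff_flip[OF T eT(2) fe] diff_flip[OF T eT(1) eT(1)] by simp
  moreover have "index e \<noteq> index f" using eT ef(3) by (auto simp: index_eq_iff)
  ultimately have "{j \<in> index ` (T - ?S). j \<le> index e} = (if index f < index e then {index e, index f} else {index e})"
      "{j \<in> index ` (T - ?S). j \<le> index f} = (if index f < index e then {index f} else {index e, index f})"
    by auto
  then have "even (Suc (rk (T - ?S) e + rk (T - ?S) f))"
    using \<open>index e \<noteq> index f\<close> by (simp add: rk_def)
  then have "epow (Suc (rk (T - ?S) e + rk (T - ?S) f)) = \<one>"
    by (simp only: epow_mod2 if_True)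
  moreover have "x = e \<or> x = f" if "x \<in> circ T" "star x \<in> circ ?S" for x
    using star_in_flip2[OF T eT(1,2)] that circ_subset by blast
  ultimately show ?thesis
    using entry_pair(3)[OF T S(1) ef(1) S(2) eT(3) ef(3)] entry_closed[OF T ef(1)] entry_closed[OF S(1,2)] by simp
qed

text \<open>Two transversals lie between adjacent bases. The choice operators pick one of them, and
  \<open>entry_edge\<close> makes the ratio independent of the pick.\<close>

definition \<gamma> :: "elt set \<Rightarrow> elt set \<Rightarrow> 'a" where
  "\<gamma> B B' = (let e = SOME e. e \<in> B - B'; f = SOME f. f \<in> B - B' \<and> f \<noteq> e; T = flip B e
     in entry T f \<otimes> inv (entry T (star e)))"

lemma gamma_eq:
  assumes T: "T \<in> transversals n" and ef: "e \<in> circ T" "f \<in> circ T" "e \<noteq> f"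
  shows "\<gamma> (flip T e) (flip T f) = entry T f \<otimes> inv (entry T e)"
proof -
  let ?B = "flip T e" and ?B' = "flip T f"
  let ?S = "flip (flip T e) f"
  note S = circ_flip2[OF T ef]
  have eT: "e \<in> T" "f \<in> T" "star e \<notin> T" "star f \<notin> T"
    using ef circ_subset[of T] transversal_star[OF T] by auto
  have ne: "star e \<noteq> f" using eT by auto
  have BT: "?B \<in> transversals n" "star e \<in> ?B" "f \<in> ?B"
    using flip_transversal[OF T] in_transversal_ground[OF T eT(1)] eT ef(3) ne by (auto simp: in_flip_iff)
  have "?B' = flip (flip ?B (star e)) f" by (simp add: flip_commute)
  moreover have "f \<in> flip ?B (star e)" using eT by simp
  ultimately have D: "?B - ?B' = {f, star e}"
    using diff_flip[OF BT(1,3), of "flip ?B (star e)"] diff_flip[OF BT(1,2,2)] by simp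
  define e' where "e' = (SOME x. x \<in> ?B - ?B')"
  define f' where "f' = (SOME x. x \<in> ?B - ?B' \<and> x \<noteq> e')"
  have gam: "\<gamma> ?B ?B' = entry (flip ?B e') f' \<otimes> inv (entry (flip ?B e') (star e'))"
    unfolding \<gamma>_def Let_def e'_def f'_def by simp
  have "e' \<in> ?B - ?B'"
    unfolding e'_def by (rule someI[of _ f]) (simp add: D)
  \<comment> \<open>The first choice leads back to \<open>T\<close>, the second to the opposite
    transversal \<open>?S\<close>.\<close>
  then consider "e' = star e" | "e' = f" using D by blast
  then show ?thesis
  proof cases
    case 1
    then have "f' = f"
      unfolding f'_def using ne by (intro some_equality) (auto simp: D)
    then show ?thesis using gam 1 by simp
  next
    case 2
    then have "f' = star e"
      unfolding f'_def using ne by (intro some_equality) (auto simp: D)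
    then have g: "\<gamma> ?B ?B' = entry ?S (star e) \<otimes> inv (entry ?S (star f))" using gam 2 by simp
    note cl = entry_closed(1)[OF T ef(1)] entry_closed(1)[OF T ef(2)] entry_closed(1)[OF S(1,2)] entry_closed(1)[OF S(1,3)]
    have "entry ?S (star e) = entry T f \<otimes> entry ?S (star f) \<otimes> inv (entry T e)"
      using entry_edge[OF T ef] cl by (metis inv_closed inv_solve_right m_closed m_comm)
    then show ?thesis
      unfolding g using cl by (simp add: m_ac)
  qed
qed

text \<open>A four-term Wick relation with corners \<open>B\<close> and the basis obtained by
  toggling all of \<open>a\<close>, \<open>b\<close>, \<open>c\<close>, \<open>d\<close>. The
  missing bases remove its terms at \<open>c\<close> and \<open>d\<close>; the two left over force
  the far corner to be a basis and make parallel edges agree up to sign.\<close>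

lemma half_square:
  assumes B: "B \<in> \<B>" and abcd: "{a, b, c, d} \<subseteq> B" "distinct [a, b, c, d]"
    and ab: "flip (flip B a) b \<in> \<B>" and cd: "flip (flip B c) d \<in> \<B>"
    and no: "flip (flip B a) c \<notin> \<B>" "flip (flip B a) d \<notin> \<B>"
  shows "flip (flip (flip (flip B a) b) c) d \<in> \<B>"
    "\<gamma> (flip (flip B c) d) (flip (flip (flip (flip B a) b) c) d) =
       epow (Suc (rk {a, b, c, d} a + rk {a, b, c, d} b)) \<otimes> \<gamma> B (flip (flip B a) b)"
proof -
  note tr = basis_transversal[OF B]
  \<comment> \<open>\<open>T1\<close> and \<open>T2\<close> are chosen so that the two remaining
    terms are \<open>B\<close> against the far corner, at \<open>star a\<close>, and the two given
    exchanges against each other, at \<open>b\<close>.\<close>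
  define T1 where "T1 = flip B a"
  define T2 where "T2 = flip (flip (flip B b) c) d"
  have inB: "a \<in> B" "b \<in> B" "c \<in> B" "d \<in> B" using abcd by auto
  have st: "star a \<notin> B" "star b \<notin> B" "star c \<notin> B" "star d \<notin> B"
    using transversal_star[OF tr] inB by auto
  have gr: "a \<in> ground n" "b \<in> ground n" "c \<in> ground n" "d \<in> ground n"
    using in_transversal_ground[OF tr] inB by auto
  have neq: "a \<noteq> b" "a \<noteq> c" "a \<noteq> d" "b \<noteq> c" "b \<noteq> d" "c \<noteq> d" using abcd(2) by auto
  have sneq: "x \<noteq> star z" if "x \<in> {a, b, c, d}" "z \<in> {a, b, c, d}" for x z
    using that inB st by auto
  have T: "T1 \<in> transversals n" "T2 \<in> transversals n"
    unfolding T1_def T2_def using flip_transversal tr gr by simp_all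
  have T1m: "star a \<in> T1" "b \<in> T1" "c \<in> T1" "d \<in> T1" "a \<notin> T1"
    using inB st neq sneq by (simp_all add: T1_def in_flip_iff)
  have D: "T1 - T2 = {d, c, b, star a}"
  proof -
    have 0: "T1 - B = {star a}"
      using st inB by (auto simp: T1_def in_flip_iff split: if_splits)
    have 1: "T1 - flip B b = {b, star a}"
      using diff_flip[OF T(1) T1m(2) inB(2)] 0 by simp
    have "c \<in> flip B b" "d \<in> flip (flip B b) c"
      using inB neq sneq by (simp_all add: in_flip_iff)
    then show ?thesis
      unfolding T2_def using diff_flip[OF T(1) T1m(3), of "flip B b"]
        diff_flip[OF T(1) T1m(4), of "flip (flip B b) c"] 1 by simp
  qed
  have f1: "flip T1 (star a) = B" "flip T1 b = flip (flip B a) b"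
    by (simp_all add: T1_def)
  have f2: "flip T2 (star b) = flip (flip B c) d"
    unfolding T2_def by (simp add: flip_commute)
  have f2': "flip T2 a = flip (flip (flip (flip B a) b) c) d"
    unfolding T2_def by (simp only: flip_commute)
  have c1: "b \<in> circ T1" "star a \<in> circ T1"
    unfolding circ_def using T1m f1 ab B by simp_all
  have T2m: "star b \<in> T2"
    using st neq sneq inB by (simp add: T2_def in_flip_iff)
  have c2: "star b \<in> circ T2"
    unfolding circ_def using T2m f2 cd by simp
  have only: "x = b \<or> x = star a" if "x \<in> circ T1" "star x \<in> circ T2" for x
  proof -
    have "x \<in> T1" "star x \<in> T2" using that circ_subset by blast+
    then have "x \<in> T1 - T2" using transversal_star[OF T(2), of "star x"] by auto
    moreover have "x \<noteq> c" "x \<noteq> d"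
      using that(1) no by (auto simp: circ_def T1_def)
    ultimately show ?thesis using D by blast
  qed
  have sg: "star a \<in> ground n" and ba: "b \<noteq> star a" using gr sneq by simp_all
  note yp = entry_pair[OF T c1(1) c2 sg ba only]
  have c2': "a \<in> circ T2" using yp(2) by simp
  then show "flip (flip (flip (flip B a) b) c) d \<in> \<B>"
    unfolding circ_def mem_Collect_eq f2' by blast
  have idx: "index ` (T1 - T2) = index ` {a, b, c, d}"
    unfolding D by auto
  define s where "s = epow (Suc (rk {a, b, c, d} a + rk {a, b, c, d} b))"
  have "rk (T1 - T2) b = rk {a, b, c, d} b" "rk (T1 - T2) (star a) = rk {a, b, c, d} a"
    unfolding rk_def idx by simp_all
  then have eq: "entry T1 (star a) \<otimes> entry T2 a = s \<otimes> (entry T1 b \<otimes> entry T2 (star b))"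
    using yp(3) by (simp add: s_def add.commute)
  have g1: "\<gamma> B (flip (flip B a) b) = entry T1 b \<otimes> inv (entry T1 (star a))"
    using gamma_eq[OF T(1) c1(2,1)] ba f1 by simp
  have sba: "star b \<noteq> a" using sneq by force
  have g2: "\<gamma> (flip (flip B c) d) (flip (flip (flip (flip B a) b) c) d) = entry T2 a \<otimes> inv (entry T2 (star b))"
    using gamma_eq[OF T(2) c2 c2' sba] unfolding f2 f2' .
  note cl = entry_closed(1)[OF T(1) c1(1)] entry_closed(1)[OF T(1) c1(2)] entry_closed(1)[OF T(2) c2] entry_closed(1)[OF T(2) c2']
  have scl: "s \<in> carrier F" by (simp add: s_def)
  have "entry T2 a = s \<otimes> (entry T1 b \<otimes> entry T2 (star b)) \<otimes> inv (entry T1 (star a))"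
    using eq cl scl by (metis inv_closed inv_solve_right m_closed m_comm)
  then show "\<gamma> (flip (flip B c) d) (flip (flip (flip (flip B a) b) c) d) =
       epow (Suc (rk {a, b, c, d} a + rk {a, b, c, d} b)) \<otimes> \<gamma> B (flip (flip B a) b)"
    unfolding g1 g2 s_def[symmetric] using cl scl by (simp add: m_ac mult_inv_cancel)
qed

lemma adj_gamma_closed: "adj B B' \<Longrightarrow> \<gamma> B B' \<in> carrier F"
  unfolding adj_def using gamma_eq entry_closed(1) by (metis inv_closed m_closed)

lemma cocycle: "basis_cocycle n \<B> F \<gamma>"
proof unfold_locales
  fix B B' assume a: "adj B B'"
  show "\<gamma> B B' \<in> carrier F" by (rule adj_gamma_closed[OF a])
  obtain T e f where T: "T \<in> transversals n" "e \<in> circ T" "f \<in> circ T" "e \<noteq> f" "B = flip T e" "B' = flip T f"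
    using a unfolding adj_def by blast
  note cl = entry_closed(1)[OF T(1,2)] entry_closed(1)[OF T(1,3)]
  show "\<gamma> B' B = inv (\<gamma> B B')"
    using gamma_eq[OF T(1,2,3,4)] gamma_eq[OF T(1,3,2)] T(4,5,6) cl by (simp add: inv_mult m_comm)
next
  fix T e f g assume T: "T \<in> transversals n" "e \<in> circ T" "f \<in> circ T" "g \<in> circ T" "e \<noteq> f" "f \<noteq> g" "e \<noteq> g"
  note cl = entry_closed(1)[OF T(1,2)] entry_closed(1)[OF T(1,3)] entry_closed(1)[OF T(1,4)]
  have "entry T f \<otimes> inv (entry T e) \<otimes> (entry T g \<otimes> inv (entry T f)) = entry T g \<otimes> inv (entry T e) \<otimes> (entry T f \<otimes> inv (entry T f))"
    using cl by (simp only: m_ac m_closed inv_closed)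
  then show "\<gamma> (flip T e) (flip T f) \<otimes> \<gamma> (flip T f) (flip T g) = \<gamma> (flip T e) (flip T g)"
    using gamma_eq[OF T(1,2,3,5)] gamma_eq[OF T(1,3,4,6)] gamma_eq[OF T(1,2,4,7)] cl by simp
next
  fix B a b c d
  assume B: "B \<in> \<B>" and abcd: "{a, b, c, d} \<subseteq> B" "distinct [a, b, c, d]"
    and ab: "flip (flip B a) b \<in> \<B>" and cd: "flip (flip B c) d \<in> \<B>"
    and no: "flip (flip B a) c \<notin> \<B>" "flip (flip B a) d \<notin> \<B>" "flip (flip B b) c \<notin> \<B>" "flip (flip B b) d \<notin> \<B>"
  let ?R = "flip (flip (flip (flip B a) b) c) d"
  have R: "flip (flip (flip (flip B c) d) a) b = ?R" by (simp only: flip_commute)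
  \<comment> \<open>Used with the pairs in both orders, \<open>half_square\<close> compares both
    pairs of parallel edges. The two signs coincide by \<open>rank_sum_parity\<close>, so both paths
    to the far corner have the same product.\<close>
  note h1 = half_square[OF B abcd ab cd no(1,2)]
  have "{c, d, a, b} \<subseteq> B" "distinct [c, d, a, b]" "flip (flip B c) a \<notin> \<B>" "flip (flip B c) b \<notin> \<B>"
    using abcd no by (auto simp: flip_commute)
  note h2 = half_square[OF B this(1,2) cd ab this(3,4), unfolded R]
  have set: "{c, d, a, b} = {a, b, c, d}" by auto
  have "distinct [index a, index b, index c, index d]"
    using abcd transversal_star[OF basis_transversal[OF B]] by (auto simp: index_eq_iff)
  from rank_sum_parity[OF this]
  have "even (rk {a, b, c, d} a + rk {a, b, c, d} b) \<longleftrightarrow> even (rk {a, b, c, d} c + rk {a, b, c, d} d)"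
    unfolding rk_def by simp
  then have s: "epow (Suc (rk {a, b, c, d} a + rk {a, b, c, d} b)) = epow (Suc (rk {a, b, c, d} c + rk {a, b, c, d} d))"
    by (intro epow_parity) simp
  have "adj B (flip (flip B a) b)" "adj B (flip (flip B c) d)"
    using adj_flip2(5)[OF B] abcd ab cd by auto
  then have cl: "\<gamma> B (flip (flip B a) b) \<in> carrier F" "\<gamma> B (flip (flip B c) d) \<in> carrier F"
    using adj_gamma_closed by blast+
  show "?R \<in> \<B> \<and> \<gamma> B (flip (flip B a) b) \<otimes> \<gamma> (flip (flip B a) b) ?R = \<gamma> B (flip (flip B c) d) \<otimes> \<gamma> (flip (flip B c) d) ?R"
    using h1 h2 cl unfolding set s by (simp add: m_ac)
qed

lemma wick_function_exists:
  obtains \<phi> where "\<phi> \<in> strong_wick F n" "signature_of_matroid F id n (wick_class \<phi>) = \<C>"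
proof -
  interpret basis_cocycle n \<B> F \<gamma> by (rule cocycle)
  obtain p where p: "\<And>B. p B \<in> carrier F" "\<And>B B'. adj B B' \<Longrightarrow> p B' = p B \<otimes> \<gamma> B B'"
    using potential_exists by blast
  define \<phi> where "\<phi> B = (if B \<in> \<B> then Some (p B) else None)" for B
  have K: "\<phi> B \<in> K" for B using p(1) by (simp add: \<phi>_def)
  have supp: "supp (wv \<phi> T) = circ T" for T
    by (auto simp: supp_def wv_def circ_def \<phi>_def split: if_splits)
  have proportion: "\<exists>a \<in> carrier F. wv \<phi> T = scale (Some a) (circuit_vector T)" if T: "T \<in> transversals n" and e: "e \<in> circ T" for T e
  proof -
    \<comment> \<open>One coordinate \<open>e\<close> determines the factor; that it also serves any
      other \<open>f\<close> is the potential equation along the edge from \<open>flip T e\<close>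
      to \<open>flip T f\<close>.\<close>
    define a where "a = p (flip T e) \<otimes> inv (entry T e)"
    note ye = entry_closed[OF T e]
    have a: "a \<in> carrier F" using p(1) ye by (simp add: a_def)
    have X: "supp (circuit_vector T) = circ T" using circuit_vector(2)[OF T] e by blast
    have "wv \<phi> T f = Some a \<odot> circuit_vector T f" for f
    proof (cases "f \<in> circ T")
      case True
      note yf = entry_closed[OF T True]
      have "p (flip T f) = a \<otimes> entry T f"
      proof (cases "f = e")
        case True
        then show ?thesis using p(1) ye by (simp add: a_def m_assoc)
      next
        case False
        then have "adj (flip T e) (flip T f)" unfolding adj_def using T e True by metis
        then have "p (flip T f) = p (flip T e) \<otimes> (entry T f \<otimes> inv (entry T e))"
          using p(2) gamma_eq[OF T e True] False by simp
        then show ?thesis using p(1) ye yf by (simp add: a_def m_ac)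
      qed
      moreover have "f \<in> T" "flip T f \<in> \<B>" using True by (simp_all add: circ_def)
      ultimately show ?thesis
        using a yf by (simp add: wv_def \<phi>_def m_ac)
    next
      case False
      then have "wv \<phi> T f = None" "circuit_vector T f = None"
        using supp[of T] X by (metis in_supp_iff)+
      then show ?thesis by simp
    qed
    then show ?thesis using a by (auto simp: scale_def)
  qed
  have wick: "\<phi> \<in> strong_wick F n"
    unfolding strong_wick_iff
  proof (intro conjI allI impI ballI)
    show "\<phi> T \<in> K" for T by (rule K)
    show "\<phi> T = None" if "T \<notin> transversals n" for T
      using that basis_transversal by (auto simp: \<phi>_def)
    show "\<exists>T. \<phi> T \<noteq> None"
      using bases_nonempty by (auto simp: \<phi>_def)
    fix T1 T2 assume T: "T1 \<in> transversals n" "T2 \<in> transversals n"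
    show "orth n (wv \<phi> T1) (wv \<phi> T2)"
    proof (cases "circ T1 = {} \<or> circ T2 = {}")
      case True
      then have "wv \<phi> T1 x = None \<or> wv \<phi> T2 (star x) = None" for x
        using in_supp_iff[of x "wv \<phi> T1"] in_supp_iff[of "star x" "wv \<phi> T2"]
        unfolding supp by blast
      then show ?thesis by (rule orth_disjoint)
    next
      case False
      then obtain a1 a2 where a: "a1 \<in> carrier F" "wv \<phi> T1 = scale (Some a1) (circuit_vector T1)"
          "a2 \<in> carrier F" "wv \<phi> T2 = scale (Some a2) (circuit_vector T2)"
        using proportion[OF T(1)] proportion[OF T(2)] by (metis ex_in_conv)
      have X: "circuit_vector T1 \<in> \<C>" "circuit_vector T2 \<in> \<C>" using circuit_vector(1) T False by blast+
      then have V: "circuit_vector T1 \<in> V n" "circuit_vector T2 \<in> V n" using C_vecs by blast+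
      have "orth n (scale (Some a1) (circuit_vector T1)) (scale (Some a2) (circuit_vector T2))"
        using strong[OF X] a(1,3) V by (simp add: orth_scale)
      then show ?thesis using a by simp
    qed
  qed
  interpret W: wick F n \<phi> by unfold_locales (rule wick)
  have bas: "W.bases = \<B>" by (auto simp: W.bases_def \<phi>_def)
  have circ: "W.circ T = circ T" for T by (simp add: W.circ_def circ_def bas)
  have "W.vectors = \<C>"
  proof (intro subset_antisym subsetI)
    fix X assume "X \<in> W.vectors"
    then obtain c T where X: "c \<in> carrier F" "T \<in> transversals n" "circ T \<noteq> {}" "X = scale (Some c) (wv \<phi> T)"
      unfolding W.vectors_iff circ by blast
    then obtain a where "a \<in> carrier F" "wv \<phi> T = scale (Some a) (circuit_vector T)"
      using proportion[OF X(2)] by (metis ex_in_conv)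
    then show "X \<in> \<C>"
      using X C_scale circuit_vector(1)[OF X(2,3)] by simp
  next
    \<comment> \<open>For the converse inclusion, a Wick vector with the support of \<open>X\<close>
      is proportional to \<open>X\<close>, and \<open>W.vectors\<close> is closed under
      units.\<close>
    fix X assume X: "X \<in> \<C>"
    then obtain Y where Y: "Y \<in> W.vectors" "supp Y = supp X"
      using C_circuit[OF X] W.circuit_C[of "supp X"] bas by auto
    obtain a where a: "a \<in> carrier F" "Y = scale (Some a) X"
    proof (rule proportional[OF W.C_vecs[OF Y(1)] _ X])
      fix Z assume Z: "Z \<in> \<C>"
      obtain c T where c: "c \<in> carrier F" "T \<in> transversals n" "circ T \<noteq> {}" "Y = scale (Some c) (wv \<phi> T)"
        using Y(1) unfolding W.vectors_iff circ by blast
      then obtain a where "a \<in> carrier F" "wv \<phi> T = scale (Some a) (circuit_vector T)"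
        using proportion[OF c(2)] by (metis ex_in_conv)
      then have "Y \<in> \<C>" using c C_scale circuit_vector(1)[OF c(2,3)] by simp
      then show "orth n Y Z" using strong Z by blast
    qed (use Y(2) in auto)
    have "X = scale (ti (Some a)) Y"
      using scale_scale_ti(1)[of "Some a" X] a C_vecs[OF X] by simp
    then show "X \<in> W.vectors"
      using W.C_scale[OF Y(1), of "ti (Some a)"] a(1) by simp
  qed
  then show thesis
    using that[OF wick] W.signature_of_matroid_class by simp
qed

end


section \<open>The bijections for the trivial involution\<close>

context tract
begin

lemma strong_signature_iff:
  "strong_signature F n \<B> \<C> \<longleftrightarrow> orthogonal_matroid n \<B> \<and> strong_orthogonal_signature_of F id n \<B> \<C>"
proof
  assume "strong_signature F n \<B> \<C>"
  then interpret strong_signature F n \<B> \<C> .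
  show "orthogonal_matroid n \<B> \<and> strong_orthogonal_signature_of F id n \<B> \<C>"
    using orth_matroid sign strong by (simp add: strong_orthogonal_signature_of_def inner_prod_id)
next
  assume "orthogonal_matroid n \<B> \<and> strong_orthogonal_signature_of F id n \<B> \<C>"
  then show "strong_signature F n \<B> \<C>"
    by unfold_locales (simp_all add: strong_orthogonal_signature_of_def inner_prod_id)
qed

text \<open>Both notions contain two-term orthogonality, and once that is granted
  \<open>strong_iff_span\<close> compares what remains.\<close>

lemma strong_circuit_set_of_iff:
  assumes "orthogonal_matroid n \<B>"
  shows "strong_circuit_set_of F id n \<B> \<C> \<longleftrightarrow> strong_orthogonal_signature_of F id n \<B> \<C>"
proof (cases "signature F id n \<B> \<C> \<and>
    (\<forall>X \<in> \<C>. \<forall>Y \<in> \<C>. card (supp X \<inter> star ` supp Y) = 2 \<longrightarrow> orth n X Y)")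
  case True
  then interpret circuit_signature F n \<B> \<C>
    using assms by unfold_locales auto
  show ?thesis
    using strong_iff_span True
    by (simp add: strong_circuit_set_of_def strong_orthogonal_signature_of_def inner_prod_id)
next
  case False
  then show ?thesis
    by (auto simp: strong_circuit_set_of_def strong_orthogonal_signature_of_def inner_prod_id)
qed

lemma strong_circuit_sets_id: "strong_circuit_sets F id n = strong_orthogonal_signatures F id n"
  by (auto simp: strong_circuit_sets_def strong_orthogonal_signatures_def strong_circuit_set_of_iff)

lemma strong_signatures_id: "\<C> \<in> strong_orthogonal_signatures F id n \<longleftrightarrow> (\<exists>\<B>. strong_signature F n \<B> \<C>)"
  by (simp add: strong_orthogonal_signatures_def strong_signature_iff)

lemma bij_signature_id:
  "bij_betw (signature_of_matroid F id n) (strong_orthogonal_matroids F n) (strong_orthogonal_signatures F id n)"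
  unfolding bij_betw_def
proof
  show "inj_on (signature_of_matroid F id n) (strong_orthogonal_matroids F n)"
    using signature_injective by (auto simp: inj_on_def strong_orthogonal_matroids_eq)
  show "signature_of_matroid F id n ` strong_orthogonal_matroids F n = strong_orthogonal_signatures F id n"
  proof (intro subset_antisym subsetI)
    fix \<C> assume "\<C> \<in> signature_of_matroid F id n ` strong_orthogonal_matroids F n"
    then obtain \<phi> where \<phi>: "\<phi> \<in> strong_wick F n" "\<C> = signature_of_matroid F id n (wick_class \<phi>)"
      by (auto simp: strong_orthogonal_matroids_eq)
    interpret wick F n \<phi> by unfold_locales (rule \<phi>(1))
    have "\<C> = vectors" using \<phi>(2) signature_of_matroid_class by simp
    then show "\<C> \<in> strong_orthogonal_signatures F id n"
      unfolding strong_signatures_id using strong_signature_axioms by blast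
  next
    fix \<C> assume "\<C> \<in> strong_orthogonal_signatures F id n"
    then obtain \<B> where "strong_signature F n \<B> \<C>" unfolding strong_signatures_id by blast
    then interpret strong_signature F n \<B> \<C> .
    show "\<C> \<in> signature_of_matroid F id n ` strong_orthogonal_matroids F n"
      using wick_function_exists unfolding strong_orthogonal_matroids_eq by (metis imageI)
  qed
qed

lemma circuits_to_vectors_id:
  assumes "\<C> \<in> strong_circuit_sets F id n"
  shows "fundamental_span F id n \<C> \<in> orthogonal_vector_sets F id n"
    "elementary_vectors n (fundamental_span F id n \<C>) = \<C>"
proof -
  obtain \<B> where "strong_signature F n \<B> \<C>"
    using assms unfolding strong_circuit_sets_id strong_signatures_id by blast
  then interpret strong_signature F n \<B> \<C> .
  show "fundamental_span F id n \<C> \<in> orthogonal_vector_sets F id n"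
    "elementary_vectors n (fundamental_span F id n \<C>) = \<C>"
    using orthogonal_vector_set_perp elementary_perp
    by (simp_all add: fundamental_span_perp orthogonal_vector_sets_def)
qed

lemma vectors_to_circuits_id:
  assumes "\<V> \<in> orthogonal_vector_sets F id n"
  shows "elementary_vectors n \<V> \<in> strong_circuit_sets F id n"
    "fundamental_span F id n (elementary_vectors n \<V>) = \<V>"
proof -
  interpret vector_set F n \<V>
    using assms by unfold_locales (simp add: orthogonal_vector_sets_def)
  show "elementary_vectors n \<V> \<in> strong_circuit_sets F id n"
    unfolding strong_circuit_sets_id strong_signatures_id using strong_signature_axioms elem_def by metis
  show "fundamental_span F id n (elementary_vectors n \<V>) = \<V>"
    using fundamental_span_elem by (simp add: elem_def)
qed

end


section \<open>Reduction to the trivial involution\<close>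

text \<open>
  All conditions depend on the involution only through \<^term>\<open>tilde \<sigma>\<close>, which is a bijection of
  the ambient space; so applying it to every vector turns the involution into the identity.
\<close>

locale tract_inv = tract F for F :: "('g, 'b) tract_scheme" (structure) +
  fixes \<sigma> :: "'g \<Rightarrow> 'g"
  assumes involution: "tract_involution F \<sigma>"
begin

abbreviation tld :: "(elt \<Rightarrow> 'g option) \<Rightarrow> elt \<Rightarrow> 'g option" where "tld \<equiv> tilde \<sigma>"

lemma sigma_hom: "\<sigma> \<in> hom F F" and sigma_sigma: "x \<in> carrier F \<Longrightarrow> \<sigma> (\<sigma> x) = x"
  using involution by (simp_all add: tract_involution_def tract_hom_def)

lemma sigma_closed: "x \<in> carrier F \<Longrightarrow> \<sigma> x \<in> carrier F"
  using sigma_hom by (auto simp: hom_def)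

lemma sigma_one: "\<sigma> \<one> = \<one>"
  using sigma_hom by (simp add: hom_one is_group)

lemma supp_tld [simp]: "supp (tld X) = supp X"
proof -
  have "tld X e = None \<longleftrightarrow> X e = None" for e
    by (cases e) (simp_all add: tilde_def)
  then show ?thesis by (simp add: supp_def)
qed

lemma tld_zero_iff [simp]: "tld X = zero_vec \<longleftrightarrow> X = zero_vec"
  by (simp add: zero_vec_iff)

lemma tld_vecs [simp]: "X \<in> V n \<Longrightarrow> tld X \<in> V n"
proof -
  assume X: "X \<in> V n"
  have "tld X e \<in> K" for e
    using vecs_K[OF X, of e] sigma_closed by (cases e; cases "X e") (simp_all add: tilde_def)
  then show ?thesis using X by (simp add: vecs_iff)
qed

lemma tld_tld: "X \<in> V n \<Longrightarrow> tld (tld X) = X"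
proof
  fix e assume "X \<in> V n"
  then have "X e \<in> K" by simp
  then show "tld (tld X) e = X e"
    using sigma_sigma by (cases e; cases "X e") (simp_all add: tilde_def)
qed

text \<open>The involution fixes \<open>\<one>\<close>, so normalised forms stay normalised.\<close>

lemma tld_one_iff: "X \<in> V n \<Longrightarrow> tld X e = Some \<one> \<longleftrightarrow> X e = Some \<one>"
proof -
  have *: "tld X e = Some \<one>" if "X e = Some \<one>" for X e
    using that sigma_one by (cases e) (simp_all add: tilde_def)
  assume "X \<in> V n"
  then show ?thesis using *[of X e] *[of "tld X" e] tld_tld by metis
qed

lemma tld_image_subset: "C \<subseteq> V n \<Longrightarrow> tld ` C \<subseteq> V n"
  by auto

lemma tld_image_image: "C \<subseteq> V n \<Longrightarrow> tld ` tld ` C = C"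
proof -
  assume "C \<subseteq> V n"
  then have "tld ` tld ` C = (\<lambda>X. X) ` C"
    unfolding image_image using tld_tld by (intro image_cong) blast+
  then show ?thesis by simp
qed

lemma tld_mem_iff: "C \<subseteq> V n \<Longrightarrow> X \<in> V n \<Longrightarrow> tld X \<in> tld ` C \<longleftrightarrow> X \<in> C"
proof
  assume C: "C \<subseteq> V n" and X: "X \<in> V n"
  show "X \<in> C" if mem: "tld X \<in> tld ` C"
  proof -
    obtain Y where Y: "Y \<in> C" "tld X = tld Y" using mem by blast
    then have "X = Y" using tld_tld[OF X] tld_tld[of Y n] C by (metis subsetD)
    then show ?thesis using Y(1) by simp
  qed
qed blast

text \<open>In a pairing with \<open>star_vec Y\<close>, conjugation falls exactly on the starred
  coordinates of \<open>X\<close> and of \<open>Y\<close>.\<close>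

lemma inner_prod_tld: "inner_prod F \<sigma> n X (star_vec Y) = inner_prod F id n (tld X) (star_vec (tld Y))"
  by (simp add: inner_prod_def star_vec_def tilde_def option.map_id)

text \<open>The conjugate factor that \<open>smult\<close> puts on starred coordinates becomes the
  plain factor under \<open>tld\<close>.\<close>

lemma tld_smult: "X \<in> V n \<Longrightarrow> a \<in> carrier F \<Longrightarrow> tld (smult F \<sigma> (Some a) X) = smult F id (Some a) (tld X)"
  using tilde_smult[OF involution, of "Some a" X n] by (simp add: smult_id scale_def)

lemma smult_vecs: "X \<in> V n \<Longrightarrow> a \<in> carrier F \<Longrightarrow> smult F \<sigma> (Some a) X \<in> V n"
proof -
  assume X: "X \<in> V n" and a: "a \<in> carrier F"
  have "smult F \<sigma> (Some a) X e \<in> K" for e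
    using vecs_K[OF X, of e] a sigma_closed[OF a] by (auto simp: smult_def split: elt.splits)
  moreover have "smult F \<sigma> (Some a) X e = None \<longleftrightarrow> X e = None" for e
    by (cases e) (simp_all add: smult_def)
  then have "supp (smult F \<sigma> (Some a) X) = supp X"
    by (simp add: supp_def)
  ultimately show ?thesis using X by (simp add: vecs_iff)
qed

lemma signature_tld:
  assumes C: "C \<subseteq> V n"
  shows "signature F \<sigma> n \<B> C \<longleftrightarrow> signature F id n \<B> (tld ` C)"
proof -
  have "smult F \<sigma> (Some a) X \<in> C \<longleftrightarrow> smult F id (Some a) (tld X) \<in> tld ` C" if "X \<in> C" "a \<in> carrier F" for X a
  proof -
    have X: "X \<in> V n" using C that by blast
    show ?thesis
      using tld_mem_iff[OF C smult_vecs[OF X that(2)]] tld_smult[OF X that(2)] by simp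
  qed
  moreover have "supp ` tld ` C = supp ` C" by (simp add: image_image)
  ultimately show ?thesis
    using C tld_image_subset[OF C] by (simp add: signature_def)
qed

lemma strong_orthogonal_signature_tld:
  assumes C: "C \<subseteq> V n"
  shows "strong_orthogonal_signature_of F \<sigma> n \<B> C \<longleftrightarrow> strong_orthogonal_signature_of F id n \<B> (tld ` C)"
  by (simp add: strong_orthogonal_signature_of_def signature_tld[OF C] inner_prod_tld)

lemma lin_span_cong:
  "(\<And>i. i \<in> I \<Longrightarrow> Xs i = Ys i) \<Longrightarrow> lin_span F n I Xs = lin_span F n I Ys"
  by (simp add: lin_span_def)

lemma strong_circuit_set_tld:
  assumes C: "C \<subseteq> V n"
  shows "strong_circuit_set_of F \<sigma> n \<B> C \<longleftrightarrow> strong_circuit_set_of F id n \<B> (tld ` C)"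
proof -
  have "(\<forall>Xs. (\<forall>e \<in> star ` B. Xs e \<in> C \<and> supp (Xs e) = fund_circuit n \<B> B e) \<longrightarrow>
        tld X \<in> lin_span F n (star ` B) (\<lambda>e. tld (Xs e))) \<longleftrightarrow>
      (\<forall>Ys. (\<forall>e \<in> star ` B. Ys e \<in> tld ` C \<and> supp (Ys e) = fund_circuit n \<B> B e) \<longrightarrow>
        tld X \<in> lin_span F n (star ` B) Ys)" (is "?L \<longleftrightarrow> ?R") for X B
  proof (intro iffI allI impI)
    fix Ys assume L: ?L and Ys: "\<forall>e \<in> star ` B. Ys e \<in> tld ` C \<and> supp (Ys e) = fund_circuit n \<B> B e"
    have YV: "Ys e \<in> V n" if "e \<in> star ` B" for e
      using Ys that tld_image_subset[OF C] by blast
    have "tld (Ys e) \<in> C \<and> supp (tld (Ys e)) = fund_circuit n \<B> B e" if e: "e \<in> star ` B" for e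
    proof -
      obtain Z where "Z \<in> C" "Ys e = tld Z" using Ys e by blast
      then have "tld (Ys e) \<in> C" using tld_tld[of Z n] C by auto
      moreover have "supp (Ys e) = fund_circuit n \<B> B e" using Ys e by blast
      ultimately show ?thesis by simp
    qed
    then have "tld X \<in> lin_span F n (star ` B) (\<lambda>e. tld (tld (Ys e)))"
      using L[THEN spec, of "\<lambda>e. tld (Ys e)"] by blast
    then show "tld X \<in> lin_span F n (star ` B) Ys"
      using lin_span_cong[of "star ` B" "\<lambda>e. tld (tld (Ys e))" Ys] tld_tld[OF YV] by blast
  next
    fix Xs assume R: ?R and Xs: "\<forall>e \<in> star ` B. Xs e \<in> C \<and> supp (Xs e) = fund_circuit n \<B> B e"
    then have "tld (Xs e) \<in> tld ` C \<and> supp (tld (Xs e)) = fund_circuit n \<B> B e" if "e \<in> star ` B" for e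
      unfolding supp_tld using that by blast
    then show "tld X \<in> lin_span F n (star ` B) (\<lambda>e. tld (Xs e))"
      using R[THEN spec, of "\<lambda>e. tld (Xs e)"] by blast
  qed
  then show ?thesis
    by (simp add: strong_circuit_set_of_def signature_tld[OF C] inner_prod_tld)
qed

lemma tld_diff_zero: "tld ` C - {zero_vec} = tld ` (C - {zero_vec})"
proof (intro subset_antisym subsetI)
  fix Y assume "Y \<in> tld ` C - {zero_vec}"
  then obtain X where "X \<in> C" "Y = tld X" "tld X \<noteq> zero_vec" by blast
  then show "Y \<in> tld ` (C - {zero_vec})" by simp
next
  fix Y assume "Y \<in> tld ` (C - {zero_vec})"
  then obtain X where "X \<in> C" "X \<noteq> zero_vec" "Y = tld X" by blast
  then show "Y \<in> tld ` C - {zero_vec}" by simp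
qed

lemma elementary_tld: "elementary_vectors n (tld ` C) = tld ` elementary_vectors n C"
proof -
  have iff: "tld X \<in> elementary_vectors n (tld ` C) \<longleftrightarrow> X \<in> elementary_vectors n C" if X: "X \<in> C" for X
  proof -
    have "(\<forall>Y \<in> tld ` (C - {zero_vec}). \<not> supp Y \<subset> supp X) \<longleftrightarrow> (\<forall>Y \<in> C - {zero_vec}. \<not> supp Y \<subset> supp X)"
      unfolding ball_simps supp_tld ..
    then show ?thesis
      unfolding elementary_vectors_def tld_diff_zero mem_Collect_eq supp_tld tld_zero_iff using X by (metis imageI)
  qed
  show ?thesis
  proof (intro subset_antisym subsetI)
    fix Y assume Y: "Y \<in> elementary_vectors n (tld ` C)"
    then have "Y \<in> tld ` C" by (simp add: elementary_vectors_def)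
    then obtain X where "X \<in> C" "Y = tld X" by blast
    then show "Y \<in> tld ` elementary_vectors n C" using iff[of X] Y by simp
  next
    fix Y assume "Y \<in> tld ` elementary_vectors n C"
    then obtain X where X: "X \<in> elementary_vectors n C" "Y = tld X" by blast
    then have "X \<in> C" unfolding elementary_vectors_def by simp
    then show "Y \<in> elementary_vectors n (tld ` C)" using iff[of X] X by simp
  qed
qed

lemma support_basis_tld: "support_basis n (tld ` C) B \<longleftrightarrow> support_basis n C B"
  unfolding support_basis_def tld_diff_zero by simp

lemma fund_circuit_form_tld:
  assumes C: "C \<subseteq> V n"
  shows "fund_circuit_form F C B Xs \<Longrightarrow> fund_circuit_form F (tld ` C) B (\<lambda>e. tld (Xs e))"
proof -
  assume form: "fund_circuit_form F C B Xs"
  have "tld (Xs e) \<in> tld ` C \<and> supp (tld (Xs e)) \<subseteq> sym_diff B {e, star e} \<and> tld (Xs e) e = Some \<one>"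
    if "e \<in> star ` B" for e
  proof -
    have X: "Xs e \<in> C" "supp (Xs e) \<subseteq> sym_diff B {e, star e}" "Xs e e = Some \<one>"
      using form that unfolding fund_circuit_form_def by blast+
    then have "tld (Xs e) e = Some \<one>" using tld_one_iff C by blast
    then show ?thesis using X by simp
  qed
  then show ?thesis unfolding fund_circuit_form_def by blast
qed

lemma fundamental_span_tld:
  assumes C: "C \<subseteq> V n"
  shows "fundamental_span F id n (tld ` C) = tld ` fundamental_span F \<sigma> n C"
proof -
  note C' = tld_image_subset[OF C]
  have iff: "tld X \<in> fundamental_span F id n (tld ` C) \<longleftrightarrow> X \<in> fundamental_span F \<sigma> n C" if X: "X \<in> V n" for X
  proof
    assume L: "tld X \<in> fundamental_span F id n (tld ` C)"
    have "tld X \<in> lin_span F n (star ` B) (\<lambda>e. tld (Xs e))"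
      if "support_basis n C B" "fund_circuit_form F C B Xs" for B Xs
    proof -
      have "tilde id (tld X) \<in> lin_span F n (star ` B) (\<lambda>e. tilde id (tld (Xs e)))"
        using L that fund_circuit_form_tld[OF C that(2)] support_basis_tld[of n C B]
        unfolding fundamental_span_def by blast
      then show ?thesis by simp
    qed
    then show "X \<in> fundamental_span F \<sigma> n C"
      using X by (simp add: fundamental_span_def)
  next
    assume R: "X \<in> fundamental_span F \<sigma> n C"
    have "tld X \<in> lin_span F n (star ` B) Ys"
      if B: "support_basis n C B" and form: "fund_circuit_form F (tld ` C) B Ys" for B Ys
    proof -
      have YV: "Ys e \<in> V n" if "e \<in> star ` B" for e
        using form that C' unfolding fund_circuit_form_def by blast
      \<comment> \<open>A form for the image comes from a form for \<open>C\<close>, because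
        \<open>tld\<close> is its own inverse on vectors.\<close>
      have "fund_circuit_form F C B (\<lambda>e. tld (Ys e))"
        using fund_circuit_form_tld[OF C' form] by (simp only: tld_image_image[OF C])
      then have "tld X \<in> lin_span F n (star ` B) (\<lambda>e. tld (tld (Ys e)))"
        using R B unfolding fundamental_span_def by blast
      then show ?thesis
        using lin_span_cong[of "star ` B" "\<lambda>e. tld (tld (Ys e))" Ys] tld_tld[OF YV] by blast
    qed
    then show "tld X \<in> fundamental_span F id n (tld ` C)"
      using X by (simp add: fundamental_span_def support_basis_tld)
  qed
  have sub: "fundamental_span F id n (tld ` C) \<subseteq> V n" "fundamental_span F \<sigma> n C \<subseteq> V n"
    by (auto simp: fundamental_span_def)
  show ?thesis
  proof (intro subset_antisym subsetI)
    fix X assume X: "X \<in> fundamental_span F id n (tld ` C)"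
    then have XV: "X \<in> V n" using sub by blast
    then have "tld X \<in> fundamental_span F \<sigma> n C"
      using iff[of "tld X"] X by (simp add: tld_tld)
    then show "X \<in> tld ` fundamental_span F \<sigma> n C"
      using tld_tld[OF XV] by (metis imageI)
  next
    fix X assume "X \<in> tld ` fundamental_span F \<sigma> n C"
    then show "X \<in> fundamental_span F id n (tld ` C)"
      using iff sub by blast
  qed
qed

lemma orthogonal_vector_set_tld:
  assumes C: "C \<subseteq> V n"
  shows "orthogonal_vector_set F \<sigma> n C \<longleftrightarrow> orthogonal_vector_set F id n (tld ` C)"
proof -
  note C' = tld_image_subset[OF C]
  let ?E = "elementary_vectors n C"
  have V1: "(\<forall>X \<in> tld ` ?E. \<forall>Y \<in> tld ` ?E. card (supp X \<inter> star ` supp Y) \<le> 2 \<longrightarrow>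
        inner_prod F id n X (star_vec Y) \<in> nulls F) \<longleftrightarrow>
      (\<forall>X \<in> ?E. \<forall>Y \<in> ?E. card (supp X \<inter> star ` supp Y) \<le> 2 \<longrightarrow>
        inner_prod F \<sigma> n X (star_vec Y) \<in> nulls F)"
    by (simp add: inner_prod_tld)
  have V2: "(\<exists>Xs. fund_circuit_form F (tld ` C) B Xs) \<longleftrightarrow> (\<exists>Xs. fund_circuit_form F C B Xs)" for B
    using fund_circuit_form_tld[OF C] fund_circuit_form_tld[OF C'] tld_image_image[OF C] by metis
  have "fundamental_span F \<sigma> n C \<subseteq> V n"
    by (auto simp: fundamental_span_def)
  then have V3: "tld ` C = fundamental_span F id n (tld ` C) \<longleftrightarrow> C = fundamental_span F \<sigma> n C"
    unfolding fundamental_span_tld[OF C] using tld_image_image[OF C] tld_image_image[of "fundamental_span F \<sigma> n C"]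
    by (metis (no_types))
  show ?thesis
    by (simp only: orthogonal_vector_set_def elementary_tld support_basis_tld V1 V2 V3 C C' simp_thms)
qed

section \<open>Transporting the families and the maps between them\<close>

lemma signatures_tld: "strong_orthogonal_signatures F \<sigma> n = {C. C \<subseteq> V n \<and> tld ` C \<in> strong_orthogonal_signatures F id n}"
proof (rule Set.set_eqI)
  fix C
  show "C \<in> strong_orthogonal_signatures F \<sigma> n \<longleftrightarrow> C \<in> {C. C \<subseteq> V n \<and> tld ` C \<in> strong_orthogonal_signatures F id n}"
  proof (cases "C \<subseteq> V n")
    case True
    then show ?thesis by (simp add: strong_orthogonal_signatures_def strong_orthogonal_signature_tld[OF True])
  next
    case False
    then have "\<not> strong_orthogonal_signature_of F \<sigma> n \<B> C" for \<B>
      unfolding strong_orthogonal_signature_of_def signature_def by blast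
    with False show ?thesis by (simp add: strong_orthogonal_signatures_def)
  qed
qed

lemma circuit_sets_tld: "strong_circuit_sets F \<sigma> n = {C. C \<subseteq> V n \<and> tld ` C \<in> strong_circuit_sets F id n}"
proof (rule Set.set_eqI)
  fix C
  show "C \<in> strong_circuit_sets F \<sigma> n \<longleftrightarrow> C \<in> {C. C \<subseteq> V n \<and> tld ` C \<in> strong_circuit_sets F id n}"
  proof (cases "C \<subseteq> V n")
    case True
    then show ?thesis by (simp add: strong_circuit_sets_def strong_circuit_set_tld[OF True])
  next
    case False
    then have "\<not> strong_circuit_set_of F \<sigma> n \<B> C" for \<B>
      unfolding strong_circuit_set_of_def signature_def by blast
    with False show ?thesis by (simp add: strong_circuit_sets_def)
  qed
qed

lemma vector_sets_tld: "orthogonal_vector_sets F \<sigma> n = {C. C \<subseteq> V n \<and> tld ` C \<in> orthogonal_vector_sets F id n}"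
proof (rule Set.set_eqI)
  fix C
  show "C \<in> orthogonal_vector_sets F \<sigma> n \<longleftrightarrow> C \<in> {C. C \<subseteq> V n \<and> tld ` C \<in> orthogonal_vector_sets F id n}"
  proof (cases "C \<subseteq> V n")
    case True
    then show ?thesis by (simp add: orthogonal_vector_sets_def orthogonal_vector_set_tld[OF True])
  next
    case False
    then have "\<not> orthogonal_vector_set F \<sigma> n C"
      unfolding orthogonal_vector_set_def by blast
    with False show ?thesis by (simp add: orthogonal_vector_sets_def)
  qed
qed

text \<open>Wick functions do not involve the involution; it enters only through the outer
  \<open>tilde\<close> of \<open>wick_vector\<close>.\<close>

lemma signature_of_matroid_tld: "signature_of_matroid F \<sigma> n M = tld ` signature_of_matroid F id n M"
proof -
  have w: "wick_vector F \<sigma> \<phi> T = tld (wick_vector F id \<phi> T)" for \<phi> T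
    unfolding wick_vector_def by simp
  have "{wick_vector F \<sigma> \<phi> T | \<phi> T. \<phi> \<in> M \<and> T \<in> transversals n} = tld ` {wick_vector F id \<phi> T | \<phi> T. \<phi> \<in> M \<and> T \<in> transversals n}"
    (is "?L = ?R")
  proof (intro subset_antisym subsetI)
    fix X assume "X \<in> ?L"
    then obtain \<phi> T where X: "X = tld (wick_vector F id \<phi> T)" and "\<phi> \<in> M" "T \<in> transversals n"
      unfolding w by blast
    then have "wick_vector F id \<phi> T \<in> {wick_vector F id \<phi> T | \<phi> T. \<phi> \<in> M \<and> T \<in> transversals n}" by blast
    then show "X \<in> ?R" unfolding X by (rule imageI)
  next
    fix X assume "X \<in> ?R"
    then obtain \<phi> T where "X = wick_vector F \<sigma> \<phi> T" "\<phi> \<in> M" "T \<in> transversals n"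
      unfolding w by blast
    then show "X \<in> ?L" by blast
  qed
  then show ?thesis
    unfolding signature_of_matroid_def by (simp only: tld_diff_zero)
qed

lemma bij_signature:
  "bij_betw (signature_of_matroid F \<sigma> n) (strong_orthogonal_matroids F n) (strong_orthogonal_signatures F \<sigma> n)"
proof -
  have sub: "C \<subseteq> V n" if "C \<in> strong_orthogonal_signatures F id n" for C
    using that unfolding strong_orthogonal_signatures_def strong_orthogonal_signature_of_def signature_def
    by (elim CollectE exE conjE)
  have "bij_betw ((`) tld) (strong_orthogonal_signatures F id n) (strong_orthogonal_signatures F \<sigma> n)"
  proof (rule bij_betw_byWitness[of _ "(`) tld"])
    show "\<forall>C \<in> strong_orthogonal_signatures F id n. tld ` tld ` C = C"
      by (intro ballI) (rule tld_image_image[OF sub])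
    show "\<forall>C \<in> strong_orthogonal_signatures F \<sigma> n. tld ` tld ` C = C"
      by (intro ballI tld_image_image[of _ n]) (simp add: signatures_tld)
    show "(`) tld ` strong_orthogonal_signatures F id n \<subseteq> strong_orthogonal_signatures F \<sigma> n"
    proof
      fix D assume "D \<in> (`) tld ` strong_orthogonal_signatures F id n"
      then obtain C where C: "C \<in> strong_orthogonal_signatures F id n" "D = tld ` C" by blast
      then show "D \<in> strong_orthogonal_signatures F \<sigma> n"
        using sub[OF C(1)] tld_image_image[of C] tld_image_subset[of C] by (simp add: signatures_tld)
    qed
    show "(`) tld ` strong_orthogonal_signatures F \<sigma> n \<subseteq> strong_orthogonal_signatures F id n"
      unfolding signatures_tld by blast
  qed
  from bij_betw_trans[OF bij_signature_id this]
  have "bij_betw (\<lambda>M. tld ` signature_of_matroid F id n M) (strong_orthogonal_matroids F n) (strong_orthogonal_signatures F \<sigma> n)"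
    by (simp only: comp_def)
  then show ?thesis
    by (simp add: signature_of_matroid_tld[abs_def])
qed

lemma circuits_to_vectors:
  assumes "C \<in> strong_circuit_sets F \<sigma> n"
  shows "vectors_of_circuits F \<sigma> n C \<in> orthogonal_vector_sets F \<sigma> n"
    "elementary_vectors n (vectors_of_circuits F \<sigma> n C) = C"
proof -
  have C: "C \<subseteq> V n" "tld ` C \<in> strong_circuit_sets F id n"
    using assms by (auto simp: circuit_sets_tld)
  let ?W = "fundamental_span F \<sigma> n C"
  have W: "?W \<subseteq> V n" by (auto simp: fundamental_span_def)
  note id = circuits_to_vectors_id[OF C(2), unfolded fundamental_span_tld[OF C(1)]]
  show "vectors_of_circuits F \<sigma> n C \<in> orthogonal_vector_sets F \<sigma> n"
    using id(1) W by (simp add: vector_sets_tld vectors_of_circuits_def)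
  have "elementary_vectors n ?W \<subseteq> V n" using W by (auto simp: elementary_vectors_def)
  then show "elementary_vectors n (vectors_of_circuits F \<sigma> n C) = C"
    using id(2) tld_image_image C(1) unfolding elementary_tld vectors_of_circuits_def by metis
qed

lemma vectors_to_circuits:
  assumes "C \<in> orthogonal_vector_sets F \<sigma> n"
  shows "elementary_vectors n C \<in> strong_circuit_sets F \<sigma> n"
    "vectors_of_circuits F \<sigma> n (elementary_vectors n C) = C"
proof -
  have C: "C \<subseteq> V n" "tld ` C \<in> orthogonal_vector_sets F id n"
    using assms by (auto simp: vector_sets_tld)
  let ?E = "elementary_vectors n C"
  have E: "?E \<subseteq> V n" using C by (auto simp: elementary_vectors_def)
  note id = vectors_to_circuits_id[OF C(2), unfolded elementary_tld]
  show "?E \<in> strong_circuit_sets F \<sigma> n"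
    using id(1) E by (simp add: circuit_sets_tld)
  have "fundamental_span F \<sigma> n ?E \<subseteq> V n" by (auto simp: fundamental_span_def)
  then show "vectors_of_circuits F \<sigma> n ?E = C"
    using id(2) tld_image_image C(1) unfolding fundamental_span_tld[OF E] vectors_of_circuits_def by metis
qed

end

theorem theorem1p2:
  fixes n :: nat and F :: "('g, 'b) tract_scheme" and \<sigma> :: "'g \<Rightarrow> 'g"
  assumes "tract F" and "tract_involution F \<sigma>"
  shows "bij_betw (signature_of_matroid F \<sigma> n)
           (strong_orthogonal_matroids F n) (strong_orthogonal_signatures F \<sigma> n)
       \<and> bij_betw (\<lambda>\<C>. \<C>)
           (strong_orthogonal_signatures F \<sigma> n) (strong_circuit_sets F \<sigma> n)
       \<and> bij_betw (vectors_of_circuits F \<sigma> n)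
           (strong_circuit_sets F \<sigma> n) (orthogonal_vector_sets F \<sigma> n)
       \<and> bij_betw (elementary_vectors n)
           (orthogonal_vector_sets F \<sigma> n) (strong_circuit_sets F \<sigma> n)
       \<and> (\<forall>\<C> \<in> strong_circuit_sets F \<sigma> n. elementary_vectors n (vectors_of_circuits F \<sigma> n \<C>) = \<C>)"
proof -
  interpret tract_inv F \<sigma>
    using assms by (simp add: tract_inv_def tract_inv_axioms_def)
  \<comment> \<open>After transport to the trivial involution, signatures and circuit sets are one
    family, so the second map is the identity.\<close>
  have same: "strong_orthogonal_signatures F \<sigma> n = strong_circuit_sets F \<sigma> n"
    by (simp add: signatures_tld circuit_sets_tld strong_circuit_sets_id)
  have "bij_betw (\<lambda>\<C>. \<C>) (strong_orthogonal_signatures F \<sigma> n) (strong_circuit_sets F \<sigma> n)"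
    unfolding same by (simp add: bij_betw_def)
  moreover have "bij_betw (vectors_of_circuits F \<sigma> n) (strong_circuit_sets F \<sigma> n) (orthogonal_vector_sets F \<sigma> n)"
    using circuits_to_vectors vectors_to_circuits
    by (intro bij_betw_byWitness[of _ "elementary_vectors n"]) auto
  moreover have "bij_betw (elementary_vectors n) (orthogonal_vector_sets F \<sigma> n) (strong_circuit_sets F \<sigma> n)"
    using circuits_to_vectors vectors_to_circuits
    by (intro bij_betw_byWitness[of _ "vectors_of_circuits F \<sigma> n"]) auto
  ultimately show ?thesis
    using bij_signature circuits_to_vectors(2) by simp
qed

end
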